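(* Suppose $M$ is a dense linear order with no first nor last element, $M$ is a suborder of the reals, and for every perfect set $P$ of reals the set $P\cap|M|$ is countable, or even only of cardinality $<2^{\aleph_0}$. Then the monadic theory of $M$ is the monadic theory of the rationals $(\mathbb{Q},<)$.
   Context: $|M|$ is the universe of $M$; structures are nonempty. In this paper a perfect set means a closed, nowhere dense set of reals with no isolated points and at least two points. The monadic theory of an order is the set of sentences of monadic second-order logic (first-order logic with quantification over arbitrary subsets of the universe) in the language $\{<\}$ that are true in it. *)

theory Defs
  imports "HOL-Analysis.Analysis" "HOL-Library.Equipollence"
begin

(* Formulas of monadic second-order logic in the language {<}, with equality. Element variables
   and set variables are two separate sorts, each named by natural numbers. The remaining
   connectives and the universal quantifiers are the usual abbreviations. *)
datatype mso =
    Eq nat nat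
  | Less nat nat
  | Mem nat nat
  | Neg mso
  | Conj mso mso
  | ExElem nat mso
  | ExSet nat mso

fun free_elem_vars :: "mso \<Rightarrow> nat set" where
  "free_elem_vars (Eq x y) = {x, y}"
| "free_elem_vars (Less x y) = {x, y}"
| "free_elem_vars (Mem x X) = {x}"
| "free_elem_vars (Neg \<phi>) = free_elem_vars \<phi>"
| "free_elem_vars (Conj \<phi> \<psi>) = free_elem_vars \<phi> \<union> free_elem_vars \<psi>"
| "free_elem_vars (ExElem x \<phi>) = free_elem_vars \<phi> - {x}"
| "free_elem_vars (ExSet X \<phi>) = free_elem_vars \<phi>"

fun free_set_vars :: "mso \<Rightarrow> nat set" where
  "free_set_vars (Eq x y) = {}"
| "free_set_vars (Less x y) = {}"
| "free_set_vars (Mem x X) = {X}"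
| "free_set_vars (Neg \<phi>) = free_set_vars \<phi>"
| "free_set_vars (Conj \<phi> \<psi>) = free_set_vars \<phi> \<union> free_set_vars \<psi>"
| "free_set_vars (ExElem x \<phi>) = free_set_vars \<phi>"
| "free_set_vars (ExSet X \<phi>) = free_set_vars \<phi> - {X}"

definition sentence :: "mso \<Rightarrow> bool" where
  "sentence \<phi> \<longleftrightarrow> free_elem_vars \<phi> = {} \<and> free_set_vars \<phi> = {}"

(* Satisfaction in the structure with universe M and order relation lt, under the assignment e
   of element variables and s of set variables. *)
fun sat :: "'a set \<Rightarrow> ('a \<Rightarrow> 'a \<Rightarrow> bool) \<Rightarrow> (nat \<Rightarrow> 'a) \<Rightarrow> (nat \<Rightarrow> 'a set) \<Rightarrow> mso \<Rightarrow> bool" where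
  "sat M lt e s (Eq x y) \<longleftrightarrow> e x = e y"
| "sat M lt e s (Less x y) \<longleftrightarrow> lt (e x) (e y)"
| "sat M lt e s (Mem x X) \<longleftrightarrow> e x \<in> s X"
| "sat M lt e s (Neg \<phi>) \<longleftrightarrow> \<not> sat M lt e s \<phi>"
| "sat M lt e s (Conj \<phi> \<psi>) \<longleftrightarrow> sat M lt e s \<phi> \<and> sat M lt e s \<psi>"
| "sat M lt e s (ExElem x \<phi>) \<longleftrightarrow> (\<exists>a\<in>M. sat M lt (e(x := a)) s \<phi>)"
| "sat M lt e s (ExSet X \<phi>) \<longleftrightarrow> (\<exists>A\<subseteq>M. sat M lt e (s(X := A)) \<phi>)"

(* The truth value of a sentence does not depend on the assignment, so quantifying over all
   assignments into M is harmless as long as M is nonempty. *)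
definition monadic_theory :: "'a set \<Rightarrow> ('a \<Rightarrow> 'a \<Rightarrow> bool) \<Rightarrow> mso set" where
  "monadic_theory M lt =
    {\<phi>. sentence \<phi> \<and> (\<forall>e s. range e \<subseteq> M \<longrightarrow> (\<forall>X. s X \<subseteq> M) \<longrightarrow> sat M lt e s \<phi>)}"

(* Dense as an order in itself; M need not be topologically dense in the ambient type. *)
definition order_dense :: "'a::linorder set \<Rightarrow> bool" where
  "order_dense M \<longleftrightarrow> (\<forall>x\<in>M. \<forall>y\<in>M. x < y \<longrightarrow> (\<exists>z\<in>M. x < z \<and> z < y))"

definition no_endpoints :: "'a::linorder set \<Rightarrow> bool" where
  "no_endpoints M \<longleftrightarrow> (\<forall>x\<in>M. (\<exists>y\<in>M. y < x) \<and> (\<exists>y\<in>M. x < y))"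

definition nowhere_dense :: "'a::topological_space set \<Rightarrow> bool" where
  "nowhere_dense S \<longleftrightarrow> interior (closure S) = {}"

(* Unlike the common usage, nowhere density is part of the definition. *)
definition perfect_set :: "real set \<Rightarrow> bool" where
  "perfect_set P \<longleftrightarrow>
    closed P \<and> nowhere_dense P \<and> (\<forall>x\<in>P. \<not> x isolated_in P) \<and> (\<exists>x\<in>P. \<exists>y\<in>P. x \<noteq> y)"

end

theory Submission
  imports Defs
begin

text \<open>Two coloured orders are compared by the set-move game \<open>eqv\<close> of finite depth. The heart of the proof is a statement
  on shuffles, by induction on the depth: if two sums are indexed by suborders of the reals that satisfy the hypothesis of the
  theorem, are dense without endpoints, and are coloured with each colour dense, and if summands of equal colour are equivalent
  at depth \<open>n\<close>, then the sums are equivalent at depth \<open>n\<close>. Summands with one point give the theorem.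

  In the induction step a set \<open>A\<close> on the left must be answered on the right. Call a convex set of indices good if \<open>A\<close>
  restricted to it can be answered over every convex set on the right which looks the same at its endpoints. Identify two
  indices if all convex sets between them are good. The classes are good as sums over the integers, and the order of the
  classes is dense, as adjacent good sets can be joined. If there were several classes, then in a suitable interval each type
  of a class that occurs would be dense, so the induction hypothesis for shuffles of classes would make that interval good.

  To apply it, the order on the right has to be decomposed into convex pieces of prescribed kinds, each kind dense. Such
  decompositions come from trees of gaps, and only the points which lie in a gap at each stage cause trouble. The tree can be
  chosen in continuum many ways, with disjoint sets of such points that are separated by intervals free of all of them; by the
  hypothesis on perfect sets, one of these sets is empty.\<close>

section \<open>Types of coloured orders\<close>

text \<open>What makes good sets composable is that the answer may depend on the convex set on the
  right only through its kind: which endpoints it has, their colours, and whether it is a single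
  point. A cut on the left can then be copied on the right by matching endpoints alone, and sums
  over the integers need no Ramsey argument. Smallness of the index orders is used twice, each time
  against a tree with continuum many branches: to find cuts with no endpoint on either side, like
  the irrational cuts of the rationals, and to rid a tree of gaps of the points that never leave the
  gaps. One such point per branch would give a nowhere dense subset of size continuum, and by
  Cantor-Bendixson all but countably many of its points lie in a perfect set. The choice of a branch
  must not disturb the decomposition, so discarded gaps are absorbed by the pieces next to them;
  this takes a kind with several points. If all kinds are single points, nothing can be absorbed,
  and the order is recoloured instead.\<close>

definition meets :: "'a set \<Rightarrow> 'a set \<Rightarrow> 'a set \<Rightarrow> bool" where
  "meets X A B \<longleftrightarrow> (\<exists>x\<in>X. x \<in> A \<and> x \<in> B)"

text \<open>Both relations look only inside \<open>X\<close>, because the sets that are played are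
  arbitrary subsets of the type. On the diagonal they count: \<open>meets X A A\<close> says that
  \<open>A\<close> has a point in \<open>X\<close>, and the failure of \<open>precedes X A A\<close>
  says that it has at most one.\<close>

definition precedes :: "'a::linorder set \<Rightarrow> 'a set \<Rightarrow> 'a set \<Rightarrow> bool" where
  "precedes X A B \<longleftrightarrow> (\<exists>x\<in>X. \<exists>x'\<in>X. x < x' \<and> x \<in> A \<and> x' \<in> B)"

text \<open>The Ehrenfeucht-Fraisse game with set moves only: an element \<open>a\<close> is played as the set \<open>{a}\<close>, and
  being a singleton is preserved at level \<open>0\<close> (see \<open>eqv_singleton\<close>).\<close>

primrec eqv :: "nat \<Rightarrow> 'a::linorder set \<Rightarrow> 'a set list \<Rightarrow> 'b::linorder set \<Rightarrow> 'b set list \<Rightarrow> bool" where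
  "eqv 0 X As Y Bs \<longleftrightarrow> length As = length Bs \<and> (\<forall>p<length As. \<forall>q<length As.
     (meets X (As ! p) (As ! q) \<longleftrightarrow> meets Y (Bs ! p) (Bs ! q)) \<and>
     (precedes X (As ! p) (As ! q) \<longleftrightarrow> precedes Y (Bs ! p) (Bs ! q)))"
| "eqv (Suc n) X As Y Bs \<longleftrightarrow>
     (\<forall>A. \<exists>B. eqv n X (A # As) Y (B # Bs)) \<and> (\<forall>B. \<exists>A. eqv n X (A # As) Y (B # Bs))"

lemma eqv_0_D:
  assumes "eqv 0 X As Y Bs" "p < length As" "q < length As"
  shows "meets X (As ! p) (As ! q) \<longleftrightarrow> meets Y (Bs ! p) (Bs ! q)"
    and "precedes X (As ! p) (As ! q) \<longleftrightarrow> precedes Y (Bs ! p) (Bs ! q)"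
  using assms by simp_all

lemma meets_cong: "(\<And>x. x \<in> X \<Longrightarrow> x \<in> A' \<longleftrightarrow> x \<in> A) \<Longrightarrow> (\<And>x. x \<in> X \<Longrightarrow> x \<in> B' \<longleftrightarrow> x \<in> B) \<Longrightarrow>
    meets X A' B' = meets X A B"
  unfolding meets_def by (intro bex_cong) simp_all

lemma precedes_cong: "(\<And>x. x \<in> X \<Longrightarrow> x \<in> A' \<longleftrightarrow> x \<in> A) \<Longrightarrow> (\<And>x. x \<in> X \<Longrightarrow> x \<in> B' \<longleftrightarrow> x \<in> B) \<Longrightarrow>
    precedes X A' B' = precedes X A B"
  unfolding precedes_def by (intro bex_cong refl) simp_all

lemma eqv_sym: "eqv n X As Y Bs \<Longrightarrow> eqv n Y Bs X As"
proof (induction n arbitrary: As Bs)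
  case (Suc n)
  then show ?case unfolding eqv.simps by meson
qed simp

lemma eqv_trans: "eqv n X As Y Bs \<Longrightarrow> eqv n Y Bs Z Cs \<Longrightarrow> eqv n X As Z Cs"
proof (induction n arbitrary: As Bs Cs)
  case 0
  then show ?case by simp
next
  case (Suc n)
  show ?case
    unfolding eqv.simps
  proof (intro conjI allI)
    fix A
    obtain B where B: "eqv n X (A # As) Y (B # Bs)" using Suc.prems(1) by auto
    obtain C where "eqv n Y (B # Bs) Z (C # Cs)" using Suc.prems(2) by auto
    with B show "\<exists>C. eqv n X (A # As) Z (C # Cs)" using Suc.IH by blast
  next
    fix C
    obtain B where B: "eqv n Y (B # Bs) Z (C # Cs)" using Suc.prems(2) by auto
    obtain A where "eqv n X (A # As) Y (B # Bs)" using Suc.prems(1) by auto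
    with B show "\<exists>A. eqv n X (A # As) Z (C # Cs)" using Suc.IH by blast
  qed
qed

lemma eqv_tail_0:
  assumes "eqv 0 X (A # As) Y (B # Bs)"
  shows "eqv 0 X As Y Bs"
  using assms eqv_0_D[OF assms, of "Suc _" "Suc _"] by simp

text \<open>Play the empty set in every remaining round and forget it afterwards.\<close>

lemma eqv_0: "eqv n X As Y Bs \<Longrightarrow> eqv 0 X As Y Bs"
proof (induction n arbitrary: As Bs)
  case (Suc n)
  then obtain B where "eqv n X ({} # As) Y (B # Bs)" by (meson eqv.simps(2))
  then show ?case using Suc.IH eqv_tail_0 by blast
qed

text \<open>Only the traces of the sets on \<open>X\<close> and \<open>Y\<close> matter. Hence
  answers found on separate fibres can be glued without cutting them down first.\<close>

lemma eqv_cong: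
  "eqv n X As Y Bs \<Longrightarrow> length As' = length As \<Longrightarrow> length Bs' = length Bs \<Longrightarrow>
   (\<And>i x. i < length As \<Longrightarrow> x \<in> X \<Longrightarrow> x \<in> As' ! i \<longleftrightarrow> x \<in> As ! i) \<Longrightarrow>
   (\<And>i y. i < length Bs \<Longrightarrow> y \<in> Y \<Longrightarrow> y \<in> Bs' ! i \<longleftrightarrow> y \<in> Bs ! i) \<Longrightarrow> eqv n X As' Y Bs'"
proof (induction n arbitrary: As Bs As' Bs')
  case 0
  have "meets X (As' ! p) (As' ! q) = meets X (As ! p) (As ! q)" "precedes X (As' ! p) (As' ! q) = precedes X (As ! p) (As ! q)"
    if "p < length As" "q < length As" for p q
    using 0(4) that by (intro meets_cong precedes_cong; blast)+
  moreover have "meets Y (Bs' ! p) (Bs' ! q) = meets Y (Bs ! p) (Bs ! q)"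
    "precedes Y (Bs' ! p) (Bs' ! q) = precedes Y (Bs ! p) (Bs ! q)"
    if "p < length Bs" "q < length Bs" for p q
    using 0(5) that by (intro meets_cong precedes_cong; blast)+
  ultimately show ?case using 0(1-3) by simp
next
  case (Suc n)
  have step: "eqv n X (A # As') Y (B # Bs')" if "eqv n X (A # As) Y (B # Bs)" for A B
    by (rule Suc.IH[OF that]) (use Suc.prems(2-) in \<open>auto simp: less_Suc_eq_0_disj\<close>)
  then show ?case using Suc.prems(1) unfolding eqv.simps by meson
qed

lemma eqv_cong_hd:
  assumes "eqv n X (A # As) Y (B # Bs)" "A' \<inter> X = A \<inter> X" "B' \<inter> Y = B \<inter> Y"
  shows "eqv n X (A' # As) Y (B' # Bs)"
  by (rule eqv_cong[OF assms(1)]) (use assms(2,3) in \<open>auto simp: less_Suc_eq_0_disj\<close>)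

lemma eqv_iso:
  assumes "strict_mono_on X \<phi>"
  shows "length As = length Bs \<Longrightarrow> (\<And>i. i < length As \<Longrightarrow> \<forall>x\<in>X. x \<in> As ! i \<longleftrightarrow> \<phi> x \<in> Bs ! i)
    \<Longrightarrow> eqv n X As (\<phi> ` X) Bs"
proof (induction n arbitrary: As Bs)
  case 0
  have lt: "\<phi> x < \<phi> y \<longleftrightarrow> x < y" if "x \<in> X" "y \<in> X" for x y
    using strict_mono_on_less[OF assms that] .
  have mem: "x \<in> As ! p \<longleftrightarrow> \<phi> x \<in> Bs ! p" if "p < length As" "x \<in> X" for p x
    using 0(2) that by blast
  have "meets X (As ! p) (As ! q) \<longleftrightarrow> meets (\<phi> ` X) (Bs ! p) (Bs ! q)"
    "precedes X (As ! p) (As ! q) \<longleftrightarrow> precedes (\<phi> ` X) (Bs ! p) (Bs ! q)"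
    if "p < length As" "q < length As" for p q
    by (simp_all add: meets_def precedes_def mem that lt cong: bex_cong conj_cong)
  then show ?case using 0(1) by simp
next
  case (Suc n)
  have inj: "inj_on \<phi> X" using assms strict_mono_on_imp_inj_on by blast
  show ?case
    unfolding eqv.simps
  proof (intro conjI allI)
    fix A
    have "eqv n X (A # As) (\<phi> ` X) (\<phi> ` (A \<inter> X) # Bs)"
      by (rule Suc.IH) (use Suc.prems inj in \<open>auto simp: less_Suc_eq_0_disj dest: inj_onD\<close>)
    then show "\<exists>B. eqv n X (A # As) (\<phi> ` X) (B # Bs)" by blast
  next
    fix B
    have "eqv n X (\<phi> -` B # As) (\<phi> ` X) (B # Bs)"
      by (rule Suc.IH) (use Suc.prems in \<open>auto simp: less_Suc_eq_0_disj\<close>)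
    then show "\<exists>A. eqv n X (A # As) (\<phi> ` X) (B # Bs)" by blast
  qed
qed

section \<open>From the game to monadic sentences\<close>

primrec qrank :: "mso \<Rightarrow> nat" where
  "qrank (Eq x y) = 0"
| "qrank (Less x y) = 0"
| "qrank (Mem x S) = 0"
| "qrank (Neg \<phi>) = qrank \<phi>"
| "qrank (Conj \<phi> \<psi>) = max (qrank \<phi>) (qrank \<psi>)"
| "qrank (ExElem x \<phi>) = Suc (qrank \<phi>)"
| "qrank (ExSet S \<phi>) = Suc (qrank \<phi>)"

lemma meets_singletons:
  assumes "A \<inter> X = {a}"
  shows "meets X A B \<longleftrightarrow> a \<in> B \<inter> X"
proof -
  have "meets X A B \<longleftrightarrow> (\<exists>z\<in>A \<inter> X. z \<in> B)" unfolding meets_def by blast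
  then show ?thesis using assms by auto
qed

lemma precedes_singletons:
  assumes "A \<inter> X = {a}" "B \<inter> X = {b}"
  shows "precedes X A B \<longleftrightarrow> a < b"
proof -
  have "precedes X A B \<longleftrightarrow> (\<exists>z\<in>A \<inter> X. \<exists>z'\<in>B \<inter> X. z < z')" unfolding precedes_def by blast
  then show ?thesis using assms by simp
qed

lemma eqv_singleton:
  assumes "eqv n X (A # As) Y (B # Bs)" and "A \<inter> X = {a}"
  shows "\<exists>b\<in>Y. B \<inter> Y = {b}"
proof -
  note 0 = eqv_0_D[OF eqv_0[OF assms(1)], of 0 0, simplified]
  have "meets Y B B" using 0(1) meets_singletons[OF assms(2), of A] assms(2) by auto
  then obtain b where b: "b \<in> Y" "b \<in> B" by (auto simp: meets_def)
  have no: "\<not> precedes Y B B" using 0(2) precedes_singletons[OF assms(2) assms(2)] by simp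
  have "y = b" if "y \<in> B \<inter> Y" for y
    using no b that unfolding precedes_def by (cases y b rule: linorder_cases) auto
  then show ?thesis using b by blast
qed

text \<open>\<open>ve\<close> and \<open>vs\<close> tell at which position of the lists the value of
  a variable is kept. A new move goes to the front, so under a quantifier the bound variable gets
  position 0 and all others are shifted by one. The value of an element variable is kept as a set
  whose trace is a singleton; \<open>eqv_singleton\<close> guarantees that the answer to such a move
  is again the value of an element.\<close>

lemma sat_eqv:
  assumes "eqv n X As Y Bs" and "qrank \<phi> \<le> n"
    and "\<forall>x\<in>free_elem_vars \<phi>. ve x < length As \<and> As ! ve x \<inter> X = {e x} \<and> Bs ! ve x \<inter> Y = {e' x}"
    and "\<forall>S\<in>free_set_vars \<phi>. vs S < length As \<and> As ! vs S \<inter> X = s S \<inter> X \<and> Bs ! vs S \<inter> Y = s' S \<inter> Y"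
  shows "sat X (<) e s \<phi> \<longleftrightarrow> sat Y (<) e' s' \<phi>"
  using assms
proof (induction \<phi> arbitrary: n As Bs ve vs e e' s s')
  case (Eq x y)
  have *: "As ! ve x \<inter> X = {e x}" "As ! ve y \<inter> X = {e y}"
    "Bs ! ve x \<inter> Y = {e' x}" "Bs ! ve y \<inter> Y = {e' y}"
    "ve x < length As" "ve y < length As" using Eq(3) by auto
  show ?case
    using eqv_0_D(1)[OF eqv_0[OF Eq(1)] *(5,6)]
    unfolding meets_singletons[OF *(1)] meets_singletons[OF *(3)] *(2,4) by simp
next
  case (Less x y)
  have *: "As ! ve x \<inter> X = {e x}" "As ! ve y \<inter> X = {e y}"
    "Bs ! ve x \<inter> Y = {e' x}" "Bs ! ve y \<inter> Y = {e' y}"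
    "ve x < length As" "ve y < length As" using Less(3) by auto
  show ?case
    using eqv_0_D(2)[OF eqv_0[OF Less(1)] *(5,6)]
    unfolding precedes_singletons[OF *(1,2)] precedes_singletons[OF *(3,4)] by simp
next
  case (Mem x S)
  have *: "As ! ve x \<inter> X = {e x}" "As ! vs S \<inter> X = s S \<inter> X"
    "Bs ! ve x \<inter> Y = {e' x}" "Bs ! vs S \<inter> Y = s' S \<inter> Y"
    "ve x < length As" "vs S < length As" using Mem(3,4) by auto
  have "e x \<in> X" "e' x \<in> Y" using *(1,3) by blast+
  then show ?case
    using eqv_0_D(1)[OF eqv_0[OF Mem(1)] *(5,6)]
    unfolding meets_singletons[OF *(1)] meets_singletons[OF *(3)] *(2,4) by simp
next
  case (Neg \<phi>)
  have "sat X (<) e s \<phi> \<longleftrightarrow> sat Y (<) e' s' \<phi>"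
    by (rule Neg.IH[OF Neg.prems(1)]) (use Neg.prems in auto)
  then show ?case by simp
next
  case (Conj \<phi> \<psi>)
  have "sat X (<) e s \<phi> \<longleftrightarrow> sat Y (<) e' s' \<phi>"
    by (rule Conj.IH(1)[OF Conj.prems(1)]) (use Conj.prems in auto)
  moreover have "sat X (<) e s \<psi> \<longleftrightarrow> sat Y (<) e' s' \<psi>"
    by (rule Conj.IH(2)[OF Conj.prems(1)]) (use Conj.prems in auto)
  ultimately show ?case by simp
next
  case (ExElem x \<phi>)
  then obtain m where m: "n = Suc m" by (cases n) auto
  have step: "sat X (<) (e(x := a)) s \<phi> \<longleftrightarrow> sat Y (<) (e'(x := b)) s' \<phi>"
    if "eqv m X (A # As) Y (B # Bs)" "A \<inter> X = {a}" "B \<inter> Y = {b}" for A B a b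
    by (rule ExElem.IH[OF that(1), where ve = "\<lambda>y. if y = x then 0 else Suc (ve y)" and vs = "\<lambda>S. Suc (vs S)"])
      (use ExElem.prems m that in auto)
  show ?case
  proof
    assume "sat X (<) e s (ExElem x \<phi>)"
    then obtain a where a: "a \<in> X" "sat X (<) (e(x := a)) s \<phi>" by auto
    obtain B where B: "eqv m X ({a} # As) Y (B # Bs)" using ExElem.prems(1) m by auto
    moreover have "{a} \<inter> X = {a}" using a by auto
    ultimately obtain b where "b \<in> Y" "B \<inter> Y = {b}" using eqv_singleton by blast
    then show "sat Y (<) e' s' (ExElem x \<phi>)" using step[OF B] a by auto
  next
    assume "sat Y (<) e' s' (ExElem x \<phi>)"
    then obtain b where b: "b \<in> Y" "sat Y (<) (e'(x := b)) s' \<phi>" by auto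
    obtain A where A: "eqv m X (A # As) Y ({b} # Bs)" using ExElem.prems(1) m by auto
    moreover have "{b} \<inter> Y = {b}" using b by auto
    ultimately obtain a where "a \<in> X" "A \<inter> X = {a}" using eqv_singleton eqv_sym by metis
    then show "sat X (<) e s (ExElem x \<phi>)" using step[OF A] b by auto
  qed
next
  case (ExSet S \<phi>)
  then obtain m where m: "n = Suc m" by (cases n) auto
  have step: "sat X (<) e (s(S := C)) \<phi> \<longleftrightarrow> sat Y (<) e' (s'(S := D)) \<phi>"
    if "eqv m X (A # As) Y (B # Bs)" "C = A \<inter> X" "D = B \<inter> Y" for A B C D
    by (rule ExSet.IH[OF that(1), where ve = "\<lambda>y. Suc (ve y)" and vs = "\<lambda>T. if T = S then 0 else Suc (vs T)"])
      (use ExSet.prems m that in auto)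
  show ?case
  proof
    assume "sat X (<) e s (ExSet S \<phi>)"
    then obtain A where A: "A \<subseteq> X" "sat X (<) e (s(S := A)) \<phi>" by auto
    obtain B where B: "eqv m X (A # As) Y (B # Bs)" using ExSet.prems(1) m by auto
    have "sat Y (<) e' (s'(S := B \<inter> Y)) \<phi>" using step[OF B, of A] A by auto
    then show "sat Y (<) e' s' (ExSet S \<phi>)" by auto
  next
    assume "sat Y (<) e' s' (ExSet S \<phi>)"
    then obtain B where B: "B \<subseteq> Y" "sat Y (<) e' (s'(S := B)) \<phi>" by auto
    obtain A where A: "eqv m X (A # As) Y (B # Bs)" using ExSet.prems(1) m by auto
    have "sat X (<) e (s(S := A \<inter> X)) \<phi>" using step[OF A, of _ B] B by auto
    then show "sat X (<) e s (ExSet S \<phi>)" by auto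
  qed
qed

lemma monadic_theory_eqI:
  assumes "X \<noteq> {}" "Y \<noteq> {}" and "\<And>n. eqv n X [] Y []"
  shows "monadic_theory X (<) = monadic_theory Y (<)"
proof -
  have iff: "sat X (<) e s \<phi> \<longleftrightarrow> sat Y (<) e' s' \<phi>" if "sentence \<phi>" for \<phi> e s e' s'
    by (rule sat_eqv[OF assms(3)[of "qrank \<phi>"]]) (use that in \<open>auto simp: sentence_def\<close>)
  obtain x y where "x \<in> X" "y \<in> Y" using assms(1,2) by blast
  then have ex: "range (\<lambda>_::nat. x) \<subseteq> X" "range (\<lambda>_::nat. y) \<subseteq> Y" "\<And>Z. (\<lambda>_::nat. {}) Z \<subseteq> X"
     "\<And>Z. (\<lambda>_::nat. {}) Z \<subseteq> Y" by auto
  show ?thesis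
    unfolding monadic_theory_def
    using iff ex by (intro Collect_cong) metis
qed

section \<open>Finiteness of the number of types\<close>

lemma ex_finite_code:
  assumes "finite (range F)"
  shows "\<exists>c::'a \<Rightarrow> nat. finite (range c) \<and> (\<forall>x y. c x = c y \<longleftrightarrow> F x = F y)"
proof (intro exI conjI allI)
  let ?c = "\<lambda>x. to_nat_on (range F) (F x)"
  show "finite (range ?c)" using assms by (metis finite_imageI image_image)
  show "?c x = ?c y \<longleftrightarrow> F x = F y" for x y
    using assms by (simp add: countable_finite)
qed

text \<open>At depth \<open>0\<close> the type is a pair of relations on the \<open>k\<close>
  positions; at depth \<open>Suc n\<close> it is the set of depth \<open>n\<close> types reached by
  one more set. Both range over a finite set. The code is a number because colours are
  numbers.\<close>

lemma eqv_finite_code: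
  "\<exists>c::'a::linorder set \<times> 'a set list \<Rightarrow> nat. finite (range c) \<and>
    (\<forall>X As Y Bs. length As = k \<and> length Bs = k \<and> c (X, As) = c (Y, Bs) \<longrightarrow> eqv n X As Y Bs)"
proof (induction n arbitrary: k)
  case 0
  define F where "F = (\<lambda>(X::'a set, As::'a set list).
    ({(p, q). p < k \<and> q < k \<and> meets X (As ! p) (As ! q)}, {(p, q). p < k \<and> q < k \<and> precedes X (As ! p) (As ! q)}))"
  have "range F \<subseteq> Pow ({..<k} \<times> {..<k}) \<times> Pow ({..<k} \<times> {..<k})"
    by (auto simp: F_def)
  then have "finite (range F)" by (rule finite_subset) auto
  from ex_finite_code[OF this] obtain c :: "'a set \<times> 'a set list \<Rightarrow> nat"
    where c: "finite (range c)" "\<And>x y. c x = c y \<longleftrightarrow> F x = F y" by metis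
  have "eqv 0 X As Y Bs" if "length As = k" "length Bs = k" "F (X, As) = F (Y, Bs)" for X As Y Bs
  proof -
    note F = that(3)[unfolded F_def prod.case prod.inject]
    note eq = conjunct1[OF F] conjunct2[OF F]
    have "meets X (As ! p) (As ! q) \<longleftrightarrow> meets Y (Bs ! p) (Bs ! q)"
      "precedes X (As ! p) (As ! q) \<longleftrightarrow> precedes Y (Bs ! p) (Bs ! q)" if "p < k" "q < k" for p q
      using arg_cong[OF eq(1), of "\<lambda>S. (p, q) \<in> S"] arg_cong[OF eq(2), of "\<lambda>S. (p, q) \<in> S"] that
      by simp_all
    then show ?thesis using that(1,2) by simp
  qed
  then show ?case using c by blast
next
  case (Suc n)
  obtain c :: "'a set \<times> 'a set list \<Rightarrow> nat" where c: "finite (range c)"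
    "\<And>X As Y Bs. length As = Suc k \<and> length Bs = Suc k \<and> c (X, As) = c (Y, Bs) \<longrightarrow> eqv n X As Y Bs"
    using Suc.IH[of "Suc k"] by metis
  define F where "F = (\<lambda>(X, As). range (\<lambda>A. c (X, A # As)))"
  have "range F \<subseteq> Pow (range c)" by (auto simp: F_def)
  then have "finite (range F)" by (rule finite_subset) (use c(1) in auto)
  from ex_finite_code[OF this] obtain d :: "'a set \<times> 'a set list \<Rightarrow> nat"
    where d: "finite (range d)" "\<And>x y. d x = d y \<longleftrightarrow> F x = F y" by metis
  have "eqv (Suc n) X As Y Bs" if "length As = k" "length Bs = k" "F (X, As) = F (Y, Bs)" for X As Y Bs
    unfolding eqv.simps
  proof (intro conjI allI)
    have eq: "range (\<lambda>A. c (X, A # As)) = range (\<lambda>A. c (Y, A # Bs))" using that by (simp add: F_def)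
    fix A
    have "c (X, A # As) \<in> range (\<lambda>A. c (Y, A # Bs))" using eq by blast
    then obtain B where "c (X, A # As) = c (Y, B # Bs)" by blast
    then show "\<exists>B. eqv n X (A # As) Y (B # Bs)" using c(2) that by (metis length_Cons)
  next
    have eq: "range (\<lambda>A. c (X, A # As)) = range (\<lambda>A. c (Y, A # Bs))" using that by (simp add: F_def)
    fix B
    have "c (Y, B # Bs) \<in> range (\<lambda>A. c (X, A # As))" using eq by blast
    then obtain A where "c (Y, B # Bs) = c (X, A # As)" by (rule rangeE)
    then show "\<exists>A. eqv n X (A # As) Y (B # Bs)" using c(2) that by (metis length_Cons)
  qed
  then show ?case using d by blast
qed

section \<open>Sums over a linear order\<close>

lemma mono_on_less_rev:
  fixes \<pi> :: "'a::linorder \<Rightarrow> 'b::linorder"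
  assumes "mono_on X \<pi>" "x \<in> X" "y \<in> X" "\<pi> x < \<pi> y"
  shows "x < y"
  using mono_onD[OF assms(1,3,2)] assms(4) by (meson not_less)

lemma meets_fibre: "\<rho> ` X \<subseteq> C \<Longrightarrow> meets X A B \<longleftrightarrow> (\<exists>c\<in>C. meets (X \<inter> \<rho> -` {c}) A B)"
  by (auto simp: meets_def)

lemma precedes_fibre:
  fixes \<rho> :: "'a::linorder \<Rightarrow> 'c::linorder"
  assumes "mono_on X \<rho>" "\<rho> ` X \<subseteq> C"
  shows "precedes X A B \<longleftrightarrow> (\<exists>c\<in>C. precedes (X \<inter> \<rho> -` {c}) A B) \<or>
    (\<exists>c\<in>C. \<exists>d\<in>C. c < d \<and> meets (X \<inter> \<rho> -` {c}) A A \<and> meets (X \<inter> \<rho> -` {d}) B B)" (is "?L \<longleftrightarrow> ?R1 \<or> ?R2")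
proof
  assume ?L
  then obtain x y where xy: "x \<in> X" "y \<in> X" "x < y" "x \<in> A" "y \<in> B" by (auto simp: precedes_def)
  show "?R1 \<or> ?R2"
  proof (cases "\<rho> x = \<rho> y")
    case True
    then have "precedes (X \<inter> \<rho> -` {\<rho> x}) A B" using xy by (auto simp: precedes_def)
    then show ?thesis using xy(1) assms(2) by blast
  next
    case False
    then have "\<rho> x < \<rho> y" using mono_onD[OF assms(1) xy(1,2) less_imp_le[OF xy(3)]] by simp
    moreover have "meets (X \<inter> \<rho> -` {\<rho> x}) A A" "meets (X \<inter> \<rho> -` {\<rho> y}) B B" using xy by (auto simp: meets_def)
    ultimately show ?thesis using xy(1,2) assms(2) by blast
  qed
next
  assume "?R1 \<or> ?R2"
  then show ?L
  proof
    assume ?R2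
    then obtain x y where xy: "x \<in> X" "y \<in> X" "\<rho> x < \<rho> y" "x \<in> A" "y \<in> B" by (auto simp: meets_def)
    then show ?L using mono_on_less_rev[OF assms(1)] unfolding precedes_def by blast
  qed (auto simp: precedes_def)
qed

text \<open>Composition of strategies: a move is answered fibre by fibre, and each point consults
  the answer that belongs to its own index. Fibres may be empty, so \<open>C\<close> need only
  contain both images.\<close>

lemma eqv_sum:
  fixes \<rho> :: "'a::linorder \<Rightarrow> 'c::linorder" and \<rho>' :: "'b::linorder \<Rightarrow> 'c"
  assumes "mono_on X \<rho>" "mono_on Y \<rho>'" and C: "\<rho> ` X \<subseteq> C" "\<rho>' ` Y \<subseteq> C"
  shows "length As = length Bs \<Longrightarrow> (\<And>c. c \<in> C \<Longrightarrow> eqv n (X \<inter> \<rho> -` {c}) As (Y \<inter> \<rho>' -` {c}) Bs)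
    \<Longrightarrow> eqv n X As Y Bs"
proof (induction n arbitrary: As Bs)
  case 0
  note D = eqv_0_D[OF 0(2)]
  have "meets X (As ! p) (As ! q) \<longleftrightarrow> meets Y (Bs ! p) (Bs ! q)" if "p < length As" "q < length As" for p q
    unfolding meets_fibre[OF C(1)] meets_fibre[OF C(2)] using D(1) that by simp
  moreover have "precedes X (As ! p) (As ! q) \<longleftrightarrow> precedes Y (Bs ! p) (Bs ! q)" if "p < length As" "q < length As" for p q
    unfolding precedes_fibre[OF assms(1) C(1)] precedes_fibre[OF assms(2) C(2)]
    using D that by (simp cong: bex_cong conj_cong)
  ultimately show ?case using 0(1) by simp
next
  case (Suc n)
  show ?case
    unfolding eqv.simps
  proof (intro conjI allI)
    fix A
    have "\<forall>c. \<exists>B. c \<in> C \<longrightarrow> eqv n (X \<inter> \<rho> -` {c}) (A # As) (Y \<inter> \<rho>' -` {c}) (B # Bs)"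
      using Suc.prems(2) by (meson eqv.simps(2))
    then obtain b where b: "\<And>c. c \<in> C \<Longrightarrow>
      eqv n (X \<inter> \<rho> -` {c}) (A # As) (Y \<inter> \<rho>' -` {c}) (b c # Bs)" by metis
    have "eqv n X (A # As) Y ({y. y \<in> b (\<rho>' y)} # Bs)"
      by (rule Suc.IH) (use Suc.prems(1) in simp, rule eqv_cong_hd[OF b], auto)
    then show "\<exists>B. eqv n X (A # As) Y (B # Bs)" by blast
  next
    fix B
    have "\<forall>c. \<exists>A. c \<in> C \<longrightarrow> eqv n (X \<inter> \<rho> -` {c}) (A # As) (Y \<inter> \<rho>' -` {c}) (B # Bs)"
      using Suc.prems(2) by (meson eqv.simps(2))
    then obtain a where a: "\<And>c. c \<in> C \<Longrightarrow>
      eqv n (X \<inter> \<rho> -` {c}) (a c # As) (Y \<inter> \<rho>' -` {c}) (B # Bs)" by metis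
    have "eqv n X ({x. x \<in> a (\<rho> x)} # As) Y (B # Bs)"
      by (rule Suc.IH) (use Suc.prems(1) in simp, rule eqv_cong_hd[OF a], auto)
    then show "\<exists>A. eqv n X (A # As) Y (B # Bs)" by blast
  qed
qed

section \<open>Thin sets of reals\<close>

text \<open>For sets of reals this amounts to nowhere density, stated through gaps between points of
  \<open>S\<close>, which is what the tree constructions deliver.\<close>

definition thin :: "real set \<Rightarrow> bool" where
  "thin S \<longleftrightarrow> (\<forall>x\<in>S. \<forall>y\<in>S. x < y \<longrightarrow> (\<exists>u v. x \<le> u \<and> u < v \<and> v \<le> y \<and> S \<inter> {u<..<v} = {}))"

text \<open>The working form of the hypothesis on perfect sets. It passes to subsets, hence to all
  index orders that arise, and countable orders have it as well.\<close>

definition small_on_thin :: "real set \<Rightarrow> bool" where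
  "small_on_thin M \<longleftrightarrow> (\<forall>S\<subseteq>M. thin S \<longrightarrow> \<not> (UNIV :: nat set set) \<lesssim> S)"

lemma small_on_thin_subset: "small_on_thin M \<Longrightarrow> N \<subseteq> M \<Longrightarrow> small_on_thin N"
  by (auto simp: small_on_thin_def)

lemma uncountable_nat_sets: "uncountable (UNIV :: nat set set)"
proof
  assume "countable (UNIV :: nat set set)"
  then obtain f :: "nat set \<Rightarrow> nat" where "inj f" unfolding countable_def by blast
  then have "surj (inv f)" by (rule inj_imp_surj_inv)
  then have "inv f ` UNIV = Pow UNIV" by simp
  then show False using Cantors_theorem by metis
qed

lemma small_on_thin_countable: "countable M \<Longrightarrow> small_on_thin M"
  unfolding small_on_thin_def
  using uncountable_nat_sets by (meson countable_lepoll countable_subset)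

text \<open>If the closure contained a ball, there would be points of \<open>S\<close> in it on both
  sides of its centre, and the gap that thinness puts between them would contain points of
  \<open>S\<close> after all.\<close>

lemma thin_nowhere_dense:
  assumes "thin S"
  shows "interior (closure S) = {}"
proof (rule ccontr)
  assume "interior (closure S) \<noteq> {}"
  then obtain z e where e: "e > 0" "ball z e \<subseteq> closure S"
    by (metis all_not_in_conv mem_interior)
  have dense: "\<exists>s\<in>S. a < s \<and> s < b" if "z - e \<le> a" "a < b" "b \<le> z + e" for a b
  proof -
    have "(a + b) / 2 \<in> ball z e" using that by (simp add: dist_real_def abs_if field_simps)
    then have "(a + b) / 2 \<in> closure S" using e by blast
    moreover have "open {a<..<b}" "(a + b) / 2 \<in> {a<..<b}" using that by auto
    ultimately have "{a<..<b} \<inter> S \<noteq> {}" using open_Int_closure_eq_empty by blast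
    then show ?thesis by auto
  qed
  obtain x where x: "x \<in> S" "z - e < x" "x < z" using dense[of "z - e" z] e(1) by auto
  obtain y where y: "y \<in> S" "z < y" "y < z + e" using dense[of z "z + e"] e(1) by auto
  obtain u v where "x \<le> u" "u < v" "v \<le> y" "S \<inter> {u<..<v} = {}"
    using assms x y unfolding thin_def by (meson less_trans)
  then show False using dense[of u v] x y by auto
qed

text \<open>For closed \<open>C\<close> this is the perfect kernel of the Cantor-Bendixson
  theorem.\<close>

definition condensation :: "real set \<Rightarrow> real set" where
  "condensation C = {x. \<forall>e>0. uncountable (C \<inter> ball x e)}"

text \<open>Each point of the difference lies in an interval with rational ends that contains only
  countably many points of \<open>C\<close>, and there are countably many such intervals.\<close>

lemma countable_diff_condensation: "countable (C - condensation C)"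
proof -
  define Q where "Q = {p \<in> \<rat> \<times> \<rat>. countable (C \<inter> {fst p<..<snd p})}"
  have ratl: "\<forall>x\<in>C - condensation C. \<exists>a b. a \<in> \<rat> \<and> b \<in> \<rat> \<and> a < x \<and> x < b \<and> countable (C \<inter> {a<..<b})"
  proof
    fix x assume "x \<in> C - condensation C"
    then obtain e where e: "e > 0" "countable (C \<inter> ball x e)" by (auto simp: condensation_def)
    obtain a where a: "a \<in> \<rat>" "x - e < a" "a < x" using Rats_dense_in_real[of "x - e" x] e by auto
    obtain b where b: "b \<in> \<rat>" "x < b" "b < x + e" using Rats_dense_in_real[of x "x + e"] e by auto
    have "{a<..<b} \<subseteq> ball x e" using a b by (auto simp: dist_real_def abs_if)
    then have "countable (C \<inter> {a<..<b})" using e(2) by (meson Int_mono countable_subset order_refl)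
    then show "\<exists>a b. a \<in> \<rat> \<and> b \<in> \<rat> \<and> a < x \<and> x < b \<and> countable (C \<inter> {a<..<b})" using a b by blast
  qed
  have sub: "C - condensation C \<subseteq> (\<Union>p\<in>Q. C \<inter> {fst p<..<snd p})"
  proof
    fix x assume x: "x \<in> C - condensation C"
    then obtain a b where "a \<in> \<rat>" "b \<in> \<rat>" "a < x" "x < b" "countable (C \<inter> {a<..<b})"
      using ratl by blast
    then have "(a, b) \<in> Q" "x \<in> C \<inter> {fst (a, b)<..<snd (a, b)}" using x by (auto simp: Q_def)
    then show "x \<in> (\<Union>p\<in>Q. C \<inter> {fst p<..<snd p})" by blast
  qed
  have "countable Q"
    by (rule countable_subset[of _ "\<rat> \<times> \<rat>"]) (auto simp: Q_def countable_rat)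
  then have "countable (\<Union>p\<in>Q. C \<inter> {fst p<..<snd p})"
    by (rule countable_UN) (simp add: Q_def)
  with sub show ?thesis by (rule countable_subset)
qed

lemma closed_condensation: "closed (condensation C)"
proof -
  have "open (- condensation C)"
    unfolding open_contains_ball
  proof
    fix x assume "x \<in> - condensation C"
    then obtain e where e: "e > 0" "countable (C \<inter> ball x e)" by (auto simp: condensation_def)
    have "y \<in> - condensation C" if y: "y \<in> ball x e" for y
    proof -
      obtain d where d: "d > 0" "ball y d \<subseteq> ball x e" using y openE[OF open_ball] by blast
      then have "countable (C \<inter> ball y d)" using e(2) by (meson Int_mono countable_subset order_refl)
      then show ?thesis using d by (auto simp: condensation_def)
    qed
    then show "\<exists>e>0. ball x e \<subseteq> - condensation C" using e by blast
  qed
  then show ?thesis by (simp add: closed_def)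
qed

lemma condensation_subset: "closed C \<Longrightarrow> condensation C \<subseteq> C"
proof
  fix x assume "closed C" "x \<in> condensation C"
  have "\<exists>y\<in>C. dist y x < e" if "e > 0" for e
  proof -
    have "C \<inter> ball x e \<noteq> {}" using \<open>x \<in> condensation C\<close> that unfolding condensation_def by force
    then show ?thesis by (auto simp: dist_commute)
  qed
  then show "x \<in> C" using \<open>closed C\<close> by (meson closed_approachable)
qed

text \<open>Near an isolated point, \<open>C\<close> would consist of that point and of points that
  are not condensation points, hence be countable there.\<close>

lemma condensation_no_isolated:
  assumes "x \<in> condensation C" "e > 0"
  shows "\<exists>y\<in>condensation C. y \<noteq> x \<and> dist y x < e"
proof (rule ccontr)
  assume "\<not> ?thesis"
  then have "C \<inter> ball x e \<subseteq> insert x (C - condensation C)" by (auto simp: dist_commute)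
  then have "countable (C \<inter> ball x e)"
    by (rule countable_subset) (simp add: countable_diff_condensation)
  then show False using assms by (auto simp: condensation_def)
qed

lemma perfect_condensation:
  assumes "closed C" "interior C = {}" "condensation C \<noteq> {}"
  shows "perfect_set (condensation C)"
  unfolding perfect_set_def
proof (intro conjI ballI)
  show cl: "closed (condensation C)" by (rule closed_condensation)
  have "interior (condensation C) \<subseteq> interior C" using condensation_subset[OF assms(1)] by (rule interior_mono)
  then show "nowhere_dense (condensation C)" using assms(2) cl by (simp add: nowhere_dense_def)
  obtain x where x: "x \<in> condensation C" using assms(3) by blast
  then obtain y where "y \<in> condensation C" "y \<noteq> x" using condensation_no_isolated[of x C 1] by auto
  then show "\<exists>x\<in>condensation C. \<exists>y\<in>condensation C. x \<noteq> y" using x by blast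
next
  fix x assume x: "x \<in> condensation C"
  show "\<not> x isolated_in condensation C"
  proof
    assume "x isolated_in condensation C"
    then obtain T where T: "open T" "T \<inter> condensation C = {x}" by (auto simp: isolated_in_def)
    then obtain e where e: "e > 0" "ball x e \<subseteq> T" using openE[of T x] by blast
    obtain y where "y \<in> condensation C" "y \<noteq> x" "dist y x < e" using condensation_no_isolated x e by blast
    then have "y \<in> T \<inter> condensation C" using e by (auto simp: dist_commute)
    then show False using T \<open>y \<noteq> x\<close> by blast
  qed
qed

text \<open>An infinite set absorbs a countable one; if \<open>A\<close> is finite, the union is
  countable and the assumption fails.\<close>

lemma continuum_Un_countable:
  assumes "(UNIV :: nat set set) \<lesssim> A \<union> B" "countable B"
  shows "(UNIV :: nat set set) \<lesssim> A"
proof (cases "finite A")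
  case True
  then have "countable (A \<union> B)" using assms(2) by (simp add: countable_finite)
  then show ?thesis using assms(1) uncountable_nat_sets countable_lepoll by blast
next
  case False
  have "B \<lesssim> (UNIV :: nat set)" using assms(2) by (auto simp: countable_def lepoll_def)
  also have "(UNIV :: nat set) \<lesssim> A" using False by (simp add: infinite_le_lepoll)
  finally have "(card_of B, card_of A) \<in> ordLeq" by (simp add: card_of_ordLeq[symmetric] lepoll_def)
  then have "(card_of (A \<union> B), card_of A) \<in> ordLeq"
    using False card_of_Un_ordLeq_infinite_Field[of "card_of A" A B]
    by (simp add: Field_card_of card_of_card_order_on card_of_refl ordIso_imp_ordLeq)
  then have "A \<union> B \<lesssim> A" by (simp add: card_of_ordLeq[symmetric] lepoll_def)
  then show ?thesis using assms(1) lepoll_trans by blast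
qed

text \<open>A thin \<open>S\<close> of size continuum keeps that size after removal of the countably
  many points outside the perfect kernel of its closure. The closure is nowhere dense, so the kernel
  is a perfect set that meets \<open>M\<close> in too many points.\<close>

lemma small_on_thin_if_perfect:
  assumes "\<And>P. perfect_set P \<Longrightarrow> P \<inter> M \<prec> (UNIV :: nat set set)"
  shows "small_on_thin M"
  unfolding small_on_thin_def
proof (intro allI impI notI)
  fix S assume S: "S \<subseteq> M" "thin S" and le: "(UNIV :: nat set set) \<lesssim> S"
  define C where "C = closure S"
  have C: "closed C" "interior C = {}" using thin_nowhere_dense[OF S(2)] by (simp_all add: C_def)
  have "S \<subseteq> (condensation C \<inter> M) \<union> (C - condensation C)"
    using S(1) closure_subset by (auto simp: C_def)
  then have "(UNIV :: nat set set) \<lesssim> (condensation C \<inter> M) \<union> (C - condensation C)"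
    using le lepoll_trans subset_imp_lepoll by blast
  then have le': "(UNIV :: nat set set) \<lesssim> condensation C \<inter> M"
    using continuum_Un_countable countable_diff_condensation by blast
  then have "condensation C \<inter> M \<noteq> {}" by (metis lepoll_empty_iff_empty empty_not_UNIV)
  then have "perfect_set (condensation C)" using perfect_condensation C by blast
  then have "condensation C \<inter> M \<prec> (UNIV :: nat set set)" using assms by blast
  then show False using le' lesspoll_trans2 by blast
qed

text \<open>Choosing one point from each of continuum many separated sets would produce a thin set of size continuum.\<close>

lemma separated_family_has_empty:
  fixes L :: "nat set \<Rightarrow> real set"
  assumes "small_on_thin M" "\<And>\<sigma>. L \<sigma> \<subseteq> M"
    and disj: "\<And>\<sigma> \<tau>. \<sigma> \<noteq> \<tau> \<Longrightarrow> L \<sigma> \<inter> L \<tau> = {}"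
    and sep: "\<And>\<sigma> \<tau> x y. \<sigma> \<noteq> \<tau> \<Longrightarrow> x \<in> L \<sigma> \<Longrightarrow> y \<in> L \<tau> \<Longrightarrow> x < y \<Longrightarrow>
      \<exists>u v. x \<le> u \<and> u < v \<and> v \<le> y \<and> (\<Union>(range L)) \<inter> {u<..<v} = {}"
  shows "\<exists>\<sigma>. L \<sigma> = {}"
proof (rule ccontr)
  assume "\<not> ?thesis"
  then have "\<forall>\<sigma>. \<exists>x. x \<in> L \<sigma>" by blast
  then obtain p where p: "\<And>\<sigma>. p \<sigma> \<in> L \<sigma>" by metis
  have "inj p" using p disj by (metis IntI empty_iff injI)
  then have "(UNIV :: nat set set) \<lesssim> range p" by (auto simp: lepoll_def)
  moreover have "range p \<subseteq> M" using p assms(2) by blast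
  moreover have "thin (range p)"
    unfolding thin_def
  proof (intro ballI impI)
    fix x y assume "x \<in> range p" "y \<in> range p" "x < y"
    then obtain \<sigma> \<tau> where st: "x = p \<sigma>" "y = p \<tau>" by blast
    then have "\<sigma> \<noteq> \<tau>" using \<open>x < y\<close> by auto
    then obtain u v where uv: "x \<le> u" "u < v" "v \<le> y" "(\<Union>(range L)) \<inter> {u<..<v} = {}"
      using sep p st \<open>x < y\<close> by metis
    have "range p \<subseteq> \<Union>(range L)" using p by blast
    then show "\<exists>u v. x \<le> u \<and> u < v \<and> v \<le> y \<and> range p \<inter> {u<..<v} = {}" using uv by blast
  qed
  ultimately show False using assms(1) unfolding small_on_thin_def by blast
qed

section \<open>Cuts of coloured dense orders\<close>

text \<open>A set with at most one point qualifies as soon as its colour lies in \<open>T\<close>,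
  so the notion passes to all convex subsets.\<close>

definition colour_dense :: "nat set \<Rightarrow> ('a::linorder \<Rightarrow> nat) \<Rightarrow> 'a set \<Rightarrow> bool" where
  "colour_dense T f I \<longleftrightarrow>
    f ` I \<subseteq> T \<and> (\<forall>a\<in>I. \<forall>b\<in>I. a < b \<longrightarrow> (\<forall>t\<in>T. \<exists>c\<in>I. a < c \<and> c < b \<and> f c = t))"

definition convex_in :: "'a::linorder set \<Rightarrow> 'a set \<Rightarrow> bool" where
  "convex_in I J \<longleftrightarrow> J \<subseteq> I \<and> (\<forall>a\<in>J. \<forall>b\<in>J. \<forall>c\<in>I. a < c \<and> c < b \<longrightarrow> c \<in> J)"

definition initial_in :: "'a::linorder set \<Rightarrow> 'a set \<Rightarrow> bool" where
  "initial_in I D \<longleftrightarrow> D \<subseteq> I \<and> (\<forall>a\<in>D. \<forall>b\<in>I. b < a \<longrightarrow> b \<in> D)"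

definition no_min :: "'a::linorder set \<Rightarrow> bool" where
  "no_min S \<longleftrightarrow> (\<forall>a\<in>S. \<exists>b\<in>S. b < a)"

definition no_max :: "'a::linorder set \<Rightarrow> bool" where
  "no_max S \<longleftrightarrow> (\<forall>a\<in>S. \<exists>b\<in>S. a < b)"

text \<open>Either empty or the singleton of the colour of the endpoint.\<close>

definition min_colour :: "('a::linorder \<Rightarrow> nat) \<Rightarrow> 'a set \<Rightarrow> nat set" where
  "min_colour f S = f ` {m \<in> S. \<forall>y\<in>S. m \<le> y}"

definition max_colour :: "('a::linorder \<Rightarrow> nat) \<Rightarrow> 'a set \<Rightarrow> nat set" where
  "max_colour f S = f ` {m \<in> S. \<forall>y\<in>S. y \<le> m}"

lemma no_endpoints_iff: "no_endpoints S \<longleftrightarrow> no_min S \<and> no_max S"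
  by (auto simp: no_endpoints_def no_min_def no_max_def)

lemma min_colour_no_min: "min_colour f S = {} \<longleftrightarrow> no_min S"
  unfolding min_colour_def no_min_def by (auto simp: not_le)

lemma max_colour_no_max: "max_colour f S = {} \<longleftrightarrow> no_max S"
  unfolding max_colour_def no_max_def by (auto simp: not_le)

lemma min_colour_eq: "m \<in> S \<Longrightarrow> (\<And>y. y \<in> S \<Longrightarrow> m \<le> y) \<Longrightarrow> min_colour f S = {f m}"
proof -
  assume m: "m \<in> S" "\<And>y. y \<in> S \<Longrightarrow> m \<le> y"
  then have "{m \<in> S. \<forall>y\<in>S. m \<le> y} = {m}" by (auto intro: antisym)
  then show ?thesis by (simp add: min_colour_def)
qed

lemma max_colour_eq: "m \<in> S \<Longrightarrow> (\<And>y. y \<in> S \<Longrightarrow> y \<le> m) \<Longrightarrow> max_colour f S = {f m}"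
proof -
  assume m: "m \<in> S" "\<And>y. y \<in> S \<Longrightarrow> y \<le> m"
  then have "{m \<in> S. \<forall>y\<in>S. y \<le> m} = {m}" by (auto intro: antisym)
  then show ?thesis by (simp add: max_colour_def)
qed

lemma colour_dense_convex_in: "colour_dense T f I \<Longrightarrow> convex_in I J \<Longrightarrow> colour_dense T f J"
  unfolding colour_dense_def convex_in_def by (meson image_mono order_trans subsetD)

lemma convex_in_Int_vimage:
  fixes \<rho> :: "'a::linorder \<Rightarrow> 'c::linorder"
  assumes "convex_in I J" "mono_on J \<rho>"
  shows "convex_in I (J \<inter> \<rho> -` {c})"
  unfolding convex_in_def
proof (intro conjI ballI impI)
  show "J \<inter> \<rho> -` {c} \<subseteq> I" using assms(1) by (auto simp: convex_in_def)
  fix a b z assume *: "a \<in> J \<inter> \<rho> -` {c}" "b \<in> J \<inter> \<rho> -` {c}" "z \<in> I" "a < z \<and> z < b"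
  then have "z \<in> J" using assms(1) unfolding convex_in_def by blast
  moreover have "\<rho> a \<le> \<rho> z" "\<rho> z \<le> \<rho> b" 
    using mono_onD[OF assms(2), of a z] mono_onD[OF assms(2), of z b] * \<open>z \<in> J\<close> by auto
  ultimately show "z \<in> J \<inter> \<rho> -` {c}" using * by auto
qed

lemma colour_dense_order_dense: "colour_dense T f I \<Longrightarrow> order_dense I"
  unfolding colour_dense_def order_dense_def by blast

text \<open>A branch of the binary tree is a set of levels, those at which the right half is taken;
  this makes the branches continuum many.\<close>

primrec nested :: "(real \<times> real \<Rightarrow> bool \<Rightarrow> real \<times> real) \<Rightarrow> real \<times> real \<Rightarrow> nat set \<Rightarrow> nat \<Rightarrow> real \<times> real" where
  "nested F xy \<sigma> 0 = xy"
| "nested F xy \<sigma> (Suc k) = F (nested F xy \<sigma> k) (k \<in> \<sigma>)"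

lemma nested_cong: "(\<And>j. j < k \<Longrightarrow> j \<in> \<sigma> \<longleftrightarrow> j \<in> \<tau>) \<Longrightarrow> nested F xy \<sigma> k = nested F xy \<tau> k"
  by (induction k) auto

text \<open>Otherwise every branch of a binary tree of nested intervals would contain a point of \<open>J\<close>.\<close>

lemma ex_free_cut:
  assumes "small_on_thin J" "order_dense J" "x \<in> J" "y \<in> J" "x < y"
  shows "\<exists>D. initial_in J D \<and> x \<in> D \<and> y \<notin> D \<and> no_max D \<and> no_min (J - D)"
proof -
  \<comment> \<open>Two separated subintervals with ends in \<open>J\<close>, strictly inside the
    given one. Strictness makes the left ends of a branch increase and its right ends decrease; the
    space between the halves provides the gaps.\<close>
  define split where "split ab ef \<longleftrightarrow> fst ab < fst (ef False) \<and> fst (ef False) < snd (ef False) \<and>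
      snd (ef False) < fst (ef True) \<and> fst (ef True) < snd (ef True) \<and> snd (ef True) < snd ab \<and>
      (\<forall>i. fst (ef i) \<in> J \<and> snd (ef i) \<in> J)" for ab :: "real \<times> real" and ef :: "bool \<Rightarrow> real \<times> real"
  have dense: "\<exists>z\<in>J. a < z \<and> z < b" if "a \<in> J" "b \<in> J" "a < b" for a b
    using assms(2) that unfolding order_dense_def by (metis (no_types))
  have "\<exists>ef. split ab ef"
    if ab: "fst ab \<in> J" "snd ab \<in> J" "fst ab < snd ab" for ab
  proof -
    obtain p where p: "p \<in> J" "fst ab < p" "p < snd ab" using dense[OF ab] by blast
    obtain q where q: "q \<in> J" "p < q" "q < snd ab" using dense[OF p(1) ab(2) p(3)] by blast
    obtain r where r: "r \<in> J" "q < r" "r < snd ab" using dense[OF q(1) ab(2) q(3)] by blast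
    obtain s where s: "s \<in> J" "r < s" "s < snd ab" using dense[OF r(1) ab(2) r(3)] by blast
    show ?thesis
      by (rule exI[of _ "\<lambda>i. if i then (r, s) else (p, q)"]) (simp add: split_def p q r s)
  qed
  then obtain F where F': "\<And>ab. fst ab \<in> J \<Longrightarrow> snd ab \<in> J \<Longrightarrow> fst ab < snd ab \<Longrightarrow> split ab (F ab)"
    by metis
  note F = F'[unfolded split_def]
  define st where "st = nested F (x, y)"
  define L where "L \<sigma> = {z \<in> J. \<forall>k. fst (st \<sigma> k) \<le> z \<and> z \<le> snd (st \<sigma> k)}" for \<sigma>
  have inv: "fst (st \<sigma> k) \<in> J \<and> snd (st \<sigma> k) \<in> J \<and> fst (st \<sigma> k) < snd (st \<sigma> k)" for \<sigma> k
  proof (induction k)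
    case 0
    then show ?case using assms by (simp add: st_def)
  next
    case (Suc k)
    then show ?case using F[of "st \<sigma> k"] by (cases "k \<in> \<sigma>") (simp_all add: st_def)
  qed
  note Fst = F[OF conjunct1[OF inv] conjunct1[OF conjunct2[OF inv]] conjunct2[OF conjunct2[OF inv]]]
  have nest: "fst (st \<sigma> k) < fst (st \<sigma> (Suc k)) \<and> snd (st \<sigma> (Suc k)) < snd (st \<sigma> k)" for \<sigma> k
    using Fst[of \<sigma> k] by (cases "k \<in> \<sigma>") (auto simp: st_def)
  have step: "st \<sigma> (Suc k) = F (st \<sigma> k) (k \<in> \<sigma>)" for \<sigma> k by (simp add: st_def)
  \<comment> \<open>An interval of level \<open>k\<close> determines the path that leads to it, so a
    point in it that stays on some branch has followed the same path.\<close>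
  have agree: "\<forall>j<k. j \<in> \<sigma> \<longleftrightarrow> j \<in> \<tau>" if "z \<in> L \<sigma>" "fst (st \<tau> k) \<le> z" "z \<le> snd (st \<tau> k)" for z \<sigma> \<tau> k
    using that(2,3)
  proof (induction k)
    case (Suc k)
    have z: "fst (st \<tau> k) \<le> z" "z \<le> snd (st \<tau> k)" using Suc.prems nest[of \<tau> k] by linarith+
    then have IH: "\<forall>j<k. j \<in> \<sigma> \<longleftrightarrow> j \<in> \<tau>" using Suc.IH by blast
    then have eq: "st \<sigma> k = st \<tau> k" unfolding st_def by (intro nested_cong) auto
    have "fst (st \<sigma> (Suc k)) \<le> z" "z \<le> snd (st \<sigma> (Suc k))" using that(1) by (auto simp: L_def)
    then have "k \<in> \<sigma> \<longleftrightarrow> k \<in> \<tau>"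
      using Suc.prems Fst[of \<tau> k] unfolding step eq by (cases "k \<in> \<sigma>"; cases "k \<in> \<tau>") auto
    then show ?case using IH less_Suc_eq by auto
  qed simp
  have ivl: "fst (st \<sigma> k) \<le> z" "z \<le> snd (st \<sigma> k)" if "z \<in> L \<sigma>" for z \<sigma> k using that by (auto simp: L_def)
  have "\<exists>\<sigma>. L \<sigma> = {}"
  proof (rule separated_family_has_empty[OF assms(1)])
    show "L \<sigma> \<subseteq> J" for \<sigma> by (auto simp: L_def)
    show "L \<sigma> \<inter> L \<tau> = {}" if "\<sigma> \<noteq> \<tau>" for \<sigma> \<tau>
    proof (rule ccontr)
      assume "L \<sigma> \<inter> L \<tau> \<noteq> {}"
      then obtain z where "z \<in> L \<sigma>" "z \<in> L \<tau>" by blast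
      then have "\<forall>j. j \<in> \<sigma> \<longleftrightarrow> j \<in> \<tau>" using agree ivl by blast
      then show False using that by blast
    qed
    fix \<sigma> \<tau> a b assume ab: "\<sigma> \<noteq> \<tau>" "a \<in> L \<sigma>" "b \<in> L \<tau>" "a < b"
    define k where "k = (LEAST j. (j \<in> \<sigma>) \<noteq> (j \<in> \<tau>))"
    have "\<exists>j. (j \<in> \<sigma>) \<noteq> (j \<in> \<tau>)" using ab(1) by blast
    then have k: "(k \<in> \<sigma>) \<noteq> (k \<in> \<tau>)" unfolding k_def by (rule LeastI_ex)
    have below: "j \<in> \<sigma> \<longleftrightarrow> j \<in> \<tau>" if "j < k" for j using not_less_Least[OF that[unfolded k_def]] by simp
    then have eq: "st \<sigma> k = st \<tau> k" unfolding st_def by (intro nested_cong) auto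
    note a = ivl[OF ab(2), of "Suc k", unfolded step]
    note b = ivl[OF ab(3), of "Suc k", unfolded step]
    have st: "k \<notin> \<sigma>" "k \<in> \<tau>" using a b k Fst[of \<tau> k] ab(4) unfolding eq by (cases "k \<in> \<sigma>"; force)+
    \<comment> \<open>The open interval between the two halves at the first level where the branches
      part. A point of any branch in it would have followed the same path up to level
      \<open>k\<close>, and would then have to lie in one of the halves.\<close>
    define u where "u = snd (F (st \<tau> k) False)"
    define v where "v = fst (F (st \<tau> k) True)"
    have "\<Union>(range L) \<inter> {u<..<v} = {}"
    proof (rule ccontr)
      assume "\<not> ?thesis"
      then obtain \<rho> z where z: "z \<in> L \<rho>" "u < z" "z < v" by auto
      have "fst (st \<tau> k) \<le> z" "z \<le> snd (st \<tau> k)" using z Fst[of \<tau> k] unfolding u_def v_def by linarith+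
      then have "\<forall>j<k. j \<in> \<rho> \<longleftrightarrow> j \<in> \<tau>" using agree z(1) by blast
      then have eq: "st \<rho> k = st \<tau> k" unfolding st_def by (intro nested_cong) auto
      then show False using ivl[OF z(1), of "Suc k", unfolded step eq] z(2,3) by (cases "k \<in> \<rho>") (auto simp: u_def v_def)
    qed
    moreover have "a \<le> u" "v \<le> b" "u < v" using a b st Fst[of \<tau> k] unfolding u_def v_def eq by auto
    ultimately show "\<exists>u v. a \<le> u \<and> u < v \<and> v \<le> b \<and> \<Union>(range L) \<inter> {u<..<v} = {}" by blast
  qed
  then obtain \<sigma> where \<sigma>: "L \<sigma> = {}" by blast
  have mono: "fst (st \<sigma> i) \<le> fst (st \<sigma> j)" "snd (st \<sigma> j) \<le> snd (st \<sigma> i)" if "i \<le> j" for i j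
    using that by (induction rule: dec_induct) (use nest[of \<sigma>] in \<open>auto intro: order_trans less_imp_le\<close>)
  have lr: "fst (st \<sigma> i) < snd (st \<sigma> j)" for i j
  proof -
    have "fst (st \<sigma> i) \<le> fst (st \<sigma> (max i j))" "snd (st \<sigma> (max i j)) \<le> snd (st \<sigma> j)" by (auto intro: mono)
    then show ?thesis using inv[of \<sigma> "max i j"] by linarith
  qed
  \<comment> \<open>The cut determined by an empty branch. The left ends are cofinal in
    \<open>D\<close>. No point of \<open>J\<close> lies in all intervals, so every point outside
    \<open>D\<close> is above some right end.\<close>
  define D where "D = {z \<in> J. \<exists>k. z \<le> fst (st \<sigma> k)}"
  show ?thesis
  proof (intro exI conjI)
    show "initial_in J D" unfolding initial_in_def D_def by (auto, meson less_imp_le order_trans)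
    have 0: "st \<sigma> 0 = (x, y)" by (simp add: st_def)
    show "x \<in> D" using assms(3) unfolding D_def by (auto intro!: exI[of _ 0] simp: 0)
    have notD: "snd (st \<sigma> k) \<notin> D" for k
    proof
      assume "snd (st \<sigma> k) \<in> D"
      then obtain i where "snd (st \<sigma> k) \<le> fst (st \<sigma> i)" by (auto simp: D_def)
      then show False using lr[of i k] by linarith
    qed
    show "y \<notin> D" using notD[of 0] 0 by simp
    show "no_max D"
      unfolding no_max_def
    proof
      fix z assume "z \<in> D"
      then obtain k where "z \<le> fst (st \<sigma> k)" by (auto simp: D_def)
      then have "z < fst (st \<sigma> (Suc k))" using nest[of \<sigma> k] by linarith
      moreover have "fst (st \<sigma> (Suc k)) \<in> D" using inv[of \<sigma> "Suc k"] by (auto simp: D_def)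
      ultimately show "\<exists>b\<in>D. z < b" by blast
    qed
    show "no_min (J - D)"
      unfolding no_min_def
    proof
      fix z assume z: "z \<in> J - D"
      then obtain k where "\<not> (fst (st \<sigma> k) \<le> z \<and> z \<le> snd (st \<sigma> k))" using \<sigma> by (auto simp: L_def)
      moreover have "fst (st \<sigma> k) \<le> z"
      proof (rule ccontr)
        assume "\<not> fst (st \<sigma> k) \<le> z"
        then have "z \<le> fst (st \<sigma> k)" by simp
        then have "z \<in> D" using z unfolding D_def by blast
        then show False using z by blast
      qed
      ultimately have "snd (st \<sigma> k) < z" by simp
      moreover have "snd (st \<sigma> k) \<in> J - D" using inv[of \<sigma> k] notD by blast
      ultimately show "\<exists>b\<in>J - D. b < z" by blast
    qed
  qed
qed

text \<open>For \<open>l = {}\<close> this is a free cut. For \<open>l = {t}\<close> cut just below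
  a point of colour \<open>t\<close>; the lower part has no maximum because the order is
  dense.\<close>

lemma ex_cut_min:
  assumes "small_on_thin J" "colour_dense T f J" "x \<in> J" "y \<in> J" "x < y" "l = {} \<or> (\<exists>t\<in>T. l = {t})"
  shows "\<exists>D. initial_in J D \<and> x \<in> D \<and> y \<notin> D \<and> no_max D \<and> min_colour f (J - D) = l"
  using assms(6)
proof
  assume "l = {}"
  then show ?thesis
    using ex_free_cut[OF assms(1) colour_dense_order_dense[OF assms(2)] assms(3-5)] min_colour_no_min by metis
next
  assume "\<exists>t\<in>T. l = {t}"
  then obtain t where t: "t \<in> T" "l = {t}" by blast
  then obtain c where c: "c \<in> J" "x < c" "c < y" "f c = t"
    using assms(2-5) unfolding colour_dense_def by blast
  have "no_max {z \<in> J. z < c}"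
    using colour_dense_order_dense[OF assms(2)] c(1) unfolding no_max_def order_dense_def by blast
  moreover have "min_colour f (J - {z \<in> J. z < c}) = {f c}"
    by (rule min_colour_eq) (use c in auto)
  ultimately show ?thesis
    by (intro exI[of _ "{z \<in> J. z < c}"]) (use c t assms(3) in \<open>auto simp: initial_in_def\<close>)
qed

lemma ex_cut_max:
  assumes "small_on_thin J" "colour_dense T f J" "x \<in> J" "y \<in> J" "x < y" "l = {} \<or> (\<exists>t\<in>T. l = {t})"
  shows "\<exists>D. initial_in J D \<and> x \<in> D \<and> y \<notin> D \<and> max_colour f D = l \<and> no_min (J - D)"
  using assms(6)
proof
  assume "l = {}"
  then show ?thesis
    using ex_free_cut[OF assms(1) colour_dense_order_dense[OF assms(2)] assms(3-5)] max_colour_no_max by metis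
next
  assume "\<exists>t\<in>T. l = {t}"
  then obtain t where t: "t \<in> T" "l = {t}" by blast
  then obtain c where c: "c \<in> J" "x < c" "c < y" "f c = t"
    using assms(2-5) unfolding colour_dense_def by blast
  have "no_min (J - {z \<in> J. z \<le> c})"
    using colour_dense_order_dense[OF assms(2)] c(1) unfolding no_min_def order_dense_def by force
  moreover have "max_colour f {z \<in> J. z \<le> c} = {f c}"
    by (rule max_colour_eq) (use c in auto)
  ultimately show ?thesis
    by (intro exI[of _ "{z \<in> J. z \<le> c}"]) (use c t assms(3) in \<open>auto simp: initial_in_def\<close>)
qed

section \<open>Decomposition of dense orders into pieces of given kinds\<close>

lemma ex_cofinal_sequence:
  fixes S :: "real set"
  assumes "no_max S" "s \<in> S"
  shows "\<exists>u::nat \<Rightarrow> real. u 0 = s \<and> strict_mono u \<and> (\<forall>n. u n \<in> S) \<and> (\<forall>y\<in>S. \<exists>n. y < u n)"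
proof -
  define q where "q = from_nat_into (\<rat> :: real set)"
  have q: "\<exists>i. q i = r" if "r \<in> \<rat>" for r
    using from_nat_into_surj[OF countable_rat that] by (auto simp: q_def)
  \<comment> \<open>The rationals enumerated by \<open>q\<close> serve as tests: the next member of
    the sequence passes all of the first \<open>n\<close> rationals that some point of
    \<open>S\<close> exceeds. As there is a rational between any two reals, such a sequence passes
    every point of \<open>S\<close>.\<close>
  have ex: "\<exists>b\<in>S. a < b \<and> (\<forall>i<n. (\<exists>s\<in>S. q i < s) \<longrightarrow> q i < b)" if "a \<in> S" for a n
  proof (induction n)
    case 0
    then show ?case using assms(1) that by (auto simp: no_max_def)
  next
    case (Suc n)
    then obtain b where b: "b \<in> S" "a < b" "\<forall>i<n. (\<exists>s\<in>S. q i < s) \<longrightarrow> q i < b" by blast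
    show ?case
    proof (cases "\<exists>s\<in>S. q n < s")
      case True
      then obtain s where "s \<in> S" "q n < s" by blast
      then show ?thesis using b by (intro bexI[of _ "max b s"]) (auto simp: less_Suc_eq max_def intro: less_le_trans)
    next
      case False
      then show ?thesis using b by (intro bexI[of _ b]) (auto simp: less_Suc_eq)
    qed
  qed
  have "\<exists>u::nat \<Rightarrow> real. \<forall>n. (u n \<in> S \<and> (n = 0 \<longrightarrow> u n = s)) \<and>
    (u n < u (Suc n) \<and> (\<forall>i<Suc n. (\<exists>s\<in>S. q i < s) \<longrightarrow> q i < u (Suc n)))"
  proof (rule dependent_nat_choice)
    fix a and n :: nat assume "a \<in> S \<and> (n = 0 \<longrightarrow> a = s)"
    then obtain b where "b \<in> S \<and> a < b \<and> (\<forall>i<Suc n. (\<exists>s\<in>S. q i < s) \<longrightarrow> q i < b)"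
      using ex[of a "Suc n"] by blast
    then show "\<exists>b. (b \<in> S \<and> (Suc n = 0 \<longrightarrow> b = s)) \<and> (a < b \<and> (\<forall>i<Suc n. (\<exists>s\<in>S. q i < s) \<longrightarrow> q i < b))"
      by blast
  qed (use assms(2) in auto)
  then obtain u :: "nat \<Rightarrow> real" where u: "\<And>n. u n \<in> S" "u 0 = s" "\<And>n. u n < u (Suc n)"
    "\<And>n i. i < Suc n \<Longrightarrow> (\<exists>s\<in>S. q i < s) \<Longrightarrow> q i < u (Suc n)" by metis
  have "\<exists>n. y < u n" if yS: "y \<in> S" for y
  proof -
    obtain y' where y': "y' \<in> S" "y < y'" using assms(1) yS by (auto simp: no_max_def)
    obtain r where r: "r \<in> \<rat>" "y < r" "r < y'" using Rats_dense_in_real[OF y'(2)] by blast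
    obtain i where "q i = r" using q r(1) by blast
    then have "r < u (Suc i)" using u(4)[of i i] y' r by auto
    then show ?thesis using r(2) less_trans by blast
  qed
  moreover have "strict_mono u" using u(3) by (simp add: strict_mono_Suc_iff)
  ultimately show ?thesis using u by blast
qed

lemma ex_coinitial_sequence:
  fixes S :: "real set"
  assumes "no_min S" "s \<in> S"
  shows "\<exists>u::nat \<Rightarrow> real. u 0 = s \<and> (\<forall>m n. m < n \<longrightarrow> u n < u m) \<and> (\<forall>n. u n \<in> S) \<and> (\<forall>y\<in>S. \<exists>n. u n < y)"
proof -
  have "no_max (uminus ` S)" using assms(1) by (auto simp: no_max_def no_min_def)
  moreover have "- s \<in> uminus ` S" using assms(2) by blast
  ultimately obtain u :: "nat \<Rightarrow> real" where "u 0 = - s \<and> strict_mono u \<and> (\<forall>n. u n \<in> uminus ` S) \<and> (\<forall>y\<in>uminus ` S. \<exists>n. y < u n)"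
    using ex_cofinal_sequence[of "uminus ` S" "- s"] by metis
  then have u: "u 0 = - s" "strict_mono u" "\<forall>n. u n \<in> uminus ` S" "\<forall>y\<in>uminus ` S. \<exists>n. y < u n" by blast+
  have "\<exists>n. - u n < y" if "y \<in> S" for y
  proof -
    obtain n where "- y < u n" using u(4) \<open>y \<in> S\<close> by blast
    then show ?thesis by (intro exI[of _ n]) simp
  qed
  moreover have "- u n \<in> S" for n using u(3)[rule_format, of n] by auto
  moreover have "- u n < - u m" if "m < n" for m n using strict_monoD[OF u(2) that] by simp
  ultimately show ?thesis
    using u(1) by (intro exI[of _ "\<lambda>n. - u n"]) simp
qed

lemma ex_int_sequence:
  fixes S :: "real set"
  assumes "no_min S" "no_max S" "S \<noteq> {}"
  shows "\<exists>x::int \<Rightarrow> real. strict_mono x \<and> (\<forall>k. x k \<in> S) \<and> (\<forall>y\<in>S. \<exists>k. x k < y) \<and> (\<forall>y\<in>S. \<exists>k. y < x k)"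
proof -
  obtain s where s: "s \<in> S" using assms(3) by blast
  obtain u :: "nat \<Rightarrow> real" where "u 0 = s \<and> strict_mono u \<and> (\<forall>n. u n \<in> S) \<and> (\<forall>y\<in>S. \<exists>n. y < u n)"
    using ex_cofinal_sequence[OF assms(2) s] by metis
  then have u: "u 0 = s" "strict_mono u" "\<And>n. u n \<in> S" "\<And>y. y \<in> S \<Longrightarrow> \<exists>n. y < u n" by blast+
  obtain d :: "nat \<Rightarrow> real" where "d 0 = s \<and> (\<forall>m n. m < n \<longrightarrow> d n < d m) \<and> (\<forall>n. d n \<in> S) \<and> (\<forall>y\<in>S. \<exists>n. d n < y)"
    using ex_coinitial_sequence[OF assms(1) s] by metis
  then have d: "d 0 = s" "\<And>m n. m < n \<Longrightarrow> d n < d m" "\<And>n. d n \<in> S" "\<And>y. y \<in> S \<Longrightarrow> \<exists>n. d n < y" by blast+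
  define x where "x k = (if k \<ge> 0 then u (nat k) else d (nat (- k)))" for k
  have "x k < x l" if "k < l" for k l
  proof -
    consider "k \<ge> 0" | "l \<le> 0" | "k < 0" "0 < l" by linarith
    then show ?thesis
    proof cases
      case 1
      then show ?thesis using u(2) that by (simp add: x_def strict_mono_less)
    next
      case 2
      then have "d (nat (- k)) < d (nat (- l))" using d(2) that by simp
      then show ?thesis using 2 that d(1) u(1) by (cases "l = 0") (auto simp: x_def)
    next
      case 3
      then have "d (nat (- k)) < s" using d(1) d(2)[of 0 "nat (- k)"] by simp
      moreover have "s < u (nat l)" using 3 u(1,2) by (metis strict_monoD zero_less_nat_eq)
      ultimately show ?thesis using 3 by (simp add: x_def)
    qed
  qed
  then have "strict_mono x" by (simp add: strict_mono_def)
  moreover have "x k \<in> S" for k using u(3) d(3) by (simp add: x_def)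
  moreover have "\<exists>k. y < x k" if yS: "y \<in> S" for y
  proof -
    obtain n where "y < u n" using u(4)[OF yS] by blast
    then have "y < x (int n)" by (simp add: x_def)
    then show ?thesis by blast
  qed
  moreover have "\<exists>k. x k < y" if yS: "y \<in> S" for y
  proof -
    obtain n where "d n < y" using d(4)[OF yS] by blast
    then have "x (- int n) < y" using u(1) d(1) by (cases "n = 0") (simp_all add: x_def)
    then show ?thesis by blast
  qed
  ultimately show ?thesis by blast
qed

text \<open>The floor of \<open>z\<close> on the scale given by \<open>u\<close>.\<close>

definition step_index :: "(int \<Rightarrow> real) \<Rightarrow> real \<Rightarrow> int" where
  "step_index u z = (THE k. u k \<le> z \<and> z < u (k + 1))"

lemma step_index_eq:
  assumes "strict_mono u" "u k \<le> z" "z < u (k + 1)"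
  shows "step_index u z = k"
  unfolding step_index_def
proof (rule the_equality)
  fix l assume "u l \<le> z \<and> z < u (l + 1)"
  then have "u k < u (l + 1)" "u l < u (k + 1)" using assms(2,3) by linarith+
  then show "l = k" unfolding strict_mono_less[OF assms(1)] by simp
qed (use assms in blast)

lemma step_index_bounds:
  assumes "strict_mono u" "\<exists>a. u a < z" "\<exists>b. z < u b"
  shows "u (step_index u z) \<le> z \<and> z < u (step_index u z + 1)"
proof -
  obtain a b where ab: "u a < z" "z < u b" using assms(2,3) by blast
  then have "u a < u b" by simp
  then have "a < b" unfolding strict_mono_less[OF assms(1)] .
  define S where "S = {k \<in> {a..b}. u k \<le> z}"
  have "finite S" unfolding S_def by (rule finite_subset[of _ "{a..b}"]) auto
  moreover have "a \<in> S" using ab \<open>a < b\<close> by (auto simp: S_def)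
  ultimately have S: "finite S" "S \<noteq> {}" by auto
  define k where "k = Max S"
  have "k \<in> S" using Max_in[OF S] by (simp add: k_def)
  have "k + 1 \<notin> S" using Max_ge[OF S(1), of "k + 1"] by (auto simp: k_def)
  moreover have "k \<noteq> b" using \<open>k \<in> S\<close> ab by (auto simp: S_def)
  ultimately have "u k \<le> z" "z < u (k + 1)" using \<open>k \<in> S\<close> by (auto simp: S_def)
  then show ?thesis using step_index_eq[OF assms(1)] by blast
qed

lemma step_index_mono:
  assumes "strict_mono u" "\<And>z. z \<in> S \<Longrightarrow> \<exists>a. u a < z" "\<And>z. z \<in> S \<Longrightarrow> \<exists>b. z < u b"
  shows "mono_on S (step_index u)"
proof (rule mono_onI)
  fix y z assume "y \<in> S" "z \<in> S" "y \<le> z"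
  then have "u (step_index u y) < u (step_index u z + 1)"
    using step_index_bounds[OF assms(1) assms(2)[of y] assms(3)[of y]]
      step_index_bounds[OF assms(1) assms(2)[of z] assms(3)[of z]] by simp
  then show "step_index u y \<le> step_index u z" unfolding strict_mono_less[OF assms(1)] by simp
qed

section \<open>Kinds of convex sets\<close>

definition kind_of :: "('a::linorder \<Rightarrow> nat) \<Rightarrow> 'a set \<Rightarrow> nat set \<times> nat set \<times> bool" where
  "kind_of f S = (min_colour f S, max_colour f S, \<exists>x. S = {x})"

text \<open>Exactly the kinds that can be prescribed: kinds of nonempty sets coloured from
  \<open>T\<close> satisfy this (\<open>valid_kind_of\<close>), and each one is realised between any
  two points (\<open>ex_piece_of_kind\<close>).\<close>

definition valid_kind :: "nat set \<Rightarrow> nat set \<times> nat set \<times> bool \<Rightarrow> bool" where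
  "valid_kind T \<kappa> \<longleftrightarrow> (case \<kappa> of (l, r, b) \<Rightarrow>
     if b then \<exists>t\<in>T. l = {t} \<and> r = {t}
     else (l = {} \<or> (\<exists>t\<in>T. l = {t})) \<and> (r = {} \<or> (\<exists>t\<in>T. r = {t})))"

lemma min_colour_cases: "f ` S \<subseteq> T \<Longrightarrow> min_colour f S = {} \<or> (\<exists>t\<in>T. min_colour f S = {t})"
proof (cases "\<exists>m\<in>S. \<forall>y\<in>S. m \<le> y")
  case True
  then obtain m where m: "m \<in> S" "\<And>y. y \<in> S \<Longrightarrow> m \<le> y" by blast
  assume "f ` S \<subseteq> T"
  then show ?thesis using min_colour_eq[OF m] m(1) by auto
qed (auto simp: min_colour_def)

lemma max_colour_cases: "f ` S \<subseteq> T \<Longrightarrow> max_colour f S = {} \<or> (\<exists>t\<in>T. max_colour f S = {t})"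
proof (cases "\<exists>m\<in>S. \<forall>y\<in>S. y \<le> m")
  case True
  then obtain m where m: "m \<in> S" "\<And>y. y \<in> S \<Longrightarrow> y \<le> m" by blast
  assume "f ` S \<subseteq> T"
  then show ?thesis using max_colour_eq[OF m] m(1) by auto
qed (auto simp: max_colour_def)

lemma kind_of_singleton: "kind_of f {x} = ({f x}, {f x}, True)"
  using min_colour_eq[of x "{x}" f] max_colour_eq[of x "{x}" f] by (simp add: kind_of_def)

lemma valid_kind_of: "f ` S \<subseteq> T \<Longrightarrow> valid_kind T (kind_of f S)"
proof (cases "\<exists>x. S = {x}")
  case True
  assume "f ` S \<subseteq> T"
  with True show ?thesis by (auto simp: valid_kind_def kind_of_singleton)
next
  case False
  assume "f ` S \<subseteq> T"
  with False show ?thesis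
    using min_colour_cases[of f S T] max_colour_cases[of f S T] by (simp add: valid_kind_def kind_of_def)
qed

lemma initial_in_le: "initial_in I D \<Longrightarrow> a \<in> D \<Longrightarrow> b \<in> I \<Longrightarrow> b \<le> a \<Longrightarrow> b \<in> D"
  unfolding initial_in_def by (metis order.order_iff_strict)

lemma min_colour_initial:
  assumes "initial_in I D" "D \<noteq> {}"
  shows "min_colour f D = min_colour f I"
proof -
  obtain d where d: "d \<in> D" using assms(2) by blast
  have sub: "D \<subseteq> I" using assms(1) by (simp add: initial_in_def)
  have "m \<in> D \<and> (\<forall>y\<in>D. m \<le> y) \<longleftrightarrow> m \<in> I \<and> (\<forall>y\<in>I. m \<le> y)" for m
  proof
    assume m: "m \<in> D \<and> (\<forall>y\<in>D. m \<le> y)"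
    have "m \<le> y" if "y \<in> I" for y
      using initial_in_le[OF assms(1), of m y] m that by (cases "y \<le> m") auto
    then show "m \<in> I \<and> (\<forall>y\<in>I. m \<le> y)" using m sub by blast
  next
    assume m: "m \<in> I \<and> (\<forall>y\<in>I. m \<le> y)"
    then have "m \<in> D" using initial_in_le[OF assms(1) d] d sub by blast
    then show "m \<in> D \<and> (\<forall>y\<in>D. m \<le> y)" using m sub by blast
  qed
  then show ?thesis by (simp add: min_colour_def)
qed

lemma max_colour_final:
  assumes "initial_in I D" "I - D \<noteq> {}"
  shows "max_colour f (I - D) = max_colour f I"
proof -
  obtain d where d: "d \<in> I" "d \<notin> D" using assms(2) by blast
  have "m \<in> I - D \<and> (\<forall>y\<in>I - D. y \<le> m) \<longleftrightarrow> m \<in> I \<and> (\<forall>y\<in>I. y \<le> m)" for m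
  proof
    assume m: "m \<in> I - D \<and> (\<forall>y\<in>I - D. y \<le> m)"
    have "y \<le> m" if "y \<in> I" for y
    proof (cases "y \<in> D")
      case True
      then show ?thesis using initial_in_le[OF assms(1), of y m] m by (meson DiffE linear)
    next
      case False
      then show ?thesis using m that by blast
    qed
    then show "m \<in> I \<and> (\<forall>y\<in>I. y \<le> m)" using m by blast
  next
    assume m: "m \<in> I \<and> (\<forall>y\<in>I. y \<le> m)"
    then have "m \<notin> D" using initial_in_le[OF assms(1), of m d] d by blast
    then show "m \<in> I - D \<and> (\<forall>y\<in>I - D. y \<le> m)" using m by blast
  qed
  then show ?thesis by (simp add: max_colour_def)
qed

text \<open>The piece is \<open>E - D\<close>. What remains below and above it is left open towards
  the piece, so that later the space between two pieces has no endpoints. A one-point piece is cut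
  out around a point of the right colour. Otherwise the two cuts are chosen independently, one below
  \<open>p\<close> and one above \<open>q\<close>, so that the piece contains both and is not a
  singleton.\<close>

lemma ex_piece_of_kind:
  assumes J: "small_on_thin J" "colour_dense T f J" and xy: "x \<in> J" "y \<in> J" "x < y" and \<kappa>: "valid_kind T \<kappa>"
  shows "\<exists>D E. initial_in J D \<and> initial_in J E \<and> D \<subseteq> E \<and> x \<in> D \<and> y \<notin> E \<and> no_max D \<and> no_min (J - E) \<and>
    E - D \<noteq> {} \<and> kind_of f (E - D) = \<kappa>"
proof -
  obtain l r b where lrb: "\<kappa> = (l, r, b)" by (cases \<kappa>) auto
  have dense: "\<exists>z\<in>J. a < z \<and> z < c" if "a \<in> J" "c \<in> J" "a < c" for a c
    using colour_dense_order_dense[OF J(2)] that unfolding order_dense_def by (metis (no_types))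
  show ?thesis
  proof (cases b)
    case True
    then obtain t where t: "t \<in> T" "l = {t}" "r = {t}" using \<kappa> lrb by (auto simp: valid_kind_def)
    then obtain c where c: "c \<in> J" "x < c" "c < y" "f c = t"
      using J(2) xy unfolding colour_dense_def by blast
    have eq: "{z \<in> J. z \<le> c} - {z \<in> J. z < c} = {c}" using c(1) by auto
    show ?thesis
    proof (intro exI conjI)
      show "initial_in J {z \<in> J. z < c}" "initial_in J {z \<in> J. z \<le> c}" by (auto simp: initial_in_def)
      show "no_max {z \<in> J. z < c}" using dense c(1) unfolding no_max_def by blast
      show "no_min (J - {z \<in> J. z \<le> c})"
        unfolding no_min_def
      proof
        fix a assume "a \<in> J - {z \<in> J. z \<le> c}"
        then have "a \<in> J" "c < a" by auto
        then obtain z where "z \<in> J" "c < z" "z < a" using dense c(1) by blast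
        then show "\<exists>b\<in>J - {z \<in> J. z \<le> c}. b < a" by (intro bexI[of _ z]) auto
      qed
      show "kind_of f ({z \<in> J. z \<le> c} - {z \<in> J. z < c}) = \<kappa>"
        unfolding eq kind_of_singleton using c t True lrb by simp
    qed (use c xy in auto)
  next
    case False
    then have lr: "l = {} \<or> (\<exists>t\<in>T. l = {t})" "r = {} \<or> (\<exists>t\<in>T. r = {t})"
      using \<kappa> lrb by (auto simp: valid_kind_def)
    obtain p where p: "p \<in> J" "x < p" "p < y" using dense[OF xy] by blast
    obtain q where q: "q \<in> J" "p < q" "q < y" using dense[OF p(1) xy(2) p(3)] by blast
    obtain D where D: "initial_in J D" "x \<in> D" "p \<notin> D" "no_max D" "min_colour f (J - D) = l"
      using ex_cut_min[OF J xy(1) p(1,2) lr(1)] by blast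
    obtain E where E: "initial_in J E" "q \<in> E" "y \<notin> E" "max_colour f E = r" "no_min (J - E)"
      using ex_cut_max[OF J q(1) xy(2) q(3) lr(2)] by blast
    have pE: "p \<in> E" using initial_in_le[OF E(1,2) p(1)] q by simp
    have sub: "D \<subseteq> E"
    proof
      fix d assume d: "d \<in> D"
      then have dJ: "d \<in> J" using D(1) by (auto simp: initial_in_def)
      have "d < p" using initial_in_le[OF D(1) d p(1)] D(3) by (meson not_le)
      then show "d \<in> E" using initial_in_le[OF E(1) pE dJ] by simp
    qed
    have qD: "q \<notin> D" using initial_in_le[OF D(1) _ p(1), of q] D(3) q(2) by auto
    have "initial_in (J - D) (E - D)" using E(1) by (auto simp: initial_in_def)
    then have "min_colour f (E - D) = l" using min_colour_initial[of "J - D" "E - D" f] pE D(3,5) by blast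
    moreover have "initial_in E D" using D(1) E(1) sub by (auto simp: initial_in_def)
    then have "max_colour f (E - D) = r" using max_colour_final[of E D f] pE D(3) E(4) by blast
    moreover have "\<not> (\<exists>z. E - D = {z})" using pE D(3) E(2) qD q(2) by (metis DiffI less_irrefl singletonD)
    ultimately have "kind_of f (E - D) = \<kappa>" using lrb False by (simp add: kind_of_def)
    then show ?thesis using D E sub pE by blast
  qed
qed

text \<open>Choose an unbounded sequence \<open>x\<close> of order type the integers and put the
  piece of kind \<open>\<kappa> k\<close> between \<open>x k\<close> and \<open>x (k + 1)\<close>.
  Even values of \<open>\<Lambda>\<close> are pieces, odd values are the gaps between consecutive
  pieces.\<close>

lemma ex_int_decomposition:
  fixes G :: "real set"
  assumes G: "small_on_thin G" "colour_dense T f G" "G \<noteq> {}" "no_endpoints G"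
    and \<kappa>: "\<And>k::int. valid_kind T (\<kappa> k)"
  shows "\<exists>\<Lambda>::real \<Rightarrow> int. mono_on G \<Lambda> \<and>
    (\<forall>k. G \<inter> \<Lambda> -` {2 * k} \<noteq> {} \<and> kind_of f (G \<inter> \<Lambda> -` {2 * k}) = \<kappa> k) \<and>
    (\<forall>k. G \<inter> \<Lambda> -` {2 * k + 1} \<noteq> {} \<and> no_endpoints (G \<inter> \<Lambda> -` {2 * k + 1}))"
proof -
  obtain x :: "int \<Rightarrow> real" where x: "strict_mono x" "\<And>k. x k \<in> G" "\<And>y. y \<in> G \<Longrightarrow> \<exists>k. x k < y"
    "\<And>y. y \<in> G \<Longrightarrow> \<exists>k. y < x k"
    using ex_int_sequence[of G] G(3,4) no_endpoints_iff by blast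
  have xl: "x k < x l \<longleftrightarrow> k < l" for k l using x(1) by (rule strict_mono_less)
  have "\<forall>k. \<exists>DE. initial_in G (fst DE) \<and> initial_in G (snd DE) \<and> fst DE \<subseteq> snd DE \<and> x k \<in> fst DE \<and>
      x (k + 1) \<notin> snd DE \<and> no_max (fst DE) \<and> no_min (G - snd DE) \<and>
      snd DE - fst DE \<noteq> {} \<and> kind_of f (snd DE - fst DE) = \<kappa> k"
  proof
    fix k
    have "x k < x (k + 1)" by (simp add: xl)
    from ex_piece_of_kind[OF G(1,2) x(2) x(2) this \<kappa>[of k]]
    show "\<exists>DE. initial_in G (fst DE) \<and> initial_in G (snd DE) \<and> fst DE \<subseteq> snd DE \<and> x k \<in> fst DE \<and>
      x (k + 1) \<notin> snd DE \<and> no_max (fst DE) \<and> no_min (G - snd DE) \<and>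
      snd DE - fst DE \<noteq> {} \<and> kind_of f (snd DE - fst DE) = \<kappa> k" by simp
  qed
  from choice[OF this] obtain DE where DE: "\<And>k. initial_in G (fst (DE k)) \<and> initial_in G (snd (DE k)) \<and>
      fst (DE k) \<subseteq> snd (DE k) \<and> x k \<in> fst (DE k) \<and>
      x (k + 1) \<notin> snd (DE k) \<and> no_max (fst (DE k)) \<and> no_min (G - snd (DE k)) \<and>
      snd (DE k) - fst (DE k) \<noteq> {} \<and> kind_of f (snd (DE k) - fst (DE k)) = \<kappa> k" by blast
  define D where "D k = fst (DE k)" for k
  define E where "E k = snd (DE k)" for k
  have D: "initial_in G (D k)" "x k \<in> D k" "no_max (D k)" "D k \<subseteq> E k" for k using DE[of k] by (simp_all add: D_def E_def)
  have E: "initial_in G (E k)" "x (k + 1) \<notin> E k" "no_min (G - E k)" "E k - D k \<noteq> {}" "kind_of f (E k - D k) = \<kappa> k"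
    for k using DE[of k] by (simp_all add: D_def E_def)
  have subG: "D k \<subseteq> G" "E k \<subseteq> G" for k using D(1) E(1) by (auto simp: initial_in_def)
  define fl where "fl = step_index x"
  have fl: "x (fl z) \<le> z \<and> z < x (fl z + 1)" if "z \<in> G" for z
    using step_index_bounds[OF x(1) x(3)[OF that] x(4)[OF that]] by (simp add: fl_def)
  have fl_eq: "fl z = k" if "z \<in> G" "x k \<le> z" "z < x (k + 1)" for z k
    using step_index_eq[OF x(1) that(2,3)] by (simp add: fl_def)
  \<comment> \<open>The gap with value \<open>2 * k + 1\<close> straddles \<open>x (k + 1)\<close>:
    it consists of what follows piece \<open>k\<close> in one interval and of what precedes piece
    \<open>k + 1\<close> in the next. This is why the part in \<open>D\<close> gets
    \<open>2 * fl z - 1\<close>.\<close>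
  define \<Lambda> where "\<Lambda> z = (if z \<in> D (fl z) then 2 * fl z - 1 else if z \<in> E (fl z) then 2 * fl z else 2 * fl z + 1)" for z
  have mono: "mono_on G \<Lambda>"
  proof (rule mono_onI)
    fix z w assume zw: "z \<in> G" "w \<in> G" "z \<le> w"
    have "x (fl z) < x (fl w + 1)" using fl[OF zw(1)] fl[OF zw(2)] zw(3) by linarith
    then have "fl z \<le> fl w" unfolding xl by simp
    then consider "fl z < fl w" | "fl z = fl w" by linarith
    then show "\<Lambda> z \<le> \<Lambda> w"
    proof cases
      case 2
      have "w \<in> D (fl w) \<Longrightarrow> z \<in> D (fl w)" "w \<in> E (fl w) \<Longrightarrow> z \<in> E (fl w)"
        using initial_in_le[OF D(1) _ zw(1,3)] initial_in_le[OF E(1) _ zw(1,3)] by blast+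
      then show ?thesis using 2 by (auto simp: \<Lambda>_def)
    qed (auto simp: \<Lambda>_def)
  qed
  have even: "G \<inter> \<Lambda> -` {2 * k} = E k - D k" for k
  proof (intro equalityI subsetI)
    fix z assume z: "z \<in> G \<inter> \<Lambda> -` {2 * k}"
    then have "\<Lambda> z = 2 * k" by simp
    then have "fl z = k \<and> z \<in> E k - D k" by (auto simp: \<Lambda>_def split: if_splits; presburger)
    then show "z \<in> E k - D k" by simp
  next
    fix z assume z: "z \<in> E k - D k"
    then have zG: "z \<in> G" using subG by blast
    have "x k \<le> z" using initial_in_le[OF D(1,2) zG] z by force
    moreover have "z < x (k + 1)" using initial_in_le[OF E(1) _ x(2), of z] E(2) z by force
    ultimately have "fl z = k" using fl_eq zG by blast
    then show "z \<in> G \<inter> \<Lambda> -` {2 * k}" using z zG by (auto simp: \<Lambda>_def)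
  qed
  have odd: "G \<inter> \<Lambda> -` {2 * k + 1} = D (k + 1) - E k" for k
  proof (intro equalityI subsetI)
    fix z assume z: "z \<in> G \<inter> \<Lambda> -` {2 * k + 1}"
    then have zG: "z \<in> G" and "\<Lambda> z = 2 * k + 1" by simp_all
    then consider "2 * fl z - 1 = 2 * k + 1" "z \<in> D (fl z)" | "2 * fl z + 1 = 2 * k + 1" "z \<notin> E (fl z)"
      | "2 * fl z = 2 * k + 1"
      unfolding \<Lambda>_def by (meson)
    then consider "fl z = k + 1" "z \<in> D (k + 1)" | "fl z = k" "z \<notin> E k"
    proof cases
      case 1
      then have eq: "fl z = k + 1" by presburger
      show ?thesis by (rule that(1)[OF eq]) (use 1(2) eq in simp)
    next
      case 2
      then have eq: "fl z = k" by presburger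
      show ?thesis by (rule that(2)[OF eq]) (use 2(2) eq in simp)
    next
      case 3
      then show ?thesis by presburger
    qed
    then show "z \<in> D (k + 1) - E k"
    proof cases
      case 1
      then have "x (k + 1) \<le> z" using fl[OF zG] by simp
      then have "z \<notin> E k" using initial_in_le[OF E(1) _ x(2), of z k "k + 1"] E(2) by blast
      then show ?thesis using 1 by simp
    next
      case 2
      then have "z \<le> x (k + 1)" using fl[OF zG] by simp
      then show ?thesis using initial_in_le[OF D(1,2) zG] 2 by blast
    qed
  next
    fix z assume z: "z \<in> D (k + 1) - E k"
    then have zG: "z \<in> G" using subG by blast
    have "x k \<le> z" using initial_in_le[OF D(1,2) zG, of k] D(4) z by force
    moreover have "x (k + 2) \<notin> E (k + 1)" using E(2)[of "k + 1"] by (simp add: add.assoc)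
    then have "z < x (k + 2)"
      using initial_in_le[OF E(1) _ x(2), of z "k + 1" "k + 2"] D(4)[of "k + 1"] z by force
    ultimately consider "fl z = k" | "fl z = k + 1"
      using fl_eq[OF zG, of k] fl_eq[OF zG, of "k + 1"] by (cases "z < x (k + 1)") (auto simp: add.commute)
    then show "z \<in> G \<inter> \<Lambda> -` {2 * k + 1}"
      using z zG D(4) by cases (auto simp: \<Lambda>_def)
  qed
  have ne: "D (k + 1) - E k \<noteq> {}" for k using D(2)[of "k + 1"] E(2)[of k] by blast
  have ends: "no_endpoints (D (k + 1) - E k)" for k
    unfolding no_endpoints_def
  proof (intro ballI conjI)
    fix z assume z: "z \<in> D (k + 1) - E k"
    then obtain w where w: "w \<in> G - E k" "w < z" using E(3)[of k] subG unfolding no_min_def by blast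
    then have "w \<in> D (k + 1)" using initial_in_le[OF D(1), of z "k + 1" w] z by auto
    then show "\<exists>y\<in>D (k + 1) - E k. y < z" using w by blast
    obtain v where v: "v \<in> D (k + 1)" "z < v" using D(3) z unfolding no_max_def by blast
    then have "v \<notin> E k" using initial_in_le[OF E(1), of v k z] z subG by auto
    then show "\<exists>y\<in>D (k + 1) - E k. z < y" using v by blast
  qed
  show ?thesis
  proof (intro exI conjI allI)
    show "mono_on G \<Lambda>" by (rule mono)
    show "G \<inter> \<Lambda> -` {2 * k} \<noteq> {}" "kind_of f (G \<inter> \<Lambda> -` {2 * k}) = \<kappa> k" for k
      unfolding even by (rule E)+
    show "G \<inter> \<Lambda> -` {2 * k + 1} \<noteq> {}" "no_endpoints (G \<inter> \<Lambda> -` {2 * k + 1})" for k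
      unfolding odd by (rule ne ends)+
  qed
qed

text \<open>A tree of gaps: at level \<open>n\<close>, a gap is cut by \<open>Lam n\<close> into pieces (even values) and gaps of the next
  level (odd values). On odd levels all pieces are of the kind \<open>ho\<close> of several points, so a gap together with its two
  neighbouring pieces can be merged to one piece of the same kind. A set \<open>\<sigma>\<close> decides on each odd level which half of
  the gaps is kept; the points which always stay in kept gaps form pairwise disjoint sets \<open>leftover \<sigma>\<close>.\<close>

locale gap_tree =
  fixes J :: "real set" and T :: "nat set" and f :: "real \<Rightarrow> nat" and H :: "nat set"
    and \<kappa> :: "nat \<Rightarrow> nat set \<times> nat set \<times> bool"
    and hs :: "int \<Rightarrow> nat" and ho :: nat and Lam :: "nat \<Rightarrow> real set \<Rightarrow> real \<Rightarrow> int"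
  assumes small: "small_on_thin J" and J: "J \<noteq> {}" "no_endpoints J"
    and Lam: "\<And>n G. convex_in J G \<Longrightarrow> G \<noteq> {} \<Longrightarrow> no_endpoints G \<Longrightarrow> mono_on G (Lam n G) \<and>
      (\<forall>k. G \<inter> Lam n G -` {2 * k} \<noteq> {} \<and>
         kind_of f (G \<inter> Lam n G -` {2 * k}) = \<kappa> (if even n then hs k else ho)) \<and>
      (\<forall>k. G \<inter> Lam n G -` {2 * k + 1} \<noteq> {} \<and> no_endpoints (G \<inter> Lam n G -` {2 * k + 1}))"
    and ho: "ho \<in> H" "\<not> snd (snd (\<kappa> ho))"
    and hs: "\<And>k. hs k \<in> H" "\<And>h k. h \<in> H \<Longrightarrow> \<exists>j<k. hs j = h" "\<And>h k. h \<in> H \<Longrightarrow> \<exists>j>k. hs j = h"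
begin

definition gap :: "real set \<Rightarrow> bool" where
  "gap G \<longleftrightarrow> convex_in J G \<and> G \<noteq> {} \<and> no_endpoints G"

text \<open>The points with the same address as \<open>x\<close> on the first \<open>n\<close>
  levels (\<open>in_gs_iff\<close>). This is a gap as long as the address consists of odd numbers;
  once a piece has been entered, nothing is known about \<open>Lam\<close> there, and the later
  values carry no information.\<close>

primrec gs :: "nat \<Rightarrow> real \<Rightarrow> real set" where
  "gs 0 x = J"
| "gs (Suc n) x = gs n x \<inter> Lam n (gs n x) -` {Lam n (gs n x) x}"

definition code :: "nat \<Rightarrow> real \<Rightarrow> int" where
  "code n x = Lam n (gs n x) x"

text \<open>On even levels all gaps are kept. On level \<open>2 * m + 1\<close> every second gap is
  kept, and membership of \<open>m\<close> in \<open>\<sigma>\<close> decides whether these are the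
  codes congruent to 1 or to 3 modulo 4 (\<open>keep_odd\<close>). Two sets that differ at
  \<open>m\<close> keep complementary halves there.\<close>

definition keep :: "nat set \<Rightarrow> nat \<Rightarrow> int \<Rightarrow> bool" where
  "keep \<sigma> n a \<longleftrightarrow> odd a \<and> (odd n \<longrightarrow> (even (a div 2) \<longleftrightarrow> n div 2 \<in> \<sigma>))"

definition alive :: "nat set \<Rightarrow> nat \<Rightarrow> real \<Rightarrow> bool" where
  "alive \<sigma> n x \<longleftrightarrow> x \<in> J \<and> (\<forall>m<n. keep \<sigma> m (code m x))"

definition leftover :: "nat set \<Rightarrow> real set" where
  "leftover \<sigma> = {x \<in> J. \<forall>n. keep \<sigma> n (code n x)}"

lemma gs_Suc: "gs (Suc n) x = gs n x \<inter> Lam n (gs n x) -` {code n x}"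
  by (simp add: code_def)

lemma self_in_gs: "x \<in> J \<Longrightarrow> x \<in> gs n x"
  by (induction n) auto

lemma gs_anti: "m \<le> n \<Longrightarrow> gs n x \<subseteq> gs m x"
  by (induction rule: dec_induct) auto

lemma gs_eq: "y \<in> gs n x \<Longrightarrow> gs n y = gs n x"
proof (induction n)
  case (Suc n)
  then have "gs n y = gs n x" by auto
  then show ?case using Suc.prems by auto
qed simp

lemma gs_sub: "gs n x \<subseteq> J"
  using gs_anti[of 0 n] by simp

lemma code_eq: "y \<in> gs n x \<Longrightarrow> code n y = Lam n (gs n x) y"
  by (simp add: code_def gs_eq)

lemma in_gs_iff: "x \<in> J \<Longrightarrow> y \<in> gs n x \<longleftrightarrow> y \<in> J \<and> (\<forall>m<n. code m y = code m x)"
proof (induction n)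
  case (Suc n)
  have "y \<in> gs (Suc n) x \<longleftrightarrow> y \<in> gs n x \<and> code n y = code n x"
    using code_eq[of y n x] unfolding gs_Suc by auto
  then show ?case using Suc by (auto simp: less_Suc_eq)
qed simp

lemma gap_0: "gap J"
  using J by (auto simp: gap_def convex_in_def)

lemma gap_sub:
  assumes "gap G"
  shows "mono_on G (Lam n G)" "G \<inter> Lam n G -` {2 * k} \<noteq> {}"
    "kind_of f (G \<inter> Lam n G -` {2 * k}) = \<kappa> (if even n then hs k else ho)"
    "gap (G \<inter> Lam n G -` {2 * k + 1})"
proof -
  note * = Lam[of G n] assms[unfolded gap_def]
  show mono: "mono_on G (Lam n G)" "G \<inter> Lam n G -` {2 * k} \<noteq> {}"
    "kind_of f (G \<inter> Lam n G -` {2 * k}) = \<kappa> (if even n then hs k else ho)"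
    using * by blast+
  have "convex_in J (G \<inter> Lam n G -` {2 * k + 1})" using * mono by (intro convex_in_Int_vimage) auto
  then show "gap (G \<inter> Lam n G -` {2 * k + 1})" using * unfolding gap_def by blast
qed

lemma gap_odd: "gap G \<Longrightarrow> odd a \<Longrightarrow> gap (G \<inter> Lam n G -` {a})"
  by (elim oddE) (simp add: gap_sub)

lemma gap_fibre: "gap G \<Longrightarrow> \<exists>z\<in>G. Lam n G z = a"
proof (cases "even a")
  case True
  assume "gap G"
  from True obtain k where "a = 2 * k" by blast
  then show ?thesis using gap_sub(2)[OF \<open>gap G\<close>, of n k] by auto
next
  case False
  assume "gap G"
  then show ?thesis using gap_odd[OF \<open>gap G\<close> False, of n] by (auto simp: gap_def)
qed

lemma gap_gs: "(\<forall>m<n. odd (code m x)) \<Longrightarrow> gap (gs n x)"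
  by (induction n) (auto simp: gap_0 gs_Suc intro!: gap_odd simp del: gs.simps(2))

lemma alive_odd: "alive \<sigma> n x \<Longrightarrow> \<forall>m<n. odd (code m x)"
  by (simp add: alive_def keep_def)

lemma alive_gap: "alive \<sigma> n x \<Longrightarrow> gap (gs n x)"
  using gap_gs alive_odd by blast

lemma alive_gs: "alive \<sigma> n x \<Longrightarrow> y \<in> gs n x \<Longrightarrow> alive \<sigma> n y"
  by (simp add: alive_def in_gs_iff)

lemma code_mono:
  assumes "gap (gs n x)" "y \<in> gs n x" "z \<in> gs n x" "y \<le> z"
  shows "code n y \<le> code n z"
  using mono_onD[OF gap_sub(1)[OF assms(1)] assms(2-4)] code_eq assms(2,3) by simp

lemma code_less:
  assumes "gap (gs n x)" "y \<in> gs n x" "z \<in> gs n x" "code n y < code n z"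
  shows "y < z"
  using code_mono[OF assms(1,3,2)] assms(4) by force

lemma leftover_disjoint: "\<sigma> \<noteq> \<tau> \<Longrightarrow> leftover \<sigma> \<inter> leftover \<tau> = {}"
proof (rule ccontr)
  assume "\<sigma> \<noteq> \<tau>" "leftover \<sigma> \<inter> leftover \<tau> \<noteq> {}"
  then obtain x where x: "\<And>n. keep \<sigma> n (code n x)" "\<And>n. keep \<tau> n (code n x)"
    by (auto simp: leftover_def)
  have "m \<in> \<sigma> \<longleftrightarrow> m \<in> \<tau>" for m
    using x[of "2 * m + 1"] by (simp add: keep_def)
  then show False using \<open>\<sigma> \<noteq> \<tau>\<close> by blast
qed

text \<open>Let \<open>n\<close> be the first level where the addresses of \<open>x\<close> and
  \<open>y\<close> differ. On a later odd level consider the piece \<open>P\<close> just to the left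
  of the gap that contains \<open>y\<close>. It has two points \<open>u < v\<close>, as the kind of
  \<open>ho\<close> is not a singleton. It contains no point that stays in gaps forever, whatever
  set decides which gaps are kept, because its code is even.\<close>

lemma leftover_separated:
  assumes "\<sigma> \<noteq> \<tau>" "x \<in> leftover \<sigma>" "y \<in> leftover \<tau>" "x < y"
  shows "\<exists>u v. x \<le> u \<and> u < v \<and> v \<le> y \<and> \<Union>(range leftover) \<inter> {u<..<v} = {}"
proof -
  have xy: "x \<in> J" "y \<in> J" using assms(2,3) by (auto simp: leftover_def)
  have odd: "odd (code n x)" "odd (code n y)" for n using assms(2,3) by (auto simp: leftover_def keep_def)
  have "\<exists>n. code n x \<noteq> code n y"
  proof (rule ccontr)
    assume "\<not> ?thesis"
    then have "x \<in> leftover \<tau>" using assms(3) xy by (auto simp: leftover_def)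
    then show False using leftover_disjoint[OF assms(1)] assms(2) by blast
  qed
  then have "\<exists>n. code n x \<noteq> code n y \<and> (\<forall>m<n. code m x = code m y)"
    by (rule exists_least_iff[THEN iffD1, THEN ex_forward]) auto
  then obtain n where n: "code n x \<noteq> code n y" "\<forall>m<n. code m x = code m y" by blast
  have xG: "x \<in> gs n y" using n(2) xy by (simp add: in_gs_iff)
  have yG: "y \<in> gs m y" for m using self_in_gs xy by blast
  have gap: "gap (gs m y)" for m using gap_gs odd by blast
  have lt: "code n x < code n y" using code_mono[OF gap xG yG] assms(4) n(1) by force
  \<comment> \<open>Odd, so that \<open>P\<close> has kind \<open>\<kappa> ho\<close>; greater than
    \<open>n\<close>, so that \<open>P\<close> lies in the level \<open>n\<close> gap of
    \<open>y\<close> and hence above \<open>x\<close>.\<close>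
  define m where "m = (if even n then n + 1 else n + 2)"
  have m: "odd m" "Suc n \<le> m" by (auto simp: m_def)
  obtain k where k: "code m y = 2 * k + 1" using odd(2) by (meson oddE)
  define P where "P = gs m y \<inter> Lam m (gs m y) -` {2 * k}"
  have P: "P \<noteq> {}" "kind_of f P = \<kappa> ho" using gap_sub(2)[OF gap[of m], of m k] gap_sub(3)[OF gap[of m], of m k] m(1) by (auto simp: P_def)
  have "(\<exists>z. P = {z}) \<longleftrightarrow> snd (snd (kind_of f P))" by (simp add: kind_of_def)
  then have "\<not> (\<exists>z. P = {z})" unfolding P(2) using ho(2) by (rule ssubst)
  then obtain u v where uv: "u \<in> P" "v \<in> P" "u < v" using P(1) by (metis is_singletonI' is_singleton_def linorder_neqE)
  have P_code: "code m z = 2 * k" if "z \<in> P" for z using that code_eq by (auto simp: P_def)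
  have P_sub: "P \<subseteq> gs m y" by (auto simp: P_def)
  have "convex_in J P"
    unfolding P_def using gap[of m] gap_sub(1)[OF gap[of m]] by (intro convex_in_Int_vimage) (auto simp: gap_def)
  have "x \<le> u"
  proof -
    have "u \<in> gs (Suc n) y" using uv(1) P_sub gs_anti[OF m(2)] by blast
    then have "u \<in> gs n y" "code n u = code n y" using in_gs_iff[OF xy(2), of u "Suc n"] by (simp, blast)
    then show ?thesis using code_less[OF gap xG] lt by force
  qed
  moreover have "v \<le> y"
    using code_less[OF gap[of m] _ yG, of v] uv(2) P_sub P_code[OF uv(2)] k by force
  moreover have "\<Union>(range leftover) \<inter> {u<..<v} = {}"
  proof (rule ccontr)
    assume "\<not> ?thesis"
    then obtain \<rho> z where z: "z \<in> leftover \<rho>" "u < z" "z < v" by auto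
    then have "z \<in> J" by (auto simp: leftover_def)
    then have "z \<in> P" using \<open>convex_in J P\<close> uv z unfolding convex_in_def by blast
    moreover have "odd (code m z)" using z(1) by (simp add: leftover_def keep_def)
    ultimately show False using P_code[of z] by simp
  qed
  ultimately show ?thesis using uv(3) by blast
qed

lemma ex_no_leftover: "\<exists>\<sigma>. leftover \<sigma> = {}"
proof (rule separated_family_has_empty[OF small])
  show "leftover \<sigma> \<subseteq> J" for \<sigma> by (auto simp: leftover_def)
  show "leftover \<sigma> \<inter> leftover \<tau> = {}" if "\<sigma> \<noteq> \<tau>" for \<sigma> \<tau>
    using that by (rule leftover_disjoint)
  show "\<exists>u v. x \<le> u \<and> u < v \<and> v \<le> y \<and> \<Union>(range leftover) \<inter> {u<..<v} = {}"
    if "\<sigma> \<noteq> \<tau>" "x \<in> leftover \<sigma>" "y \<in> leftover \<tau>" "x < y" for \<sigma> \<tau> x y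
    using that by (rule leftover_separated)
qed

text \<open>The offset makes \<open>cluster \<sigma> n\<close> constant exactly on the maximal runs of indices that are not kept.\<close>

definition cluster :: "nat set \<Rightarrow> nat \<Rightarrow> int \<Rightarrow> int" where
  "cluster \<sigma> n a = (if even n then a else (a - (if n div 2 \<in> \<sigma> then 2 else 4)) div 4)"

definition exit_level :: "nat set \<Rightarrow> real \<Rightarrow> nat" where
  "exit_level \<sigma> x = (LEAST n. \<not> keep \<sigma> n (code n x))"

text \<open>The pieces of the final decomposition. On an even level a cell is one piece. On an odd
  level it is a run piece, discarded gap, piece; its endpoints are those of the two outer pieces, so
  it still has the kind of \<open>ho\<close>.\<close>

definition cell :: "nat set \<Rightarrow> real \<Rightarrow> real set" where
  "cell \<sigma> x = {y \<in> gs (exit_level \<sigma> x) x. \<not> keep \<sigma> (exit_level \<sigma> x) (code (exit_level \<sigma> x) y) \<and>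
     cluster \<sigma> (exit_level \<sigma> x) (code (exit_level \<sigma> x) y) =
     cluster \<sigma> (exit_level \<sigma> x) (code (exit_level \<sigma> x) x)}"

definition label :: "nat set \<Rightarrow> real \<Rightarrow> nat" where
  "label \<sigma> x = (if even (exit_level \<sigma> x) then hs (code (exit_level \<sigma> x) x div 2) else ho)"

lemma keep_odd: "odd n \<Longrightarrow> keep \<sigma> n a \<longleftrightarrow> a mod 4 = (if n div 2 \<in> \<sigma> then 1 else 3)"
proof -
  assume "odd n"
  have "odd a \<and> even (a div 2) \<longleftrightarrow> a mod 4 = 1" "odd a \<and> odd (a div 2) \<longleftrightarrow> a mod 4 = 3"
    by presburger+
  then show ?thesis using \<open>odd n\<close> by (auto simp: keep_def)
qed

text \<open>The runs between consecutive kept codes are \<open>4 * q + 2\<close> to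
  \<open>4 * q + 4\<close> if the codes congruent to 1 are kept, and \<open>4 * q + 4\<close> to
  \<open>4 * q + 6\<close> if those congruent to 3 are. Subtracting 2 or 4 moves the start of a run
  to \<open>4 * q\<close>, hence the offsets in \<open>cluster\<close>.\<close>

lemma run_bounds:
  fixes a q :: int
  shows "a mod 4 \<noteq> 1 \<Longrightarrow> 4 * ((a - 2) div 4) + 2 \<le> a \<and> a \<le> 4 * ((a - 2) div 4) + 4"
    and "a mod 4 \<noteq> 3 \<Longrightarrow> 4 * ((a - 4) div 4) + 4 \<le> a \<and> a \<le> 4 * ((a - 4) div 4) + 6"
    and "4 * q + 2 \<le> a \<Longrightarrow> a \<le> 4 * q + 4 \<Longrightarrow> a mod 4 \<noteq> 1 \<and> (a - 2) div 4 = q"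
    and "4 * q + 4 \<le> a \<Longrightarrow> a \<le> 4 * q + 6 \<Longrightarrow> a mod 4 \<noteq> 3 \<and> (a - 4) div 4 = q"
  by presburger+

lemma cluster_convex:
  assumes "\<not> keep \<sigma> n a" "\<not> keep \<sigma> n c" "cluster \<sigma> n a = cluster \<sigma> n c" "a \<le> b" "b \<le> c"
  shows "\<not> keep \<sigma> n b \<and> cluster \<sigma> n b = cluster \<sigma> n c"
proof (cases "even n")
  case True
  then show ?thesis using assms by (simp add: cluster_def)
next
  case False
  have "b mod 4 \<noteq> 1 \<and> (b - 2) div 4 = (c - 2) div 4"
    if "a mod 4 \<noteq> 1" "c mod 4 \<noteq> 1" "(a - 2) div 4 = (c - 2) div 4"
    using run_bounds(1)[OF that(1)] run_bounds(1)[OF that(2)] assms(4,5) that(3)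
    by (intro run_bounds(3)) linarith+
  moreover have "b mod 4 \<noteq> 3 \<and> (b - 4) div 4 = (c - 4) div 4"
    if "a mod 4 \<noteq> 3" "c mod 4 \<noteq> 3" "(a - 4) div 4 = (c - 4) div 4"
    using run_bounds(2)[OF that(1)] run_bounds(2)[OF that(2)] assms(4,5) that(3)
    by (intro run_bounds(4)) linarith+
  ultimately show ?thesis using assms(1-3) False unfolding cluster_def keep_odd[OF False]
    by (cases "n div 2 \<in> \<sigma>"; simp only: if_True if_False simp_thms; blast)
qed

lemma cluster_between:
  assumes "\<not> keep \<sigma> n a" "\<not> keep \<sigma> n b" "cluster \<sigma> n a \<noteq> cluster \<sigma> n b" "a < b"
  shows "\<exists>c. a < c \<and> c < b \<and> keep \<sigma> n c"
proof (cases "even n")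
  case True
  then have "even a" "even b" using assms by (auto simp: keep_def)
  then have "a + 1 < b" using assms(4) by presburger
  moreover have "keep \<sigma> n (a + 1)" using True \<open>even a\<close> by (simp add: keep_def)
  ultimately show ?thesis using zless_add1_eq by blast
next
  case False
  \<comment> \<open>The kept code immediately after the run of \<open>a\<close>: the run ends at
    \<open>4 * q + 4\<close>. In the other case it ends at \<open>4 * q + 6\<close>, which gives
    7.\<close>
  have "a < 4 * ((a - 2) div 4) + 5 \<and> 4 * ((a - 2) div 4) + 5 < b \<and> (4 * ((a - 2) div 4) + 5) mod 4 = 1"
    if "a mod 4 \<noteq> 1" "b mod 4 \<noteq> 1" "(a - 2) div 4 \<noteq> (b - 2) div 4"
  proof (intro conjI)
    show "a < 4 * ((a - 2) div 4) + 5" "4 * ((a - 2) div 4) + 5 < b"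
      using run_bounds(1)[OF that(1)] run_bounds(1)[OF that(2)] assms(4) that(3) by linarith+
  qed presburger
  moreover have "a < 4 * ((a - 4) div 4) + 7 \<and> 4 * ((a - 4) div 4) + 7 < b \<and> (4 * ((a - 4) div 4) + 7) mod 4 = 3"
    if "a mod 4 \<noteq> 3" "b mod 4 \<noteq> 3" "(a - 4) div 4 \<noteq> (b - 4) div 4"
  proof (intro conjI)
    show "a < 4 * ((a - 4) div 4) + 7" "4 * ((a - 4) div 4) + 7 < b"
      using run_bounds(2)[OF that(1)] run_bounds(2)[OF that(2)] assms(4) that(3) by linarith+
  qed presburger
  ultimately show ?thesis using assms(1-3) False unfolding cluster_def keep_odd[OF False]
    by (cases "n div 2 \<in> \<sigma>"; simp only: if_True if_False simp_thms; blast)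
qed

lemma ex_keep:
  assumes "odd n"
  shows "\<exists>c<b. keep \<sigma> n c" "\<exists>c>b. keep \<sigma> n c"
proof -
  have "4 * (b div 4) - 3 < b" "4 * (b div 4) - 1 < b" "b < 4 * (b div 4) + 5" "b < 4 * (b div 4) + 7"
    "(4 * (b div 4) - 3) mod 4 = 1" "(4 * (b div 4) - 1) mod 4 = 3"
    "(4 * (b div 4) + 5) mod 4 = 1" "(4 * (b div 4) + 7) mod 4 = 3"
    by presburger+
  then show "\<exists>c<b. keep \<sigma> n c" "\<exists>c>b. keep \<sigma> n c"
    unfolding keep_odd[OF assms] by meson+
qed

lemma exit_level_eq:
  assumes "\<forall>m<n. keep \<sigma> m (code m x)" "\<not> keep \<sigma> n (code n x)"
  shows "exit_level \<sigma> x = n"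
  unfolding exit_level_def by (rule Least_equality) (use assms not_le in auto)

end

text \<open>With this \<open>\<sigma>\<close> every point leaves the kept gaps at a finite level, so
  \<open>exit_level\<close> is a genuine minimum and the cells partition \<open>J\<close>.\<close>

locale gap_tree_exhausted = gap_tree +
  fixes \<sigma>
  assumes no_leftover: "leftover \<sigma> = {}"
begin

lemma exit:
  assumes "x \<in> J"
  shows "alive \<sigma> (exit_level \<sigma> x) x" "\<not> keep \<sigma> (exit_level \<sigma> x) (code (exit_level \<sigma> x) x)"
proof -
  obtain n where n: "\<not> keep \<sigma> n (code n x)" using no_leftover assms by (auto simp: leftover_def)
  then show "\<not> keep \<sigma> (exit_level \<sigma> x) (code (exit_level \<sigma> x) x)"
    unfolding exit_level_def by (rule LeastI)
  show "alive \<sigma> (exit_level \<sigma> x) x"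
    unfolding alive_def exit_level_def using assms not_less_Least by blast
qed

lemma alive_le_exit: "alive \<sigma> n x \<Longrightarrow> n \<le> exit_level \<sigma> x"
  using exit(2)[of x] by (auto simp: alive_def not_less[symmetric])

lemma self_in_cell: "x \<in> J \<Longrightarrow> x \<in> cell \<sigma> x"
  using exit(2) self_in_gs by (auto simp: cell_def)

lemma cell_gs: "cell \<sigma> x \<subseteq> gs (exit_level \<sigma> x) x"
  by (auto simp: cell_def)

lemma cell_sub: "cell \<sigma> x \<subseteq> J"
  using cell_gs gs_sub by blast

lemma in_cell_exit:
  assumes "x \<in> J" "y \<in> cell \<sigma> x"
  shows "exit_level \<sigma> y = exit_level \<sigma> x"
proof (rule exit_level_eq)
  have "alive \<sigma> (exit_level \<sigma> x) y" using alive_gs[OF exit(1)[OF assms(1)]] assms(2) cell_gs by blast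
  then show "\<forall>m<exit_level \<sigma> x. keep \<sigma> m (code m y)" by (simp add: alive_def)
  show "\<not> keep \<sigma> (exit_level \<sigma> x) (code (exit_level \<sigma> x) y)" using assms(2) by (simp add: cell_def)
qed

lemma cell_eq:
  assumes "x \<in> J" "y \<in> cell \<sigma> x"
  shows "cell \<sigma> y = cell \<sigma> x"
proof -
  have "gs (exit_level \<sigma> x) y = gs (exit_level \<sigma> x) x" using gs_eq assms(2) cell_gs by blast
  then show ?thesis using assms(2) unfolding cell_def[of \<sigma> y] in_cell_exit[OF assms] by (simp add: cell_def)
qed

lemma label_eq:
  assumes "x \<in> J" "y \<in> cell \<sigma> x"
  shows "label \<sigma> y = label \<sigma> x"
  using assms(2) unfolding label_def in_cell_exit[OF assms] by (auto simp: cell_def cluster_def)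

lemma convex_cell:
  assumes "x \<in> J"
  shows "convex_in J (cell \<sigma> x)"
  unfolding convex_in_def
proof (intro conjI ballI impI)
  show "cell \<sigma> x \<subseteq> J" by (rule cell_sub)
  fix a c b assume *: "a \<in> cell \<sigma> x" "c \<in> cell \<sigma> x" "b \<in> J" "a < b \<and> b < c"
  define n where "n = exit_level \<sigma> x"
  have gap: "gap (gs n x)" using alive_gap exit(1)[OF assms] by (simp add: n_def)
  have ac: "a \<in> gs n x" "c \<in> gs n x" using * cell_gs by (auto simp: n_def)
  then have b: "b \<in> gs n x" using gap *(3,4) unfolding gap_def convex_in_def by blast
  have "code n a \<le> code n b" "code n b \<le> code n c" using code_mono[OF gap] ac b *(4) by auto
  moreover have "\<not> keep \<sigma> n (code n a)" "\<not> keep \<sigma> n (code n c)" "cluster \<sigma> n (code n a) = cluster \<sigma> n (code n c)"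
    "cluster \<sigma> n (code n c) = cluster \<sigma> n (code n x)"
    using *(1,2) by (auto simp: cell_def n_def)
  ultimately have "\<not> keep \<sigma> n (code n b) \<and> cluster \<sigma> n (code n b) = cluster \<sigma> n (code n x)"
    using cluster_convex by metis
  then show "b \<in> cell \<sigma> x" using b by (simp add: cell_def n_def)
qed

lemma cells_less:
  assumes "x \<in> J" "y \<in> J" "x < y" "y \<notin> cell \<sigma> x" "a \<in> cell \<sigma> x" "b \<in> cell \<sigma> y"
  shows "a < b"
proof (rule ccontr)
  assume "\<not> a < b"
  have aJ: "a \<in> J" and bJ: "b \<in> J" using assms cell_sub by blast+
  have disj: "z \<notin> cell \<sigma> y" if "z \<in> cell \<sigma> x" for z
    using cell_eq[OF assms(1) that] cell_eq[OF assms(2), of z] self_in_cell[OF assms(2)] assms(4) by blast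
  then have "a \<noteq> b" using assms(5,6) by blast
  then have "b < a" using \<open>\<not> a < b\<close> by simp
  have "a < y"
  proof (rule ccontr)
    assume "\<not> a < y"
    moreover have "a \<noteq> y" using assms(4,5) by blast
    ultimately have "y < a" by simp
    then have "y \<in> cell \<sigma> x"
      using convex_cell[OF assms(1)] self_in_cell[OF assms(1)] assms(2,3,5) unfolding convex_in_def by blast
    then show False using assms(4) by blast
  qed
  then have "a \<in> cell \<sigma> y"
    using convex_cell[OF assms(2)] self_in_cell[OF assms(2)] assms(6) aJ \<open>b < a\<close> unfolding convex_in_def by blast
  then show False using disj assms(5) by blast
qed

lemma cell_sub_gs: "alive \<sigma> n w \<Longrightarrow> z \<in> gs n w \<Longrightarrow> cell \<sigma> z \<subseteq> gs n w"
  using cell_gs gs_anti[OF alive_le_exit[OF alive_gs]] gs_eq by blast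

text \<open>On an even level the sequence \<open>hs\<close> takes the value \<open>h\<close>
  arbitrarily far to the left and to the right, so there is a piece with that label on each side of
  \<open>y\<close> in the same gap.\<close>

lemma label_dense_even:
  assumes "alive \<sigma> n y" "even n" "h \<in> H"
  shows "\<exists>z\<in>gs n y. z < y \<and> y \<notin> cell \<sigma> z \<and> label \<sigma> z = h"
    and "\<exists>z\<in>gs n y. y < z \<and> y \<notin> cell \<sigma> z \<and> label \<sigma> z = h"
proof -
  have yJ: "y \<in> J" and yG: "y \<in> gs n y" using assms(1) self_in_gs by (auto simp: alive_def)
  have gap: "gap (gs n y)" using assms(1) by (rule alive_gap)
  have piece: "\<exists>z\<in>gs n y. code n z = 2 * k \<and> label \<sigma> z = hs k \<and> (y \<in> cell \<sigma> z \<longrightarrow> code n y = 2 * k)" for k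
  proof -
    obtain z where z: "z \<in> gs n y" "Lam n (gs n y) z = 2 * k" using gap_fibre[OF gap] by blast
    then have c: "code n z = 2 * k" by (simp add: code_eq)
    have ex: "exit_level \<sigma> z = n"
      by (rule exit_level_eq) (use alive_gs[OF assms(1) z(1)] c in \<open>auto simp: alive_def keep_def\<close>)
    then have "label \<sigma> z = hs k" using assms(2) c by (simp add: label_def)
    moreover have "code n y = 2 * k" if "y \<in> cell \<sigma> z"
      using that assms(2) c unfolding cell_def ex by (simp add: cluster_def)
    ultimately show ?thesis using z c by blast
  qed
  obtain k where k: "k < code n y div 2" "hs k = h" using hs(2)[OF assms(3)] by blast
  obtain z where z: "z \<in> gs n y" "code n z = 2 * k" "label \<sigma> z = hs k" "y \<in> cell \<sigma> z \<longrightarrow> code n y = 2 * k"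
    using piece by blast
  have "2 * k < code n y" using k(1) by presburger
  then show "\<exists>z\<in>gs n y. z < y \<and> y \<notin> cell \<sigma> z \<and> label \<sigma> z = h"
    using z k(2) code_less[OF gap z(1) yG] by (intro bexI[OF _ z(1)]) auto
  obtain k where k: "k > code n y div 2" "hs k = h" using hs(3)[OF assms(3)] by blast
  obtain z where z: "z \<in> gs n y" "code n z = 2 * k" "label \<sigma> z = hs k" "y \<in> cell \<sigma> z \<longrightarrow> code n y = 2 * k"
    using piece by blast
  have "code n y < 2 * k" using k(1) by presburger
  then show "\<exists>z\<in>gs n y. y < z \<and> y \<notin> cell \<sigma> z \<and> label \<sigma> z = h"
    using z k(2) code_less[OF gap yG z(1)] by (intro bexI[OF _ z(1)]) auto
qed

text \<open>Pieces of an odd level all have label \<open>ho\<close>. The other labels are found one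
  level deeper, inside a kept gap, where the level is even.\<close>

lemma label_dense_sub:
  assumes "alive \<sigma> n y" "w \<in> gs n y" "keep \<sigma> n (code n w)" "odd n" "h \<in> H"
  shows "\<exists>z\<in>gs n y. code n z = code n w \<and> label \<sigma> z = h \<and> cell \<sigma> z \<subseteq> gs (Suc n) w"
proof -
  have w: "alive \<sigma> (Suc n) w"
    using alive_gs[OF assms(1,2)] assms(3) by (auto simp: alive_def less_Suc_eq)
  then obtain z where z: "z \<in> gs (Suc n) w" "label \<sigma> z = h"
    using label_dense_even(1)[OF w _ assms(5)] assms(4) by auto
  have eq: "gs n w = gs n y" using assms(2) by (rule gs_eq)
  have "z \<in> gs n w" using z(1) gs_anti[of n "Suc n"] by auto
  moreover have "code n z = code n w" using z(1) in_gs_iff[of w z "Suc n"] w by (auto simp: alive_def simp del: gs.simps)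
  ultimately show ?thesis using z eq cell_sub_gs[OF w z(1)] by blast
qed

lemma label_dense:
  assumes "alive \<sigma> n y" "h \<in> H"
  shows "\<exists>z\<in>gs n y. z < y \<and> y \<notin> cell \<sigma> z \<and> label \<sigma> z = h"
    and "\<exists>z\<in>gs n y. y < z \<and> y \<notin> cell \<sigma> z \<and> label \<sigma> z = h"
proof -
  have yJ: "y \<in> J" and yG: "y \<in> gs n y" using assms(1) self_in_gs by (auto simp: alive_def)
  have gap: "gap (gs n y)" using assms(1) by (rule alive_gap)
  have sub: "\<exists>z\<in>gs n y. code n z = c \<and> label \<sigma> z = h \<and> y \<notin> cell \<sigma> z"
    if c: "odd n" "keep \<sigma> n c" "c \<noteq> code n y" for c
  proof -
    obtain w where w: "w \<in> gs n y" "Lam n (gs n y) w = c" using gap_fibre[OF gap] by blast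
    then have cw: "code n w = c" by (simp add: code_eq)
    then obtain z where z: "z \<in> gs n y" "code n z = c" "label \<sigma> z = h" "cell \<sigma> z \<subseteq> gs (Suc n) w"
      using label_dense_sub[OF assms(1) w(1) _ c(1) assms(2)] c(2) by blast
    have "w \<in> J" using w(1) gs_sub by blast
    then have "y \<notin> gs (Suc n) w" using in_gs_iff[of w y "Suc n"] c(3) cw by (metis lessI)
    then show ?thesis using z by blast
  qed
  show "\<exists>z\<in>gs n y. z < y \<and> y \<notin> cell \<sigma> z \<and> label \<sigma> z = h"
  proof (cases "even n")
    case True
    then show ?thesis using label_dense_even(1) assms by blast
  next
    case False
    obtain c where c: "c < code n y" "keep \<sigma> n c" using ex_keep(1)[OF False] by blast
    then obtain z where "z \<in> gs n y" "code n z = c" "label \<sigma> z = h" "y \<notin> cell \<sigma> z" using sub False by blast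
    then show ?thesis using code_less[OF gap _ yG] c(1) by blast
  qed
  show "\<exists>z\<in>gs n y. y < z \<and> y \<notin> cell \<sigma> z \<and> label \<sigma> z = h"
  proof (cases "even n")
    case True
    then show ?thesis using label_dense_even(2) assms by blast
  next
    case False
    obtain c where c: "code n y < c" "keep \<sigma> n c" using ex_keep(2)[OF False] by blast
    then obtain z where "z \<in> gs n y" "code n z = c" "label \<sigma> z = h" "y \<notin> cell \<sigma> z" using sub False by blast
    then show ?thesis using code_less[OF gap yG] c(1) by blast
  qed
qed

text \<open>Consider the first level \<open>n\<close> where the addresses differ. If one of the
  points stays in a kept gap there, that gap contains cells of every label on the side of the other
  point. If both points leave at level \<open>n\<close>, they are in different runs, and a kept gap
  lies between the runs.\<close>

lemma label_between:
  assumes "x \<in> J" "y \<in> J" "x < y" "y \<notin> cell \<sigma> x" "h \<in> H"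
  shows "\<exists>z\<in>J. x < z \<and> z < y \<and> x \<notin> cell \<sigma> z \<and> y \<notin> cell \<sigma> z \<and> label \<sigma> z = h"
proof -
  have "\<exists>n. code n x \<noteq> code n y"
  proof (rule ccontr)
    assume "\<not> ?thesis"
    then have eq: "code n y = code n x" for n by simp
    then have "y \<in> cell \<sigma> x"
      using assms(1,2) exit(2)[OF assms(1)] by (simp add: cell_def in_gs_iff)
    then show False using assms(4) by blast
  qed
  then obtain n where n: "code n x \<noteq> code n y" "\<And>m. m < n \<Longrightarrow> code m x = code m y"
    using exists_least_iff[of "\<lambda>n. code n x \<noteq> code n y"] by blast
  have xG: "x \<in> gs n y" using n(2) assms by (simp add: in_gs_iff)
  have yG: "y \<in> gs n y" using self_in_gs assms by blast
  \<comment> \<open>If \<open>y\<close> had left the kept gaps before level \<open>n\<close>, then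
    \<open>x\<close> would have left with it, at the same code and so in the same cell.\<close>
  have al: "alive \<sigma> n y"
  proof (rule ccontr)
    assume "\<not> alive \<sigma> n y"
    then obtain m where m: "m < n" "\<not> keep \<sigma> m (code m y)" "\<forall>l<m. keep \<sigma> l (code l y)"
      using assms(2) exists_least_iff[of "\<lambda>m. m < n \<and> \<not> keep \<sigma> m (code m y)"] by (auto simp: alive_def)
    then have "exit_level \<sigma> x = m" using n(2) by (intro exit_level_eq) auto
    then have "y \<in> cell \<sigma> x" using m n(2) assms(1,2) by (simp add: cell_def in_gs_iff)
    then show False using assms(4) by blast
  qed
  have gap: "gap (gs n y)" using al by (rule alive_gap)
  have alx: "alive \<sigma> n x" using al xG by (rule alive_gs)
  have lt: "code n x < code n y" using code_mono[OF gap xG yG] assms(3) n(1) by force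
  have Suc: "alive \<sigma> (Suc n) w" if "w \<in> gs n y" "keep \<sigma> n (code n w)" for w
    using alive_gs[OF al that(1)] that(2) by (auto simp: alive_def less_Suc_eq)
  have in_Suc: "z \<in> gs n y \<and> code n z = code n w" if "w \<in> gs n y" "z \<in> gs (Suc n) w" for w z
  proof -
    have "w \<in> J" using that(1) gs_sub by blast
    then have "code n z = code n w" using in_gs_iff[of w z "Suc n"] that(2) by blast
    moreover have "z \<in> gs n w" using that(2) by simp
    ultimately show ?thesis using gs_eq[OF that(1)] by simp
  qed
  have notin: "code n v = code n w" if "w \<in> gs n y" "keep \<sigma> n (code n w)" "z \<in> gs (Suc n) w" "v \<in> cell \<sigma> z" for v w z
    using in_Suc[OF that(1)] cell_sub_gs[OF Suc[OF that(1,2)] that(3)] that(4) by blast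
  consider "keep \<sigma> n (code n y)" | "keep \<sigma> n (code n x)" | "\<not> keep \<sigma> n (code n y)" "\<not> keep \<sigma> n (code n x)" by blast
  then show ?thesis
  proof cases
    case 1
    obtain z where z: "z \<in> gs (Suc n) y" "z < y" "y \<notin> cell \<sigma> z" "label \<sigma> z = h"
      using label_dense(1)[OF Suc[OF yG 1] assms(5)] by blast
    have "x < z" using code_less[OF gap xG] in_Suc[OF yG z(1)] lt by simp
    moreover have "x \<notin> cell \<sigma> z" using notin[OF yG 1 z(1)] n(1) by blast
    ultimately show ?thesis using z gs_sub by blast
  next
    case 2
    obtain z where z: "z \<in> gs (Suc n) x" "x < z" "x \<notin> cell \<sigma> z" "label \<sigma> z = h"
      using label_dense(2)[OF Suc[OF xG 2] assms(5)] by blast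
    have "z < y" using code_less[OF gap _ yG] in_Suc[OF xG z(1)] lt by simp
    moreover have "y \<notin> cell \<sigma> z" using notin[OF xG 2 z(1)] n(1) by force
    ultimately show ?thesis using z gs_sub by blast
  next
    case 3
    have "exit_level \<sigma> x = n" by (rule exit_level_eq) (use alx 3 in \<open>auto simp: alive_def\<close>)
    then have "cluster \<sigma> n (code n x) \<noteq> cluster \<sigma> n (code n y)"
      using assms(4) yG gs_eq[OF xG] 3 by (auto simp: cell_def)
    then obtain c where c: "code n x < c" "c < code n y" "keep \<sigma> n c"
      using cluster_between[OF 3(2,1) _ lt] by blast
    obtain w where w: "w \<in> gs n y" "Lam n (gs n y) w = c" using gap_fibre[OF gap] by blast
    then have cw: "code n w = c" by (simp add: code_eq)
    have kw: "keep \<sigma> n (code n w)" using c(3) cw by simp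
    obtain z where z: "z \<in> gs (Suc n) w" "label \<sigma> z = h"
      using label_dense(1)[OF Suc[OF w(1) kw] assms(5)] by blast
    have "x < z" "z < y" using code_less[OF gap xG] code_less[OF gap _ yG] in_Suc[OF w(1) z(1)] c cw by simp_all
    moreover have "x \<notin> cell \<sigma> z" "y \<notin> cell \<sigma> z" using notin[OF w(1) kw z(1)] c cw by force+
    ultimately show ?thesis using z gs_sub by blast
  qed
qed

lemma kind_of_cell:
  assumes "x \<in> J"
  shows "kind_of f (cell \<sigma> x) = \<kappa> (label \<sigma> x)"
proof -
  define n where "n = exit_level \<sigma> x"
  define G where "G = gs n x"
  have gap: "gap G" using alive_gap exit(1)[OF assms] by (simp add: n_def G_def)
  have code: "code n y = Lam n G y" if "y \<in> G" for y using code_eq that by (simp add: G_def)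
  have xG: "x \<in> G" using self_in_gs assms by (simp add: G_def)
  have nk: "\<not> keep \<sigma> n (code n x)" using exit(2)[OF assms] by (simp add: n_def)
  have cell: "cell \<sigma> x = {y \<in> G. \<not> keep \<sigma> n (Lam n G y) \<and> cluster \<sigma> n (Lam n G y) = cluster \<sigma> n (code n x)}"
    unfolding cell_def G_def[symmetric] n_def[symmetric] using code by auto
  show ?thesis
  proof (cases "even n")
    case True
    then obtain k where k: "code n x = 2 * k" using nk by (auto simp: keep_def)
    have "cell \<sigma> x = G \<inter> Lam n G -` {2 * k}"
      unfolding cell using True by (auto simp: k cluster_def keep_def)
    then show ?thesis using gap_sub(3)[OF gap, of n k] True k by (simp add: label_def n_def)
  next
    case False
    define q where "q = cluster \<sigma> n (code n x)"
    \<comment> \<open>The run with number \<open>q\<close> begins with the piece of code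
      \<open>2 * B\<close>, which is \<open>4 * q + 2\<close> or \<open>4 * q + 4\<close>, and ends
      with the piece of code \<open>2 * (B + 1)\<close>.\<close>
    define B where "B = 2 * q + (if n div 2 \<in> \<sigma> then 1 else 2)"
    have iff: "\<not> keep \<sigma> n a \<and> cluster \<sigma> n a = q \<longleftrightarrow> 2 * B \<le> a \<and> a \<le> 2 * (B + 1)" for a
    proof (cases "n div 2 \<in> \<sigma>")
      case True
      have "a mod 4 \<noteq> 1 \<and> (a - 2) div 4 = q \<longleftrightarrow> 4 * q + 2 \<le> a \<and> a \<le> 4 * q + 4"
        using run_bounds(1)[of a] run_bounds(3)[of q a] by blast
      then show ?thesis unfolding keep_odd[OF False] cluster_def B_def using False True by (simp add: add.commute)
    next
      case nin: False
      have "a mod 4 \<noteq> 3 \<and> (a - 4) div 4 = q \<longleftrightarrow> 4 * q + 4 \<le> a \<and> a \<le> 4 * q + 6"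
        using run_bounds(2)[of a] run_bounds(4)[of q a] by blast
      then show ?thesis unfolding keep_odd[OF False] cluster_def B_def using False nin by (simp add: add.commute)
    qed
    have eq: "cell \<sigma> x = {y \<in> G. 2 * B \<le> Lam n G y \<and> Lam n G y \<le> 2 * (B + 1)}"
      unfolding cell q_def[symmetric] iff ..
    define P where "P k = G \<inter> Lam n G -` {2 * k}" for k
    have P: "P k \<noteq> {}" "kind_of f (P k) = \<kappa> ho" for k
      using gap_sub(2,3)[OF gap, of n k] False by (auto simp: P_def)
    have Psub: "P B \<subseteq> cell \<sigma> x" "P (B + 1) \<subseteq> cell \<sigma> x" by (auto simp: eq P_def)
    have mono: "Lam n G y \<le> Lam n G z" if "y \<in> G" "z \<in> G" "y \<le> z" for y z
      using mono_onD[OF gap_sub(1)[OF gap] that] .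
    have "initial_in (cell \<sigma> x) (P B)"
      using mono unfolding initial_in_def eq P_def by fastforce
    then have mi: "min_colour f (cell \<sigma> x) = min_colour f (P B)" using min_colour_initial P(1) by metis
    have "initial_in (cell \<sigma> x) (cell \<sigma> x - P (B + 1))"
      using mono unfolding initial_in_def eq P_def by fastforce
    moreover have "cell \<sigma> x - (cell \<sigma> x - P (B + 1)) = P (B + 1)" using Psub by blast
    ultimately have ma: "max_colour f (cell \<sigma> x) = max_colour f (P (B + 1))"
      using max_colour_final P(1) by metis
    obtain u v where uv: "u \<in> P B" "v \<in> P (B + 1)" using P(1) by blast
    then have "u \<noteq> v" by (auto simp: P_def)
    have ns: "\<not> (\<exists>z. cell \<sigma> x = {z})"
    proof
      assume "\<exists>z. cell \<sigma> x = {z}"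
      then obtain z where "cell \<sigma> x = {z}" ..
      then have "u = z" "v = z" using uv Psub by auto
      then show False using \<open>u \<noteq> v\<close> by simp
    qed
    have "label \<sigma> x = ho" using False by (simp add: label_def n_def)
    moreover have "fst (\<kappa> ho) = min_colour f (P B)"
      unfolding P(2)[of B, symmetric] kind_of_def by (rule fst_conv)
    moreover have "fst (snd (\<kappa> ho)) = max_colour f (P (B + 1))"
      unfolding P(2)[of "B + 1", symmetric] kind_of_def by simp
    ultimately show ?thesis using mi ma ns ho(2) unfolding kind_of_def prod_eq_iff by simp
  qed
qed

lemma label_in: "label \<sigma> x \<in> H"
  using hs(1) ho(1) by (simp add: label_def)

end

section \<open>Distinct representatives and the decomposition theorem\<close>

lemma ex_inj_choice_nat:
  fixes S :: "nat \<Rightarrow> 'a set"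
  assumes "\<And>n. infinite (S n)"
  shows "\<exists>g. inj g \<and> (\<forall>n. g n \<in> S n)"
proof -
  have "\<exists>g. \<forall>n. g n \<in> S n \<and> g n \<notin> g ` {..<n}"
  proof (rule dependent_wellorder_choice)
    show "(r \<in> S n \<and> r \<notin> f ` {..<n}) = (r \<in> S n \<and> r \<notin> g ` {..<n})"
      if "\<And>m. m < n \<Longrightarrow> f m = g m" for r f g n
      using that by auto
    show "\<exists>r. r \<in> S n \<and> r \<notin> f ` {..<n}" for n and f :: "nat \<Rightarrow> 'a"
      using assms[of n] by (metis finite_imageI finite_lessThan finite_subset subsetI)
  qed
  then obtain g where g: "\<And>n. g n \<in> S n" "\<And>n. g n \<notin> g ` {..<n}" by blast
  have "inj g"
  proof (rule linorder_injI)
    show "g m \<noteq> g n" if "m < n" for m n using g(2)[of n] that by (metis imageI lessThan_iff)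
  qed
  then show ?thesis using g(1) by blast
qed

lemma ex_inj_choice:
  assumes "countable I" "\<And>i. i \<in> I \<Longrightarrow> infinite (S i)"
  shows "\<exists>g. inj_on g I \<and> (\<forall>i\<in>I. g i \<in> S i)"
proof (cases "I = {}")
  case False
  have "infinite (S (from_nat_into I n))" for n using assms(2) False by (simp add: from_nat_into)
  then obtain g where g: "inj g" "\<And>n. g n \<in> S (from_nat_into I n)"
    using ex_inj_choice_nat[of "\<lambda>n. S (from_nat_into I n)"] by blast
  have "inj_on (\<lambda>i. g (to_nat_on I i)) I"
    using inj_on_to_nat_on[OF assms(1)] g(1) by (auto simp: inj_on_def)
  moreover have "g (to_nat_on I i) \<in> S i" if "i \<in> I" for i
    using g(2)[of "to_nat_on I i"] that assms(1) by simp
  ultimately show ?thesis by blast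
qed simp

lemma infinite_colour_class:
  assumes "colour_dense T f J" "c \<in> J" "d \<in> J" "c < d" "t \<in> T"
  shows "infinite {x \<in> J. c < x \<and> x < d \<and> f x = t}"
proof
  let ?F = "{x \<in> J. c < x \<and> x < d \<and> f x = t}"
  assume fin: "finite ?F"
  have "?F \<noteq> {}" using assms unfolding colour_dense_def by blast
  then have "Min ?F \<in> ?F" using fin Min_in by blast
  then obtain x where "x \<in> J" "c < x" "x < Min ?F" "f x = t"
    using assms unfolding colour_dense_def by blast
  moreover then have "x \<in> ?F" using \<open>Min ?F \<in> ?F\<close> by auto
  ultimately show False using fin Min_le[of ?F x] by (meson leD)
qed

text \<open>Several labels may demand single points of the same colour, so each colour class has to
  be shared out among labels that are all dense. For each label and each interval with rational ends
  that contains infinitely many suitable points, one point is reserved. These are countably many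
  demands on infinite sets, so the reserved points can be distinct. All other points get any label
  that fits their colour.\<close>

lemma ex_refined_colouring:
  fixes J :: "real set"
  assumes cd: "colour_dense T f J" and "finite H"
    and sing: "\<And>h. h \<in> H \<Longrightarrow> \<exists>t\<in>T. \<kappa> h = ({t}, {t}, True)"
    and cover: "\<And>t. t \<in> T \<Longrightarrow> \<exists>h\<in>H. \<kappa> h = ({t}, {t}, True)"
  shows "\<exists>h. colour_dense H h J \<and> (\<forall>x\<in>J. \<kappa> (h x) = ({f x}, {f x}, True))"
proof -
  define S where "S = (\<lambda>(q, r, h). {x \<in> J. q < x \<and> x < r \<and> \<kappa> h = ({f x}, {f x}, True)})"
  define I where "I = {i \<in> \<rat> \<times> \<rat> \<times> H. infinite (S i)}"
  have "countable (\<rat> \<times> \<rat> \<times> H)" using assms(2) by (simp add: countable_rat countable_finite)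
  then have "countable I" by (rule countable_subset[rotated]) (auto simp: I_def)
  moreover have "infinite (S i)" if "i \<in> I" for i using that by (simp add: I_def)
  ultimately obtain g where g: "inj_on g I" "\<And>i. i \<in> I \<Longrightarrow> g i \<in> S i"
    using ex_inj_choice[of I S] by blast
  define h where "h x = (if x \<in> g ` I then snd (snd (inv_into I g x)) else SOME h. h \<in> H \<and> \<kappa> h = ({f x}, {f x}, True))" for x
  have h_g: "h (g i) = snd (snd i)" if "i \<in> I" for i
    using that g(1) by (simp add: h_def)
  have fT: "f x \<in> T" if "x \<in> J" for x using cd that by (auto simp: colour_dense_def)
  have h: "h x \<in> H \<and> \<kappa> (h x) = ({f x}, {f x}, True)" if x: "x \<in> J" for x
  proof (cases "x \<in> g ` I")
    case True
    then obtain i where i: "i \<in> I" "x = g i" by blast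
    then show ?thesis using g(2)[OF i(1)] h_g[OF i(1)] by (auto simp: S_def I_def split: prod.splits)
  next
    case False
    then show ?thesis using someI_ex[of "\<lambda>h. h \<in> H \<and> \<kappa> h = ({f x}, {f x}, True)"] cover[OF fT[OF x]]
      by (auto simp: h_def)
  qed
  have "\<exists>c\<in>J. a < c \<and> c < b \<and> h c = k" if ab: "a \<in> J" "b \<in> J" "a < b" and k: "k \<in> H" for a b k
  proof -
    have dense: "\<exists>z\<in>J. a < z \<and> z < b" if "a \<in> J" "b \<in> J" "a < b" for a b
      using colour_dense_order_dense[OF cd] that unfolding order_dense_def by (metis (no_types))
    obtain t where t: "t \<in> T" "\<kappa> k = ({t}, {t}, True)" using sing[OF k] by blast
    obtain c where c: "c \<in> J" "a < c" "c < b" using dense[OF ab] by blast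
    obtain d where d: "d \<in> J" "c < d" "d < b" using dense[OF c(1) ab(2) c(3)] by blast
    obtain q where q: "q \<in> \<rat>" "a < q" "q < c" using Rats_dense_in_real[OF c(2)] by blast
    obtain r where r: "r \<in> \<rat>" "d < r" "r < b" using Rats_dense_in_real[OF d(3)] by blast
    have "{x \<in> J. c < x \<and> x < d \<and> f x = t} \<subseteq> S (q, r, k)" using q r t by (auto simp: S_def)
    then have "infinite (S (q, r, k))"
      using infinite_colour_class[OF cd c(1) d(1,2) t(1)] finite_subset by blast
    then have i: "(q, r, k) \<in> I" using q r k by (simp add: I_def)
    have "g (q, r, k) \<in> S (q, r, k)" using g(2)[OF i] .
    then have "g (q, r, k) \<in> J" "a < g (q, r, k)" "g (q, r, k) < b" using q r by (auto simp: S_def)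
    then show ?thesis using h_g[OF i] by auto
  qed
  then have "colour_dense H h J" using h by (auto simp: colour_dense_def)
  then show ?thesis using h by blast
qed

lemma ex_cyclic_enumeration:
  assumes "finite H" "H \<noteq> {}"
  shows "\<exists>hs::int \<Rightarrow> 'a. (\<forall>k. hs k \<in> H) \<and> (\<forall>h\<in>H. \<forall>k. (\<exists>j<k. hs j = h) \<and> (\<exists>j>k. hs j = h))"
proof -
  obtain xs where xs: "set xs = H" using assms(1) finite_list by blast
  define n where "n = int (length xs)"
  have n: "n > 0" using xs assms(2) by (auto simp: n_def)
  define hs where "hs k = xs ! nat (k mod n)" for k
  have "hs k \<in> H" for k
  proof -
    have "nat (k mod n) < length xs" using n by (simp add: n_def nat_less_iff)
    then show ?thesis using xs by (auto simp: hs_def)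
  qed
  moreover have "(\<exists>j<k. hs j = h) \<and> (\<exists>j>k. hs j = h)" if hH: "h \<in> H" for h k
  proof -
    obtain i where i: "i < length xs" "xs ! i = h" using xs hH by (metis in_set_conv_nth)
    have hs: "hs (m * n + int i) = h" for m using i by (simp add: hs_def n_def)
    have k: "k = k div n * n + k mod n" "0 \<le> k mod n" "k mod n < n" using n by simp_all
    \<comment> \<open>A full period to either side of \<open>k\<close> gives strict inequalities
      whatever the position \<open>i\<close> is.\<close>
    have "(k div n - 1) * n + int i < k" "k < (k div n + 1) * n + int i"
      using k i(1) unfolding left_diff_distrib distrib_right n_def by linarith+
    then show ?thesis using hs by blast
  qed
  ultimately show ?thesis by blast
qed

text \<open>The map \<open>\<rho>\<close> sends each piece to one of its own points, so the order of
  the pieces is again a suborder of \<open>J\<close> and inherits its smallness. With a kind of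
  several points available, the gap tree absorbs all of \<open>J\<close>. With single points only,
  every point is a piece by itself, which is possible only if each colour of \<open>T\<close> occurs
  among the kinds.\<close>

lemma ex_decomposition:
  assumes cd: "colour_dense T f J" and small: "small_on_thin J" and J: "J \<noteq> {}" "no_endpoints J"
    and H: "finite H" "H \<noteq> {}" and valid: "\<And>h. h \<in> H \<Longrightarrow> valid_kind T (\<kappa> h)"
    and cover: "(\<exists>h\<in>H. \<not> snd (snd (\<kappa> h))) \<or> (\<forall>t\<in>T. \<exists>h\<in>H. \<kappa> h = ({t}, {t}, True))"
  shows "\<exists>\<rho> h. mono_on J \<rho> \<and> \<rho> ` J \<subseteq> J \<and> no_endpoints (\<rho> ` J) \<and> colour_dense H h (\<rho> ` J) \<and>
    (\<forall>c\<in>\<rho> ` J. kind_of f (J \<inter> \<rho> -` {c}) = \<kappa> (h c))"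
proof (cases "\<exists>h\<in>H. \<not> snd (snd (\<kappa> h))")
  case False
  have sing: "\<exists>t\<in>T. \<kappa> h = ({t}, {t}, True)" if h: "h \<in> H" for h
  proof -
    obtain l r b where lrb: "\<kappa> h = (l, r, b)" by (cases "\<kappa> h") auto
    then have "b" using False h by force
    then show ?thesis using valid[OF h] lrb by (auto simp: valid_kind_def)
  qed
  then obtain h where h: "colour_dense H h J" "\<And>x. x \<in> J \<Longrightarrow> \<kappa> (h x) = ({f x}, {f x}, True)"
    using ex_refined_colouring[OF cd H(1), of \<kappa>] cover False by metis
  have "J \<inter> (\<lambda>x. x) -` {c} = {c}" if "c \<in> J" for c using that by auto
  then have "kind_of f (J \<inter> (\<lambda>x. x) -` {c}) = \<kappa> (h c)" if "c \<in> J" for c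
    using h(2) that by (simp add: kind_of_singleton)
  then show ?thesis using h(1) J(2) by (intro exI[of _ "\<lambda>x. x"] exI[of _ h]) (simp add: mono_on_def)
next
  case True
  then obtain ho where ho: "ho \<in> H" "\<not> snd (snd (\<kappa> ho))" by blast
  obtain hs :: "int \<Rightarrow> nat" where hs: "\<And>k. hs k \<in> H" "\<And>h k. h \<in> H \<Longrightarrow> \<exists>j<k. hs j = h" "\<And>h k. h \<in> H \<Longrightarrow> \<exists>j>k. hs j = h"
    using ex_cyclic_enumeration[OF H] by metis
  define good where "good n G \<Lambda> \<longleftrightarrow> mono_on G \<Lambda> \<and>
      (\<forall>k. G \<inter> \<Lambda> -` {2 * k} \<noteq> {} \<and> kind_of f (G \<inter> \<Lambda> -` {2 * k}) = \<kappa> (if even n then hs k else ho)) \<and>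
      (\<forall>k. G \<inter> \<Lambda> -` {2 * k + 1} \<noteq> {} \<and> no_endpoints (G \<inter> \<Lambda> -` {2 * k + 1}))"
    for n :: nat and G :: "real set" and \<Lambda> :: "real \<Rightarrow> int"
  define Lam where "Lam n G = (SOME \<Lambda>. good n G \<Lambda>)" for n G
  have Lam: "good n G (Lam n G)" if G: "convex_in J G" "G \<noteq> {}" "no_endpoints G" for n G
  proof -
    have "small_on_thin G" using small_on_thin_subset[OF small] G(1) by (simp add: convex_in_def)
    moreover have "colour_dense T f G" using cd G(1) by (rule colour_dense_convex_in)
    ultimately have "\<exists>\<Lambda>. good n G \<Lambda>"
      unfolding good_def by (rule ex_int_decomposition[OF _ _ G(2,3)]) (use valid hs(1) ho(1) in simp)
    then show ?thesis unfolding Lam_def by (rule someI_ex)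
  qed
  interpret gap_tree J T f H \<kappa> hs ho Lam
  proof
    show "small_on_thin J" "J \<noteq> {}" "no_endpoints J" by (rule small J)+
    show "ho \<in> H" "\<not> snd (snd (\<kappa> ho))" by (rule ho)+
    show "hs k \<in> H" for k by (rule hs)
    show "\<exists>j<k. hs j = h" "\<exists>j>k. hs j = h" if "h \<in> H" for h k using that by (rule hs)+
    show "mono_on G (Lam n G) \<and>
      (\<forall>k. G \<inter> Lam n G -` {2 * k} \<noteq> {} \<and>
         kind_of f (G \<inter> Lam n G -` {2 * k}) = \<kappa> (if even n then hs k else ho)) \<and>
      (\<forall>k. G \<inter> Lam n G -` {2 * k + 1} \<noteq> {} \<and> no_endpoints (G \<inter> Lam n G -` {2 * k + 1}))"
      if "convex_in J G" "G \<noteq> {}" "no_endpoints G" for n G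
      using Lam[OF that, of n] unfolding good_def .
  qed
  obtain \<sigma> where "leftover \<sigma> = {}" using ex_no_leftover by blast
  then interpret gap_tree_exhausted J T f H \<kappa> hs ho Lam \<sigma> by unfold_locales
  \<comment> \<open>The choice depends on the set \<open>cell \<sigma> x\<close> alone, so it is
    constant on cells.\<close>
  define \<rho> where "\<rho> x = (SOME y. y \<in> cell \<sigma> x)" for x
  have \<rho>: "\<rho> x \<in> cell \<sigma> x" if "x \<in> J" for x
    unfolding \<rho>_def using self_in_cell[OF that] by (rule someI)
  have \<rho>J: "\<rho> x \<in> J" if "x \<in> J" for x using \<rho>[OF that] cell_sub by blast
  have \<rho>_eq: "\<rho> y = \<rho> x" if "x \<in> J" "y \<in> cell \<sigma> x" for x y
    using cell_eq[OF that] by (simp add: \<rho>_def)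
  have less: "\<rho> x < \<rho> y" if "x \<in> J" "y \<in> J" "x < y" "y \<notin> cell \<sigma> x" for x y
    using cells_less[OF that \<rho>[OF that(1)] \<rho>[OF that(2)]] .
  have sym: "x \<in> cell \<sigma> y" if "y \<in> cell \<sigma> x" "x \<in> J" for x y
    using cell_eq[OF that(2,1)] self_in_cell[OF that(2)] by simp
  have fibre: "J \<inter> \<rho> -` {\<rho> x} = cell \<sigma> x" if x: "x \<in> J" for x
  proof (intro equalityI subsetI)
    fix y assume y: "y \<in> J \<inter> \<rho> -` {\<rho> x}"
    show "y \<in> cell \<sigma> x"
    proof (rule ccontr)
      assume n: "y \<notin> cell \<sigma> x"
      then have "x \<notin> cell \<sigma> y" using sym y by blast
      then have "\<rho> x < \<rho> y \<or> \<rho> y < \<rho> x"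
        using less[of x y] less[of y x] n x y self_in_cell[OF x] by (cases x y rule: linorder_cases) auto
      then show False using y by auto
    qed
  next
    fix y assume "y \<in> cell \<sigma> x"
    then show "y \<in> J \<inter> \<rho> -` {\<rho> x}" using \<rho>_eq[OF x] cell_sub by blast
  qed
  have \<rho>_mono: "\<rho> x \<le> \<rho> y" if "x \<in> J" "y \<in> J" "x \<le> y" for x y
  proof (cases "y \<in> cell \<sigma> x")
    case True
    then show ?thesis using \<rho>_eq[OF that(1) True] by simp
  next
    case False
    then have "x \<noteq> y" using self_in_cell[OF that(1)] by blast
    then have "x < y" using that(3) by simp
    then show ?thesis using less[OF that(1,2) _ False] by (simp add: less_imp_le)
  qed
  have "mono_on J \<rho>" using \<rho>_mono by (intro mono_onI)
  moreover have "\<rho> ` J \<subseteq> J" using \<rho>J by blast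
  moreover have "no_endpoints (\<rho> ` J)"
    unfolding no_endpoints_def
  proof
    fix c assume "c \<in> \<rho> ` J"
    then obtain x where x: "x \<in> J" "c = \<rho> x" by blast
    have "alive \<sigma> 0 x" using x by (simp add: alive_def)
    from label_dense[OF this ho(1)]
    obtain y z where "y \<in> J" "y < x" "x \<notin> cell \<sigma> y" "z \<in> J" "x < z" "x \<notin> cell \<sigma> z" by auto
    then have "\<rho> y < \<rho> x" "\<rho> x < \<rho> z" using less[of y x] less[of x z] x sym by blast+
    then show "(\<exists>y\<in>\<rho> ` J. y < c) \<and> (\<exists>y\<in>\<rho> ` J. c < y)" using x \<open>y \<in> J\<close> \<open>z \<in> J\<close> by blast
  qed
  moreover have "colour_dense H (label \<sigma>) (\<rho> ` J)"
    unfolding colour_dense_def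
  proof (intro conjI ballI impI)
    show "label \<sigma> ` \<rho> ` J \<subseteq> H" using label_in by blast
    fix a b h assume ab: "a \<in> \<rho> ` J" "b \<in> \<rho> ` J" "a < b" "h \<in> H"
    then obtain x y where xy: "x \<in> J" "a = \<rho> x" "y \<in> J" "b = \<rho> y" by blast
    have "y \<notin> cell \<sigma> x" using \<rho>_eq xy ab(3) by force
    moreover have "x < y"
      using \<rho>_mono[OF xy(3,1)] xy(2,4) ab(3) by linarith
    ultimately obtain z where z: "z \<in> J" "x < z" "z < y" "x \<notin> cell \<sigma> z" "y \<notin> cell \<sigma> z" "label \<sigma> z = h"
      using label_between[OF xy(1,3) _ _ ab(4)] by blast
    have "\<rho> x < \<rho> z" "\<rho> z < \<rho> y" using less[of x z] less[of z y] z xy sym by blast+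
    moreover have "label \<sigma> (\<rho> z) = h" using label_eq[OF z(1) \<rho>[OF z(1)]] z(6) by simp
    ultimately show "\<exists>c\<in>\<rho> ` J. a < c \<and> c < b \<and> label \<sigma> c = h" using z(1) xy by blast
  qed
  moreover have "kind_of f (J \<inter> \<rho> -` {c}) = \<kappa> (label \<sigma> c)" if c: "c \<in> \<rho> ` J" for c
  proof -
    obtain x where x: "x \<in> J" "c = \<rho> x" using c by blast
    show ?thesis
      using fibre[OF x(1)] kind_of_cell[OF x(1)] label_eq[OF x(1) \<rho>[OF x(1)]] x(2) by simp
  qed
  ultimately show ?thesis by blast
qed

section \<open>Shuffles\<close>

text \<open>The summands are the fibres of \<open>\<pi>\<close> and \<open>\<pi>'\<close>, and they
  may be empty. The claim speaks of all sums at once because the induction step applies it to other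
  index orders, those of classes and of pieces, and to longer lists of sets.\<close>

definition shuffle_claim :: "nat \<Rightarrow> bool" where
  "shuffle_claim n \<longleftrightarrow> (\<forall>(X::real set) As \<pi> I f (Y::real set) Bs \<pi>' I' f' T.
    finite T \<longrightarrow> length As = length Bs \<longrightarrow>
    colour_dense T f I \<longrightarrow> I \<noteq> {} \<longrightarrow> no_endpoints I \<longrightarrow> small_on_thin I \<longrightarrow> mono_on X \<pi> \<longrightarrow> \<pi> ` X \<subseteq> I \<longrightarrow>
    colour_dense T f' I' \<longrightarrow> I' \<noteq> {} \<longrightarrow> no_endpoints I' \<longrightarrow> small_on_thin I' \<longrightarrow> mono_on Y \<pi>' \<longrightarrow> \<pi>' ` Y \<subseteq> I' \<longrightarrow>
    (\<forall>i\<in>I. \<forall>j\<in>I'. f i = f' j \<longrightarrow> eqv n (X \<inter> \<pi> -` {i}) As (Y \<inter> \<pi>' -` {j}) Bs) \<longrightarrow>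
    eqv n X As Y Bs)"

lemma colour_dense_all_colours:
  assumes "colour_dense T f I" "I \<noteq> {}" "no_endpoints I" "t \<in> T"
  shows "\<exists>i\<in>I. f i = t"
proof -
  obtain a where "a \<in> I" using assms(2) by blast
  moreover obtain b where "b \<in> I" "a < b" using assms(3) \<open>a \<in> I\<close> unfolding no_endpoints_def by blast
  ultimately show ?thesis using assms(1,4) unfolding colour_dense_def by blast
qed

lemma colour_dense_above:
  assumes "colour_dense T f I" "no_endpoints I" "a \<in> I" "t \<in> T"
  shows "\<exists>i\<in>I. a < i \<and> f i = t"
proof -
  obtain b where "b \<in> I" "a < b" using assms(2,3) unfolding no_endpoints_def by blast
  then show ?thesis using assms(1,3,4) unfolding colour_dense_def by blast
qed

text \<open>What happens inside one fibre is copied to a fibre of the same colour. For two points in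
  different fibres, a second index of the required colour exists above the first one, since every
  colour occurs above every index.\<close>

lemma shuffle_0_transfer:
  fixes X Y :: "real set" and I I' :: "real set"
  assumes eq: "\<forall>i\<in>I. \<forall>j\<in>I'. f i = f' j \<longrightarrow> eqv 0 (X \<inter> \<pi> -` {i}) As (Y \<inter> \<pi>' -` {j}) Bs"
    and I: "colour_dense T f I" "mono_on X \<pi>" "\<pi> ` X \<subseteq> I"
    and I': "colour_dense T f' I'" "I' \<noteq> {}" "no_endpoints I'" "mono_on Y \<pi>'" "\<pi>' ` Y \<subseteq> I'"
    and pq: "p < length As" "q < length As"
  shows "meets X (As ! p) (As ! q) \<Longrightarrow> meets Y (Bs ! p) (Bs ! q)"
    and "precedes X (As ! p) (As ! q) \<Longrightarrow> precedes Y (Bs ! p) (Bs ! q)"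
proof -
  have fT: "f i \<in> T" if "i \<in> I" for i using I(1) that by (auto simp: colour_dense_def)
  have D: "meets (X \<inter> \<pi> -` {i}) (As ! p) (As ! q) \<Longrightarrow> meets (Y \<inter> \<pi>' -` {j}) (Bs ! p) (Bs ! q)"
    "precedes (X \<inter> \<pi> -` {i}) (As ! p) (As ! q) \<Longrightarrow> precedes (Y \<inter> \<pi>' -` {j}) (Bs ! p) (Bs ! q)"
    if "i \<in> I" "j \<in> I'" "f' j = f i" "p < length As" "q < length As" for i j p q
    using eqv_0_D[OF eq[THEN bspec, THEN bspec, THEN mp, OF that(1,2) that(3)[symmetric]] that(4,5)] by simp_all
  have same: "\<exists>j\<in>I'. f' j = f i" if "i \<in> I" for i
    using colour_dense_all_colours[OF I'(1-3) fT[OF that]] .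
  show "meets Y (Bs ! p) (Bs ! q)" if m: "meets X (As ! p) (As ! q)"
    using m D(1)[OF _ _ _ pq] same unfolding meets_fibre[OF I(3)] meets_fibre[OF I'(5)] by meson
  show "precedes Y (Bs ! p) (Bs ! q)" if "precedes X (As ! p) (As ! q)"
    using that unfolding precedes_fibre[OF I(2,3)]
  proof (elim disjE bexE conjE)
    fix i assume i: "i \<in> I" "precedes (X \<inter> \<pi> -` {i}) (As ! p) (As ! q)"
    obtain j where "j \<in> I'" "f' j = f i" using same[OF i(1)] by blast
    then show ?thesis using D(2)[OF i(1) _ _ pq i(2)] unfolding precedes_fibre[OF I'(4,5)] by blast
  next
    fix i k assume ik: "i \<in> I" "k \<in> I" "i < k" "meets (X \<inter> \<pi> -` {i}) (As ! p) (As ! p)"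
      "meets (X \<inter> \<pi> -` {k}) (As ! q) (As ! q)"
    obtain j where j: "j \<in> I'" "f' j = f i" using same[OF ik(1)] by blast
    obtain l where l: "l \<in> I'" "j < l" "f' l = f k"
      using colour_dense_above[OF I'(1,3) j(1) fT[OF ik(2)]] by blast
    show ?thesis
      using D(1)[OF ik(1) j pq(1,1) ik(4)] D(1)[OF ik(2) l(1,3) pq(2,2) ik(5)] j(1) l(1,2)
      unfolding precedes_fibre[OF I'(4,5)] by blast
  qed
qed

lemma shuffle_claim_0: "shuffle_claim 0"
  unfolding shuffle_claim_def
proof (intro allI impI)
  fix X :: "real set" and As \<pi> and I :: "real set" and f and Y :: "real set" and Bs \<pi>' and I' :: "real set" and f' T
  assume *: "length As = length Bs"
    "colour_dense T f I" "I \<noteq> {}" "no_endpoints I" "mono_on X \<pi>" "\<pi> ` X \<subseteq> I"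
    "colour_dense T f' I'" "I' \<noteq> {}" "no_endpoints I'" "mono_on Y \<pi>'" "\<pi>' ` Y \<subseteq> I'"
    "\<forall>i\<in>I. \<forall>j\<in>I'. f i = f' j \<longrightarrow> eqv 0 (X \<inter> \<pi> -` {i}) As (Y \<inter> \<pi>' -` {j}) Bs"
  have sym: "\<forall>j\<in>I'. \<forall>i\<in>I. f' j = f i \<longrightarrow> eqv 0 (Y \<inter> \<pi>' -` {j}) Bs (X \<inter> \<pi> -` {i}) As"
    using *(12) eqv_sym by metis
  show "eqv 0 X As Y Bs"
    unfolding eqv.simps
  proof (intro conjI allI impI)
    show "length As = length Bs" by (rule *(1))
    fix p q assume pq: "p < length As" "q < length As"
    then have pq': "p < length Bs" "q < length Bs" using *(1) by simp_all
    note l = shuffle_0_transfer[OF *(12,2,5,6,7,8,9,10,11) pq]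
    note r = shuffle_0_transfer[OF sym *(7,10,11,2,3,4,5,6) pq']
    show "meets X (As ! p) (As ! q) \<longleftrightarrow> meets Y (Bs ! p) (Bs ! q)"
      using l(1) r(1) by (rule iffI)
    show "precedes X (As ! p) (As ! q) \<longleftrightarrow> precedes Y (Bs ! p) (Bs ! q)"
      using l(2) r(2) by (rule iffI)
  qed
qed

section \<open>Copying a cut from one order to another\<close>

lemma min_colour_emptyI: "no_min S \<Longrightarrow> min_colour f S = {}"
  by (simp add: min_colour_no_min)

lemma max_colour_emptyI: "no_max S \<Longrightarrow> max_colour f S = {}"
  by (simp add: max_colour_no_max)

lemma min_colour_ex: "t \<in> min_colour f S \<Longrightarrow> \<exists>m\<in>S. (\<forall>y\<in>S. m \<le> y) \<and> f m = t"
  by (auto simp: min_colour_def)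

lemma max_colour_ex: "t \<in> max_colour f S \<Longrightarrow> \<exists>m\<in>S. (\<forall>y\<in>S. y \<le> m) \<and> f m = t"
  by (auto simp: max_colour_def)

lemma no_min_not_singleton: "no_min S \<Longrightarrow> \<not> (\<exists>x. S = {x})"
  by (auto simp: no_min_def)

lemma no_max_not_singleton: "no_max S \<Longrightarrow> \<not> (\<exists>x. S = {x})"
  by (auto simp: no_max_def)

lemma not_singletonI: "x \<in> S \<Longrightarrow> y \<in> S \<Longrightarrow> x \<noteq> y \<Longrightarrow> \<not> (\<exists>x. S = {x})"
  by blast

lemma not_singleton_less: "\<not> (\<exists>x. S = {x}) \<Longrightarrow> S \<noteq> {} \<Longrightarrow> \<exists>x\<in>S. \<exists>y\<in>S. x < (y::'a::linorder)"
proof -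
  assume "\<not> (\<exists>x. S = {x})" "S \<noteq> {}"
  then obtain x y where "x \<in> S" "y \<in> S" "x \<noteq> y" by blast
  then show ?thesis by (cases x y rule: linorder_cases) auto
qed

lemma kind_of_eqI:
  "min_colour f S = min_colour g R \<Longrightarrow> max_colour f S = max_colour g R \<Longrightarrow> (\<exists>x. S = {x}) = (\<exists>x. R = {x}) \<Longrightarrow>
    kind_of f S = kind_of g R"
  by (simp add: kind_of_def)

lemma kind_of_eqD:
  assumes "kind_of f S = kind_of g R"
  shows "min_colour f S = min_colour g R" "max_colour f S = max_colour g R" "(\<exists>x. S = {x}) = (\<exists>x. R = {x})"
  using assms unfolding kind_of_def prod.inject by simp_all

text \<open>The only obstruction would be a set \<open>J1\<close> with a greatest and \<open>J2\<close> with a least element, which density excludes.\<close>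

lemma ex_matching_cut:
  fixes J' :: "real set"
  assumes cd: "colour_dense T f (J1 \<union> J2)" and lt: "\<And>a b. a \<in> J1 \<Longrightarrow> b \<in> J2 \<Longrightarrow> a < b"
    and ne: "J1 \<noteq> {}" "J2 \<noteq> {}"
    and cd': "colour_dense T f' J'" and small: "small_on_thin J'" and ne': "J' \<noteq> {}"
    and kind: "kind_of f (J1 \<union> J2) = kind_of f' J'"
  shows "\<exists>D. initial_in J' D \<and> D \<noteq> {} \<and> J' - D \<noteq> {} \<and> kind_of f' D = kind_of f J1 \<and> kind_of f' (J' - D) = kind_of f J2"
proof -
  let ?J = "J1 \<union> J2"
  have J12: "?J - J1 = J2" using lt by force
  have ini: "initial_in ?J J1" unfolding initial_in_def using lt by force
  have minJ: "min_colour f J1 = min_colour f' J'"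
    using min_colour_initial[OF ini ne(1), of f] kind_of_eqD(1)[OF kind] by simp
  have maxJ: "max_colour f J2 = max_colour f' J'"
    using max_colour_final[OF ini, of f] kind_of_eqD(2)[OF kind] J12 ne(2) by simp
  have "\<not> (\<exists>x. ?J = {x})"
  proof -
    obtain a b where "a \<in> J1" "b \<in> J2" using ne by blast
    then have "a \<noteq> b" using lt by blast
    then show ?thesis using \<open>a \<in> J1\<close> \<open>b \<in> J2\<close> not_singletonI[of a ?J b] by blast
  qed
  then have "\<not> (\<exists>x. J' = {x})" using kind_of_eqD(3)[OF kind] by simp
  then obtain x y where xy: "x \<in> J'" "y \<in> J'" "x < y" using not_singleton_less[of J'] ne' by blast
  have dense: "\<exists>z\<in>J'. a < z \<and> z < c" if "a \<in> J'" "c \<in> J'" "a < c" for a c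
    using colour_dense_order_dense[OF cd'] that unfolding order_dense_def by (metis (no_types))
  \<comment> \<open>A cut between \<open>p\<close> and \<open>y\<close> leaves two points below it,
    a cut between \<open>x\<close> and \<open>p\<close> leaves two above it. This prevents an
    unwanted one-point part on either side.\<close>
  obtain p where p: "p \<in> J'" "x < p" "p < y" using dense[OF xy] by blast
  have fT: "f a \<in> T" if "a \<in> ?J" for a using cd that by (auto simp: colour_dense_def)
  have res: ?thesis if D: "initial_in J' D" "D \<noteq> {}" "J' - D \<noteq> {}" "max_colour f' D = max_colour f J1"
    "min_colour f' (J' - D) = min_colour f J2"
    "(\<exists>x. D = {x}) = (\<exists>x. J1 = {x})" "(\<exists>x. J' - D = {x}) = (\<exists>x. J2 = {x})" for D
  proof -
    have "kind_of f' D = kind_of f J1"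
      using D min_colour_initial[OF D(1,2), of f'] minJ by (intro kind_of_eqI) simp_all
    moreover have "kind_of f' (J' - D) = kind_of f J2"
      using D max_colour_final[OF D(1,3), of f'] maxJ by (intro kind_of_eqI) simp_all
    ultimately show ?thesis using D by blast
  qed
  show ?thesis
  proof (cases "no_max J1")
    case False
    then obtain m where m: "m \<in> J1" "\<And>z. z \<in> J1 \<Longrightarrow> z \<le> m" by (auto simp: no_max_def not_less)
    have max1: "max_colour f J1 = {f m}" using max_colour_eq[of m J1 f] m by simp
    have nomin2: "no_min J2"
      unfolding no_min_def
    proof
      fix b assume b: "b \<in> J2"
      have "m < b" using lt m(1) b .
      then obtain c where c: "c \<in> ?J" "m < c" "c < b"
        using cd m(1) b fT[of m] unfolding colour_dense_def by blast
      then have "c \<in> J2" using m(2) by force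
      then show "\<exists>c\<in>J2. c < b" using c by blast
    qed
    then have min2: "min_colour f J2 = {}" by (simp add: min_colour_emptyI)
    note ns2 = no_min_not_singleton[OF nomin2]
    show ?thesis
    proof (cases "\<exists>x. J1 = {x}")
      case True
      \<comment> \<open>A one-point lower part can only be matched by the least point of
        \<open>J'\<close>; that it exists and has the right colour is part of the equality of
        kinds.\<close>
      then have J1: "J1 = {m}" using m(1) by auto
      then have "f m \<in> min_colour f' J'" using minJ min_colour_eq[of m J1 f] by simp
      then obtain m' where m': "m' \<in> J'" "\<And>y. y \<in> J' \<Longrightarrow> m' \<le> y" "f' m' = f m" using min_colour_ex by metis
      have nomin: "no_min (J' - {m'})"
        unfolding no_min_def
      proof
        fix b assume b: "b \<in> J' - {m'}"
        then have "m' < b" using m'(2)[of b] by auto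
        then obtain c where "c \<in> J'" "m' < c" "c < b" using dense[of m' b] m'(1) b by blast
        then show "\<exists>c\<in>J' - {m'}. c < b" by (intro bexI[of _ c]) auto
      qed
      have "initial_in J' {m'}" unfolding initial_in_def using m' by force
      moreover have "y \<in> J' - {m'}" using xy m'(2)[OF xy(1)] by auto
      then have "J' - {m'} \<noteq> {}" by blast
      moreover have "max_colour f' {m'} = max_colour f J1" using max1 max_colour_eq[of m' "{m'}" f'] m'(3) by simp
      moreover have "min_colour f' (J' - {m'}) = min_colour f J2" using nomin min2 by (simp add: min_colour_emptyI)
      ultimately show ?thesis using no_min_not_singleton[OF nomin] ns2 True by (intro res[of "{m'}"]) auto
    next
      case False
      have "f m \<in> T" using fT m(1) by blast
      then obtain D where D: "initial_in J' D" "p \<in> D" "y \<notin> D" "max_colour f' D = {f m}" "no_min (J' - D)"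
        using ex_cut_max[OF small cd' p(1) xy(2) p(3), of "{f m}"] by blast
      have "x \<in> D" using initial_in_le[OF D(1,2) xy(1)] p by simp
      then have "\<not> (\<exists>x. D = {x})" using not_singletonI[of x D p] D(2) p(2) by blast
      then show ?thesis
        using D max1 min2 ns2 False no_min_not_singleton[OF D(5)] xy(2)
        by (intro res[of D]) (auto simp: min_colour_emptyI)
    qed
  next
    case nomax: True
    then have max1: "max_colour f J1 = {}" by (simp add: max_colour_emptyI)
    note ns1 = no_max_not_singleton[OF nomax]
    show ?thesis
    proof (cases "\<exists>x. J2 = {x}")
      case True
      then obtain m where J2: "J2 = {m}" by blast
      then have "f m \<in> max_colour f' J'" using maxJ max_colour_eq[of m J2 f] by simp
      then obtain m' where m': "m' \<in> J'" "\<And>y. y \<in> J' \<Longrightarrow> y \<le> m'" "f' m' = f m" using max_colour_ex by metis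
      have nomax': "no_max (J' - {m'})"
        unfolding no_max_def
      proof
        fix b assume b: "b \<in> J' - {m'}"
        then have "b < m'" using m'(2)[of b] by auto
        then obtain c where "c \<in> J'" "b < c" "c < m'" using dense[of b m'] m'(1) b by blast
        then show "\<exists>c\<in>J' - {m'}. b < c" by (intro bexI[of _ c]) auto
      qed
      have eq: "J' - (J' - {m'}) = {m'}" using m'(1) by blast
      have "initial_in J' (J' - {m'})" unfolding initial_in_def using m' by force
      moreover have "x \<in> J' - {m'}" using xy m'(2)[OF xy(2)] by auto
      then have "J' - {m'} \<noteq> {}" by blast
      moreover have "max_colour f' (J' - {m'}) = max_colour f J1" using nomax' max1 by (simp add: max_colour_emptyI)
      moreover have "min_colour f' {m'} = min_colour f J2"
        using min_colour_eq[of m' "{m'}" f'] min_colour_eq[of m J2 f] J2 m'(3) by simp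
      ultimately show ?thesis
        using no_max_not_singleton[OF nomax'] ns1 True by (intro res[of "J' - {m'}"]; (unfold eq)?) auto
    next
      case False
      have "f ` J2 \<subseteq> T" using fT by blast
      then obtain D where D: "initial_in J' D" "x \<in> D" "p \<notin> D" "no_max D" "min_colour f' (J' - D) = min_colour f J2"
        using ex_cut_min[OF small cd' xy(1) p(1,2), of "min_colour f J2"] min_colour_cases[of f J2 T] by blast
      have "y \<notin> D" using initial_in_le[OF D(1) _ p(1), of y] D(3) p(3) by force
      then have "\<not> (\<exists>x. J' - D = {x})" using not_singletonI[of p "J' - D" y] D(3) p xy(2) by blast
      then show ?thesis
        using D max1 ns1 False no_max_not_singleton[OF D(4)] p(1)
        by (intro res[of D]) (auto simp: max_colour_emptyI)
    qed
  qed
qed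

lemma kind_of_half_open:
  fixes J :: "'a::linorder set"
  assumes "order_dense J" "x \<in> J" "y \<in> J" "x < y"
  shows "kind_of f (J \<inter> {x..<y}) = ({f x}, {}, False)"
proof -
  have nm: "no_max (J \<inter> {x..<y})"
    unfolding no_max_def
  proof
    fix a assume a: "a \<in> J \<inter> {x..<y}"
    then obtain z where "z \<in> J" "a < z" "z < y" using assms(1,3) unfolding order_dense_def by auto
    then show "\<exists>b\<in>J \<inter> {x..<y}. a < b" using a by (intro bexI[of _ z]) auto
  qed
  have "min_colour f (J \<inter> {x..<y}) = {f x}" by (rule min_colour_eq) (use assms in auto)
  then show ?thesis
    using nm no_max_not_singleton[OF nm] unfolding kind_of_def by (simp add: max_colour_emptyI)
qed

section \<open>The induction step: good sets\<close>

locale shuffle_step =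
  fixes n :: nat and X :: "real set" and As :: "real set list" and \<pi> :: "real \<Rightarrow> real" and I :: "real set"
    and f :: "real \<Rightarrow> nat" and Y :: "real set" and Bs :: "real set list" and \<pi>' :: "real \<Rightarrow> real"
    and I' :: "real set" and f' :: "real \<Rightarrow> nat" and T :: "nat set" and A :: "real set"
  assumes claim: "shuffle_claim n" and finT: "finite T" and len: "length As = length Bs"
    and cd: "colour_dense T f I" and I: "I \<noteq> {}" "no_endpoints I" "small_on_thin I"
    and \<pi>: "mono_on X \<pi>" "\<pi> ` X \<subseteq> I"
    and cd': "colour_dense T f' I'" and I': "I' \<noteq> {}" "no_endpoints I'" "small_on_thin I'"
    and \<pi>': "mono_on Y \<pi>'" "\<pi>' ` Y \<subseteq> I'"
    and fibres: "\<And>i j. i \<in> I \<Longrightarrow> j \<in> I' \<Longrightarrow> f i = f' j \<Longrightarrow>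
      eqv (Suc n) (X \<inter> \<pi> -` {i}) As (Y \<inter> \<pi>' -` {j}) Bs"
begin

text \<open>\<open>A\<close> is fixed, while the answer may vary with \<open>J'\<close>. The
  quantifier over all \<open>J'\<close> of the same kind leaves the pieces on the right free to be
  chosen wherever their endpoints fit.\<close>

definition good :: "real set \<Rightarrow> bool" where
  "good J \<longleftrightarrow> (\<forall>J'. convex_in I' J' \<longrightarrow> J' \<noteq> {} \<longrightarrow> kind_of f J = kind_of f' J' \<longrightarrow>
    (\<exists>B. eqv n (X \<inter> \<pi> -` J) (A # As) (Y \<inter> \<pi>' -` J') (B # Bs)))"

text \<open>Hereditary goodness. Goodness is not known to pass to convex subsets, and an equivalence
  relation with convex classes needs a property that does.\<close>

definition nice :: "real set \<Rightarrow> bool" where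
  "nice C \<longleftrightarrow> (\<forall>J. convex_in I J \<longrightarrow> J \<noteq> {} \<longrightarrow> J \<subseteq> C \<longrightarrow> good J)"

lemma goodD: "good J \<Longrightarrow> convex_in I' J' \<Longrightarrow> J' \<noteq> {} \<Longrightarrow> kind_of f J = kind_of f' J' \<Longrightarrow>
    \<exists>B. eqv n (X \<inter> \<pi> -` J) (A # As) (Y \<inter> \<pi>' -` J') (B # Bs)"
  by (simp add: good_def)

lemma niceD: "nice C \<Longrightarrow> convex_in I J \<Longrightarrow> J \<noteq> {} \<Longrightarrow> J \<subseteq> C \<Longrightarrow> good J"
  by (simp add: nice_def)

lemma nice_subset: "nice C \<Longrightarrow> D \<subseteq> C \<Longrightarrow> nice D"
  unfolding nice_def by (meson order_trans)

lemma good_singleton: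
  assumes "x \<in> I"
  shows "good {x}"
  unfolding good_def
proof (intro allI impI)
  fix J' assume *: "convex_in I' J'" "J' \<noteq> {}" "kind_of f {x} = kind_of f' J'"
  have "\<exists>y. J' = {y}" using kind_of_eqD(3)[OF *(3)] by simp
  then obtain y where y: "J' = {y}" ..
  then have "f x = f' y" using *(3) by (simp add: kind_of_singleton)
  moreover have "y \<in> I'" using *(1) y by (simp add: convex_in_def)
  ultimately have "eqv (Suc n) (X \<inter> \<pi> -` {x}) As (Y \<inter> \<pi>' -` {y}) Bs" using fibres assms by blast
  then show "\<exists>B. eqv n (X \<inter> \<pi> -` {x}) (A # As) (Y \<inter> \<pi>' -` J') (B # Bs)" unfolding y eqv.simps by blast
qed

text \<open>If \<open>J\<close> and \<open>J'\<close> are cut along the same index order into pieces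
  of equal kinds, the answers over the pieces glue to an answer over \<open>J'\<close>.\<close>

lemma sum_good:
  fixes \<rho> \<rho>' :: "real \<Rightarrow> 'c::linorder"
  assumes "mono_on J \<rho>" "mono_on J' \<rho>'" "convex_in I' J'" "\<rho> ` J = \<rho>' ` J'"
    and good: "\<And>c. c \<in> \<rho> ` J \<Longrightarrow> good (J \<inter> \<rho> -` {c})"
    and kind: "\<And>c. c \<in> \<rho> ` J \<Longrightarrow> kind_of f (J \<inter> \<rho> -` {c}) = kind_of f' (J' \<inter> \<rho>' -` {c})"
  shows "\<exists>B. eqv n (X \<inter> \<pi> -` J) (A # As) (Y \<inter> \<pi>' -` J') (B # Bs)"
proof -
  have "\<forall>c. \<exists>B. c \<in> \<rho> ` J \<longrightarrow>
      eqv n (X \<inter> \<pi> -` (J \<inter> \<rho> -` {c})) (A # As) (Y \<inter> \<pi>' -` (J' \<inter> \<rho>' -` {c})) (B # Bs)"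
  proof
    fix c
    show "\<exists>B. c \<in> \<rho> ` J \<longrightarrow>
      eqv n (X \<inter> \<pi> -` (J \<inter> \<rho> -` {c})) (A # As) (Y \<inter> \<pi>' -` (J' \<inter> \<rho>' -` {c})) (B # Bs)"
    proof (cases "c \<in> \<rho> ` J")
      case True
      have "J' \<inter> \<rho>' -` {c} \<noteq> {}" using True assms(4) by auto
      then show ?thesis
        using goodD[OF good[OF True] convex_in_Int_vimage[OF assms(3,2)] _ kind[OF True]] by blast
    qed blast
  qed
  from choice[OF this] obtain b where b: "\<And>c. c \<in> \<rho> ` J \<Longrightarrow>
      eqv n (X \<inter> \<pi> -` (J \<inter> \<rho> -` {c})) (A # As) (Y \<inter> \<pi>' -` (J' \<inter> \<rho>' -` {c})) (b c # Bs)" by blast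
  have "eqv n (X \<inter> \<pi> -` J) (A # As) (Y \<inter> \<pi>' -` J') ({y. y \<in> b (\<rho>' (\<pi>' y))} # Bs)"
  proof (rule eqv_sum[where \<rho> = "\<lambda>x. \<rho> (\<pi> x)" and \<rho>' = "\<lambda>y. \<rho>' (\<pi>' y)" and C = "\<rho> ` J"])
    show "(\<lambda>x. \<rho> (\<pi> x)) ` (X \<inter> \<pi> -` J) \<subseteq> \<rho> ` J" by auto
    show "(\<lambda>y. \<rho>' (\<pi>' y)) ` (Y \<inter> \<pi>' -` J') \<subseteq> \<rho> ` J" using assms(4) by auto
    show "mono_on (X \<inter> \<pi> -` J) (\<lambda>x. \<rho> (\<pi> x))"
      using mono_onD[OF \<pi>(1)] mono_onD[OF assms(1)] by (intro mono_onI) simp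
    show "mono_on (Y \<inter> \<pi>' -` J') (\<lambda>y. \<rho>' (\<pi>' y))"
      using mono_onD[OF \<pi>'(1)] mono_onD[OF assms(2)] by (intro mono_onI) simp
    show "length (A # As) = length ({y. y \<in> b (\<rho>' (\<pi>' y))} # Bs)" using len by simp
    fix c assume c: "c \<in> \<rho> ` J"
    have eq: "X \<inter> \<pi> -` J \<inter> (\<lambda>x. \<rho> (\<pi> x)) -` {c} = X \<inter> \<pi> -` (J \<inter> \<rho> -` {c})"
      "Y \<inter> \<pi>' -` J' \<inter> (\<lambda>y. \<rho>' (\<pi>' y)) -` {c} = Y \<inter> \<pi>' -` (J' \<inter> \<rho>' -` {c})" by auto
    show "eqv n (X \<inter> \<pi> -` J \<inter> (\<lambda>x. \<rho> (\<pi> x)) -` {c}) (A # As)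
        (Y \<inter> \<pi>' -` J' \<inter> (\<lambda>y. \<rho>' (\<pi>' y)) -` {c}) ({y. y \<in> b (\<rho>' (\<pi>' y))} # Bs)"
      unfolding eq by (rule eqv_cong_hd[OF b[OF c]]) auto
  qed
  then show ?thesis by blast
qed

lemma convex_in_props:
  assumes "convex_in I J"
  shows "colour_dense T f J" "order_dense J" "small_on_thin J" "J \<subseteq> I"
  using colour_dense_convex_in[OF cd assms] colour_dense_order_dense small_on_thin_subset[OF I(3)] assms
  by (auto simp: convex_in_def)

lemma convex_in_props':
  assumes "convex_in I' J"
  shows "colour_dense T f' J" "order_dense J" "small_on_thin J" "J \<subseteq> I'"
  using colour_dense_convex_in[OF cd' assms] colour_dense_order_dense small_on_thin_subset[OF I'(3)] assms
  by (auto simp: convex_in_def)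

lemma good_join:
  assumes J: "convex_in I (J1 \<union> J2)" and lt: "\<And>a b. a \<in> J1 \<Longrightarrow> b \<in> J2 \<Longrightarrow> a < b"
    and ne: "J1 \<noteq> {}" "J2 \<noteq> {}" and good: "good J1" "good J2"
  shows "good (J1 \<union> J2)"
  unfolding good_def
proof (intro allI impI)
  fix J' assume J': "convex_in I' J'" "J' \<noteq> {}" and kind: "kind_of f (J1 \<union> J2) = kind_of f' J'"
  obtain D where D: "initial_in J' D" "D \<noteq> {}" "J' - D \<noteq> {}" "kind_of f' D = kind_of f J1" "kind_of f' (J' - D) = kind_of f J2"
    using ex_matching_cut[OF convex_in_props(1)[OF J] lt ne convex_in_props'(1,3)[OF J'(1)] J'(2) kind] by blast
  have disj: "x \<notin> J2" if "x \<in> J1" for x using lt[OF that, of x] by blast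
  have DJ: "D \<subseteq> J'" using D(1) by (simp add: initial_in_def)
  have fib: "(J1 \<union> J2) \<inter> (\<lambda>x. x \<in> J2) -` {False} = J1" "(J1 \<union> J2) \<inter> (\<lambda>x. x \<in> J2) -` {True} = J2"
    "J' \<inter> (\<lambda>y. y \<notin> D) -` {False} = D" "J' \<inter> (\<lambda>y. y \<notin> D) -` {True} = J' - D"
    using disj DJ by auto
  show "\<exists>B. eqv n (X \<inter> \<pi> -` (J1 \<union> J2)) (A # As) (Y \<inter> \<pi>' -` J') (B # Bs)"
  \<comment> \<open>The index order of a sum of two parts is the order
    \<open>False < True\<close>.\<close>
  proof (rule sum_good[where \<rho> = "\<lambda>x. x \<in> J2" and \<rho>' = "\<lambda>y. y \<notin> D"])
    show "mono_on (J1 \<union> J2) (\<lambda>x. x \<in> J2)"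
    proof (rule mono_onI)
      fix r s assume "r \<in> J1 \<union> J2" "s \<in> J1 \<union> J2" "r \<le> s"
      then show "(r \<in> J2) \<le> (s \<in> J2)" using lt[of s r] by force
    qed
    show "mono_on J' (\<lambda>y. y \<notin> D)"
    proof (rule mono_onI)
      fix r s assume "r \<in> J'" "s \<in> J'" "r \<le> s"
      then show "(r \<notin> D) \<le> (s \<notin> D)" using initial_in_le[OF D(1), of s r] by auto
    qed
    show "convex_in I' J'" by (rule J')
    show "(\<lambda>x. x \<in> J2) ` (J1 \<union> J2) = (\<lambda>y. y \<notin> D) ` J'"
    proof -
      have "(\<lambda>x. x \<in> J2) ` (J1 \<union> J2) = UNIV" using ne disj unfolding UNIV_bool by (auto simp: image_iff)
      moreover have "(\<lambda>y. y \<notin> D) ` J' = UNIV" using D(2,3) DJ unfolding UNIV_bool by (auto simp: image_iff)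
      ultimately show ?thesis by simp
    qed
    show "good ((J1 \<union> J2) \<inter> (\<lambda>x. x \<in> J2) -` {c})" for c
      using good by (cases c) (simp_all only: fib)
    show "kind_of f ((J1 \<union> J2) \<inter> (\<lambda>x. x \<in> J2) -` {c}) = kind_of f' (J' \<inter> (\<lambda>y. y \<notin> D) -` {c})" for c
      using D(4,5) by (cases c) (simp_all only: fib)
  qed
qed

text \<open>Cut \<open>J\<close> into half-open intervals along an unbounded integer sequence
  \<open>u\<close>, and \<open>J'\<close> along a sequence \<open>w\<close> of points with the same
  colours. Corresponding intervals have the same kind: least point of colour \<open>f (u k)\<close>,
  no greatest point, not a singleton.\<close>

lemma good_int_sum:
  assumes J: "convex_in I J" "J \<noteq> {}" "no_endpoints J"
    and between: "\<And>x y. x \<in> J \<Longrightarrow> y \<in> J \<Longrightarrow> x < y \<Longrightarrow> good (J \<inter> {x..<y})"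
  shows "good J"
  unfolding good_def
proof (intro allI impI)
  fix J' assume J': "convex_in I' J'" "J' \<noteq> {}" and kind: "kind_of f J = kind_of f' J'"
  have fT: "f x \<in> T" if "x \<in> J" for x using convex_in_props(1)[OF J(1)] that by (auto simp: colour_dense_def)
  have ends: "no_min J" "no_max J" using J(3) by (simp_all add: no_endpoints_iff)
  have ends': "no_min J'" "no_max J'"
    using kind_of_eqD(1,2)[OF kind] min_colour_emptyI[OF ends(1), of f] max_colour_emptyI[OF ends(2), of f]
      min_colour_no_min[of f' J'] max_colour_no_max[of f' J'] by simp_all
  obtain u :: "int \<Rightarrow> real" where u: "strict_mono u" "\<And>k. u k \<in> J" "\<And>y. y \<in> J \<Longrightarrow> \<exists>k. u k < y"
    "\<And>y. y \<in> J \<Longrightarrow> \<exists>k. y < u k"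
    using ex_int_sequence[OF ends J(2)] by blast
  obtain v :: "int \<Rightarrow> real" where v: "strict_mono v" "\<And>k. v k \<in> J'" "\<And>y. y \<in> J' \<Longrightarrow> \<exists>k. v k < y"
    "\<And>y. y \<in> J' \<Longrightarrow> \<exists>k. y < v k"
    using ex_int_sequence[OF ends' J'(2)] by blast
  \<comment> \<open>One point of the prescribed colour is taken from each interval of an unbounded
    sequence \<open>v\<close>; the interleaving makes the new sequence unbounded as well.\<close>
  have "\<forall>k. \<exists>c. c \<in> J' \<and> v k < c \<and> c < v (k + 1) \<and> f' c = f (u k)"
  proof
    fix k
    have "v k < v (k + 1)" using v(1) by (simp add: strict_mono_less)
    then show "\<exists>c. c \<in> J' \<and> v k < c \<and> c < v (k + 1) \<and> f' c = f (u k)"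
      using convex_in_props'(1)[OF J'(1)] v(2) fT[OF u(2)] unfolding colour_dense_def by blast
  qed
  from choice[OF this] obtain w where w: "\<And>k. w k \<in> J' \<and> v k < w k \<and> w k < v (k + 1) \<and> f' (w k) = f (u k)" by blast
  have w_mono: "strict_mono w"
  proof (rule strict_monoI)
    fix k l :: int assume "k < l"
    then have "v (k + 1) \<le> v l" using strict_mono_less_eq[OF v(1), of "k + 1" l] by simp
    then show "w k < w l" using w[of k] w[of l] by linarith
  qed
  have w_cof: "\<exists>k. y < w k" if yJ: "y \<in> J'" for y
  proof -
    obtain k where "y < v k" using v(4)[OF yJ] by blast
    then have "y < w k" using w[of k] by linarith
    then show ?thesis by blast
  qed
  have w_coi: "\<exists>k. w k < y" if yJ: "y \<in> J'" for y
  proof -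
    obtain k where "v k < y" using v(3)[OF yJ] by blast
    then have "w (k - 1) < y" using w[of "k - 1"] by simp
    then show ?thesis by blast
  qed
  have fu: "J \<inter> step_index u -` {k} = J \<inter> {u k..<u (k + 1)}" for k
    using step_index_bounds[OF u(1) u(3) u(4)] step_index_eq[OF u(1)] by auto
  have fw: "J' \<inter> step_index w -` {k} = J' \<inter> {w k..<w (k + 1)}" for k
    using step_index_bounds[OF w_mono w_coi w_cof] step_index_eq[OF w_mono] by auto
  have lu: "u k < u (k + 1)" for k using u(1) by (simp add: strict_mono_less)
  have lw: "w k < w (k + 1)" for k using w_mono by (simp add: strict_mono_less)
  show "\<exists>B. eqv n (X \<inter> \<pi> -` J) (A # As) (Y \<inter> \<pi>' -` J') (B # Bs)"
  proof (rule sum_good[where \<rho> = "step_index u" and \<rho>' = "step_index w"])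
    show "mono_on J (step_index u)" by (rule step_index_mono[OF u(1,3,4)])
    show "mono_on J' (step_index w)" by (rule step_index_mono[OF w_mono w_coi w_cof])
    show "convex_in I' J'" by (rule J')
    have "k \<in> step_index u ` J" for k
      by (rule image_eqI[of _ _ "u k"]) (simp_all add: step_index_eq[OF u(1) order_refl lu] u(2))
    moreover have "k \<in> step_index w ` J'" for k
      by (rule image_eqI[of _ _ "w k"]) (simp_all add: step_index_eq[OF w_mono order_refl lw] w)
    ultimately show "step_index u ` J = step_index w ` J'" by blast
    show "good (J \<inter> step_index u -` {k})" for k
      unfolding fu by (rule between[OF u(2) u(2) lu])
    show "kind_of f (J \<inter> step_index u -` {k}) = kind_of f' (J' \<inter> step_index w -` {k})" for k
      using kind_of_half_open[OF convex_in_props(2)[OF J(1)] u(2) u(2) lu, where f = f]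
        kind_of_half_open[OF convex_in_props'(2)[OF J'(1)] _ _ lw, where f = f'] w
      unfolding fu fw by simp
  qed
qed

lemma good_remove_min:
  assumes "convex_in I J" "m \<in> J" "\<And>x. x \<in> J \<Longrightarrow> m \<le> x" "J \<noteq> {m}" "good (J - {m})"
  shows "good J"
proof -
  have "{m} \<union> (J - {m}) = J" using assms(2) by blast
  moreover have "m < b" if "b \<in> J - {m}" for b using assms(3)[of b] that by force
  moreover have "good {m}" using good_singleton assms(1,2) by (auto simp: convex_in_def)
  ultimately show ?thesis using good_join[of "{m}" "J - {m}"] assms by force
qed

lemma good_remove_max:
  assumes "convex_in I J" "m \<in> J" "\<And>x. x \<in> J \<Longrightarrow> x \<le> m" "J \<noteq> {m}" "good (J - {m})"
  shows "good J"
proof -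
  have "(J - {m}) \<union> {m} = J" using assms(2) by blast
  moreover have "b < m" if "b \<in> J - {m}" for b using assms(3)[of b] that by force
  moreover have "good {m}" using good_singleton assms(1,2) by (auto simp: convex_in_def)
  ultimately show ?thesis using good_join[of "J - {m}" "{m}"] assms by force
qed

section \<open>The equivalence relation given by nice intervals\<close>

definition seg :: "real \<Rightarrow> real \<Rightarrow> real set" where
  "seg x y = I \<inter> {min x y..max x y}"

definition rel :: "real \<Rightarrow> real \<Rightarrow> bool" where
  "rel x y \<longleftrightarrow> nice (seg x y)"

definition cls :: "real \<Rightarrow> real set" where
  "cls p = {y \<in> I. rel p y}"

text \<open>A convex subset of the union meets \<open>C1\<close> and \<open>C2\<close> in convex
  sets, one below the other, and \<open>good_join\<close> applies to these traces.\<close>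

lemma nice_Un:
  assumes nice: "nice C1" "nice C2" and lt: "\<And>a b. a \<in> C1 \<Longrightarrow> b \<in> C2 \<Longrightarrow> a < b"
  shows "nice (C1 \<union> C2)"
  unfolding nice_def
proof (intro allI impI)
  fix J assume J: "convex_in I J" "J \<noteq> {}" "J \<subseteq> C1 \<union> C2"
  have c1: "convex_in I (J \<inter> C1)"
    unfolding convex_in_def
  proof (intro conjI ballI impI)
    show "J \<inter> C1 \<subseteq> I" using J(1) by (auto simp: convex_in_def)
    fix a b c assume *: "a \<in> J \<inter> C1" "b \<in> J \<inter> C1" "c \<in> I" "a < c \<and> c < b"
    then have "c \<in> J" using J(1) unfolding convex_in_def by blast
    moreover have "c \<notin> C2" using lt[of b c] * by auto
    ultimately show "c \<in> J \<inter> C1" using J(3) by blast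
  qed
  have c2: "convex_in I (J \<inter> C2)"
    unfolding convex_in_def
  proof (intro conjI ballI impI)
    show "J \<inter> C2 \<subseteq> I" using J(1) by (auto simp: convex_in_def)
    fix a b c assume *: "a \<in> J \<inter> C2" "b \<in> J \<inter> C2" "c \<in> I" "a < c \<and> c < b"
    then have "c \<in> J" using J(1) unfolding convex_in_def by blast
    moreover have "c \<notin> C1" using lt[of c a] * by auto
    ultimately show "c \<in> J \<inter> C2" using J(3) by blast
  qed
  have J12: "J \<inter> C1 \<union> J \<inter> C2 = J" using J(3) by blast
  show "good J"
  proof (cases "J \<inter> C1 = {} \<or> J \<inter> C2 = {}")
    case True
    then have "J \<subseteq> C2 \<or> J \<subseteq> C1" using J(3) by blast
    then show ?thesis using niceD nice J by blast
  next
    case False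
    have "good (J \<inter> C1 \<union> J \<inter> C2)"
    proof (rule good_join)
      show "convex_in I (J \<inter> C1 \<union> J \<inter> C2)" using J12 J(1) by simp
      show "good (J \<inter> C1)" "good (J \<inter> C2)" using niceD[OF nice(1) c1] niceD[OF nice(2) c2] False by blast+
    qed (use lt False in blast)+
    then show ?thesis using J12 by simp
  qed
qed

lemma rel_refl: "x \<in> I \<Longrightarrow> rel x x"
  unfolding rel_def nice_def
proof (intro allI impI)
  fix J assume "x \<in> I" "J \<noteq> {}" "J \<subseteq> seg x x"
  then have "J = {x}" by (auto simp: seg_def)
  then show "good J" using good_singleton \<open>x \<in> I\<close> by simp
qed

lemma rel_sym: "rel x y \<longleftrightarrow> rel y x"
  by (simp add: rel_def seg_def min.commute max.commute)

lemma rel_subseg: "rel a b \<Longrightarrow> a \<le> x \<Longrightarrow> x \<le> y \<Longrightarrow> y \<le> b \<Longrightarrow> rel x y"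
  unfolding rel_def by (erule nice_subset) (auto simp: seg_def)

lemma rel_join:
  assumes "a \<le> p" "p \<le> b" "rel a p" "rel p b"
  shows "rel a b"
proof -
  \<comment> \<open>Both segments contain \<open>p\<close>; it is taken out of the second one so
    that all points of the first lie strictly below.\<close>
  have "nice (seg p b - {p})" using assms(4) nice_subset unfolding rel_def by blast
  then have "nice (seg a p \<union> (seg p b - {p}))"
    using assms(3) unfolding rel_def by (intro nice_Un) (use assms(1,2) in \<open>auto simp: seg_def\<close>)
  moreover have "seg a b \<subseteq> seg a p \<union> (seg p b - {p})" using assms(1,2) by (auto simp: seg_def)
  ultimately show ?thesis unfolding rel_def by (rule nice_subset)
qed

lemma rel_trans_le:
  assumes "rel a p" "rel p b" "a \<le> b"
  shows "rel a b"
proof -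
  consider "p \<le> a" | "b \<le> p" | "a \<le> p" "p \<le> b" by linarith
  then show ?thesis
  proof cases
    case 1
    then show ?thesis using rel_subseg[OF assms(2)] assms(3) by simp
  next
    case 2
    then show ?thesis using rel_subseg[OF assms(1)] assms(3) by simp
  next
    case 3
    then show ?thesis using rel_join assms(1,2) by blast
  qed
qed

lemma rel_trans: "rel a p \<Longrightarrow> rel p b \<Longrightarrow> rel a b"
  using rel_trans_le[of a p b] rel_trans_le[of b p a] rel_sym by (cases "a \<le> b") auto

lemma rel_cls: "a \<in> cls p \<Longrightarrow> b \<in> cls p \<Longrightarrow> rel a b"
  unfolding cls_def using rel_trans rel_sym by blast

lemma convex_cls: "convex_in I (cls p)"
  unfolding convex_in_def
proof (intro conjI ballI impI)
  show "cls p \<subseteq> I" by (auto simp: cls_def)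
  fix a b c assume *: "a \<in> cls p" "b \<in> cls p" "c \<in> I" "a < c \<and> c < b"
  then have "rel a c" using rel_subseg[OF rel_cls[OF *(1,2)], of a c] by simp
  moreover have "rel p a" using *(1) by (simp add: cls_def)
  ultimately have "rel p c" by (rule rel_trans[rotated])
  then show "c \<in> cls p" using *(3) by (simp add: cls_def)
qed

lemma convex_in_Diff:
  assumes "convex_in I J" "(\<forall>x\<in>J. x \<le> m) \<or> (\<forall>x\<in>J. m \<le> x)"
  shows "convex_in I (J - {m})"
  unfolding convex_in_def
proof (intro conjI ballI impI)
  show "J - {m} \<subseteq> I" using assms(1) by (auto simp: convex_in_def)
  fix a b c assume *: "a \<in> J - {m}" "b \<in> J - {m}" "c \<in> I" "a < c \<and> c < b"
  then have "c \<in> J" using assms(1) unfolding convex_in_def by blast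
  moreover have "c \<noteq> m" using assms(2) * by force
  ultimately show "c \<in> J - {m}" by blast
qed

text \<open>The relation controls only the parts between two points of the class. A convex subset
  without endpoints is an integer sum of such parts; a greatest and then a least point are added as
  one-point sets.\<close>

lemma nice_cls: "nice (cls p)"
  unfolding nice_def
proof (intro allI impI)
  have dense: "\<exists>z\<in>J. a < z \<and> z < b" if "convex_in I J" "a \<in> J" "b \<in> J" "a < b" for J a b
    using convex_in_props(2)[OF that(1)] that(2-4) unfolding order_dense_def by (metis (no_types))
  have inner: "good J" if J: "convex_in I J" "J \<noteq> {}" "J \<subseteq> cls p" "no_min J" "no_max J" for J
  proof (rule good_int_sum[OF J(1,2)])
    show "no_endpoints J" using J(4,5) by (simp add: no_endpoints_iff)
    fix x y assume xy: "x \<in> J" "y \<in> J" "x < y"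
    have "convex_in I (J \<inter> {x..<y})"
    proof -
      have "J \<subseteq> I" "\<And>a b c. a \<in> J \<Longrightarrow> b \<in> J \<Longrightarrow> c \<in> I \<Longrightarrow> a < c \<Longrightarrow> c < b \<Longrightarrow> c \<in> J"
        using J(1) unfolding convex_in_def by blast+
      then show ?thesis unfolding convex_in_def by auto
    qed
    moreover have "J \<inter> {x..<y} \<subseteq> seg x y"
      using convex_in_props(4)[OF J(1)] xy(3) by (auto simp: seg_def)
    moreover have "nice (seg x y)" using rel_cls[of x p y] xy J(3) unfolding rel_def by blast
    moreover have "x \<in> J \<inter> {x..<y}" using xy by simp
    ultimately show "good (J \<inter> {x..<y})" using niceD by blast
  qed
  have left_open: "good J" if J: "convex_in I J" "J \<noteq> {}" "J \<subseteq> cls p" "no_min J" for J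
  proof (cases "no_max J")
    case True
    then show ?thesis using inner J by blast
  next
    case False
    then obtain m where m: "m \<in> J" "\<And>x. x \<in> J \<Longrightarrow> x \<le> m" by (auto simp: no_max_def not_less)
    have lt: "x < m" if "x \<in> J" "x \<noteq> m" for x using m(2)[OF that(1)] that(2) by simp
    have ne: "J \<noteq> {m}" using no_min_not_singleton[OF J(4)] by blast
    have "good (J - {m})"
    proof (rule inner)
      show "convex_in I (J - {m})" by (rule convex_in_Diff[OF J(1)]) (use m(2) in auto)
      show "no_min (J - {m})"
        unfolding no_min_def
      proof
        fix a assume a: "a \<in> J - {m}"
        then obtain b where "b \<in> J" "b < a" using J(4) unfolding no_min_def by blast
        then show "\<exists>b\<in>J - {m}. b < a" using lt[of a] a by (intro bexI[of _ b]) auto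
      qed
      show "no_max (J - {m})"
        unfolding no_max_def
      proof
        fix a assume a: "a \<in> J - {m}"
        then obtain c where "c \<in> J" "a < c" "c < m" using dense[OF J(1) _ m(1), of a] lt[of a] by blast
        then show "\<exists>b\<in>J - {m}. a < b" by (intro bexI[of _ c]) auto
      qed
    qed (use J(3) ne m(1) in blast)+
    then show ?thesis using good_remove_max[OF J(1) m ne] by blast
  qed
  fix J assume J: "convex_in I J" "J \<noteq> {}" "J \<subseteq> cls p"
  show "good J"
  proof (cases "no_min J")
    case True
    then show ?thesis using left_open J by blast
  next
    case False
    then obtain m where m: "m \<in> J" "\<And>x. x \<in> J \<Longrightarrow> m \<le> x" by (auto simp: no_min_def not_less)
    have lt: "m < x" if "x \<in> J" "x \<noteq> m" for x using m(2)[OF that(1)] that(2) by simp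
    show ?thesis
    proof (cases "J = {m}")
      case True
      then show ?thesis using good_singleton J(1) by (simp add: convex_in_def)
    next
      case ne: False
      have "good (J - {m})"
      proof (rule left_open)
        show "convex_in I (J - {m})" by (rule convex_in_Diff[OF J(1)]) (use m(2) in auto)
        show "no_min (J - {m})"
          unfolding no_min_def
        proof
          fix a assume a: "a \<in> J - {m}"
          then obtain c where "c \<in> J" "m < c" "c < a" using dense[OF J(1) m(1), of a] lt[of a] by blast
          then show "\<exists>b\<in>J - {m}. b < a" by (intro bexI[of _ c]) auto
        qed
      qed (use J(3) ne m(1) in blast)+
      then show ?thesis using good_remove_min[OF J(1) m ne] by blast
    qed
  qed
qed

end

section \<open>The order of the classes has only one element\<close>

context shuffle_step
begin

text \<open>Representatives make the order of classes a set of reals inside \<open>I\<close>, so the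
  hypothesis of smallness holds for it and the induction hypothesis can be applied to it.\<close>

definition rep :: "real \<Rightarrow> real" where
  "rep x = (SOME y. y \<in> cls x)"

abbreviation R :: "real set" where "R \<equiv> rep ` I"

lemma self_in_cls: "x \<in> I \<Longrightarrow> x \<in> cls x"
  by (simp add: cls_def rel_refl)

lemma rep_in_cls: "x \<in> I \<Longrightarrow> rep x \<in> cls x"
  unfolding rep_def by (rule someI[of _ x]) (rule self_in_cls)

lemma cls_sub: "cls x \<subseteq> I"
  by (auto simp: cls_def)

lemma cls_eq: "y \<in> cls x \<Longrightarrow> cls y = cls x"
  unfolding cls_def using rel_trans rel_sym by blast

lemma rep_eq: "y \<in> cls x \<Longrightarrow> rep y = rep x"
  by (simp add: rep_def cls_eq)

lemma rep_eq_iff: "x \<in> I \<Longrightarrow> y \<in> I \<Longrightarrow> rep x = rep y \<longleftrightarrow> y \<in> cls x"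
proof
  assume *: "x \<in> I" "y \<in> I" "rep x = rep y"
  have "cls x = cls y" using cls_eq[OF rep_in_cls[OF *(1)]] cls_eq[OF rep_in_cls[OF *(2)]] *(3) by simp
  then show "y \<in> cls x" using self_in_cls[OF *(2)] by simp
next
  assume "y \<in> cls x"
  then show "rep x = rep y" using rep_eq by simp
qed

lemma rep_in: "x \<in> I \<Longrightarrow> rep x \<in> I"
  using rep_in_cls cls_sub by blast

lemma rep_idem: "c \<in> R \<Longrightarrow> rep c = c"
  using rep_eq rep_in_cls by blast

lemma R_sub: "R \<subseteq> I"
  using rep_in by blast

lemma rep_fibre: "c \<in> R \<Longrightarrow> I \<inter> rep -` {c} = cls c"
proof (intro equalityI subsetI)
  fix x assume c: "c \<in> R" and x: "x \<in> I \<inter> rep -` {c}"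
  have cI: "c \<in> I" using c R_sub by blast
  have "rep c = rep x" using rep_idem[OF c] x by simp
  then show "x \<in> cls c" using rep_eq_iff[OF cI, of x] x by simp
next
  fix x assume c: "c \<in> R" and x: "x \<in> cls c"
  have "rep x = c" using rep_eq[OF x] rep_idem[OF c] by simp
  then show "x \<in> I \<inter> rep -` {c}" using x cls_sub by blast
qed

lemma rep_mono:
  assumes "x \<in> I" "y \<in> I" "x \<le> y"
  shows "rep x \<le> rep y"
proof (rule ccontr)
  assume "\<not> rep x \<le> rep y"
  then have lt: "rep y < rep x" by simp
  have cx: "x \<in> cls x" "rep x \<in> cls x" "y \<in> cls y" "rep y \<in> cls y" using self_in_cls rep_in_cls assms by auto
  have mid: "b \<in> cls p" if "a \<in> cls p" "c \<in> cls p" "b \<in> I" "a \<le> b" "b \<le> c" for a b c p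
  proof (cases "a = b \<or> b = c")
    case False
    then show ?thesis using convex_cls[of p] that unfolding convex_in_def by (metis order.order_iff_strict)
  qed (use that in auto)
  have "y \<in> cls x"
  proof (cases "rep y \<le> x")
    case True
    then have "x \<in> cls y" using mid[OF cx(4,3) assms(1)] assms(3) by simp
    then show ?thesis using cls_eq[of x y] cx by simp
  next
    case False
    then have "rep y \<in> cls x" using mid[OF cx(1,2) rep_in[OF assms(2)]] lt by simp
    then show ?thesis using cls_eq[of "rep y" x] cls_eq[OF cx(4)] cx by simp
  qed
  then show False using rep_eq lt by force
qed

lemma rep_less_rev: "x \<in> I \<Longrightarrow> y \<in> I \<Longrightarrow> rep x < rep y \<Longrightarrow> x < y"
  using rep_mono[of y x] by (meson not_less)

lemma R_dense: "order_dense R"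
  unfolding order_dense_def
proof (intro ballI impI)
  fix c d assume cd: "c \<in> R" "d \<in> R" "c < d"
  show "\<exists>e\<in>R. c < e \<and> e < d"
  proof (rule ccontr)
    assume no: "\<not> ?thesis"
    have cI: "c \<in> I" "d \<in> I" using cd R_sub by blast+
    have "seg c d \<subseteq> cls c \<union> cls d"
    proof
      fix x assume "x \<in> seg c d"
      then have x: "x \<in> I" "c \<le> x" "x \<le> d" using cd(3) by (auto simp: seg_def)
      have "c \<le> rep x" "rep x \<le> d" using rep_mono[OF cI(1) x(1,2)] rep_mono[OF x(1) cI(2) x(3)] rep_idem[OF cd(1)] rep_idem[OF cd(2)]
        by simp_all
      moreover have "rep x \<in> R" using x(1) by blast
      then have "\<not> (c < rep x \<and> rep x < d)" using no by blast
      ultimately have "rep x = c \<or> rep x = d" by linarith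
      then show "x \<in> cls c \<union> cls d" using rep_fibre[OF cd(1)] rep_fibre[OF cd(2)] x(1) by auto
    qed
    moreover have "nice (cls c \<union> cls d)"
    proof (rule nice_Un[OF nice_cls nice_cls])
      fix a b assume ab: "a \<in> cls c" "b \<in> cls d"
      have "rep a = c" "rep b = d" using rep_eq[OF ab(1)] rep_eq[OF ab(2)] rep_idem[OF cd(1)] rep_idem[OF cd(2)] by simp_all
      then show "a < b" using rep_less_rev ab cls_sub cd(3) by blast
    qed
    ultimately have "rel c d" unfolding rel_def using nice_subset by blast
    then have "d \<in> cls c" using cI by (simp add: cls_def)
    then have "rep c = rep d" using rep_eq by simp
    then show False using rep_idem[OF cd(1)] rep_idem[OF cd(2)] cd(3) by simp
  qed
qed

definition over :: "real set \<Rightarrow> real set" where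
  "over J = X \<inter> \<pi> -` J"

text \<open>The colour of a class records the type, \<open>A\<close> included, of the sum over it,
  together with its kind. Finitely many values suffice because there are finitely many types and
  \<open>T\<close> is finite.\<close>

lemma ex_class_colouring:
  "\<exists>h::real \<Rightarrow> nat. finite (range h) \<and> (\<forall>c d. h c = h d \<longrightarrow>
    eqv n (over (cls c)) (A # As) (over (cls d)) (A # As) \<and> kind_of f (cls c) = kind_of f (cls d))"
proof -
  obtain tp :: "real set \<times> real set list \<Rightarrow> nat" where tp: "finite (range tp)"
    "\<And>X As' Y Bs'. length As' = length (A # As) \<and> length Bs' = length (A # As) \<and> tp (X, As') = tp (Y, Bs') \<longrightarrow> eqv n X As' Y Bs'"
    using eqv_finite_code[of "length (A # As)" n] by metis
  define ends where "ends = insert {} ((\<lambda>t. {t}) ` T)"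
  have "finite ends" using finT by (simp add: ends_def)
  define F where "F c = (tp (over (cls c), A # As), kind_of f (cls c))" for c
  have kinds: "kind_of f (cls c) \<in> ends \<times> ends \<times> UNIV" for c
  proof -
    have "f ` cls c \<subseteq> T" using cd cls_sub[of c] by (auto simp: colour_dense_def)
    then have "min_colour f (cls c) \<in> ends" "max_colour f (cls c) \<in> ends"
      using min_colour_cases[of f "cls c" T] max_colour_cases[of f "cls c" T] by (auto simp: ends_def)
    then show ?thesis by (simp add: kind_of_def)
  qed
  have "F c \<in> range tp \<times> ends \<times> ends \<times> UNIV" for c using kinds[of c] unfolding F_def by blast
  then have "range F \<subseteq> range tp \<times> ends \<times> ends \<times> UNIV" by blast
  moreover have "finite (range tp \<times> ends \<times> ends \<times> (UNIV :: bool set))" using tp(1) \<open>finite ends\<close> by simp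
  ultimately have "finite (range F)" by (rule finite_subset)
  from ex_finite_code[OF this] obtain h :: "real \<Rightarrow> nat" where h: "finite (range h)" "\<And>x y. h x = h y \<longleftrightarrow> F x = F y"
    by metis
  have "eqv n (over (cls c)) (A # As) (over (cls d)) (A # As) \<and> kind_of f (cls c) = kind_of f (cls d)" if "h c = h d" for c d
  proof -
    have "F c = F d" using that h(2) by simp
    then show ?thesis using tp(2)[of "A # As" "A # As" "over (cls c)" "over (cls d)"] by (simp add: F_def)
  qed
  then show ?thesis using h(1) by blast
qed

text \<open>Here \<open>J\<close> is a shuffle of whole classes. Decompose \<open>J'\<close> into
  pieces with the kinds of these classes, each label dense. Over every piece the goodness of a class
  with that label gives an answer that makes the piece equivalent to the class. The induction
  hypothesis then compares the two shuffles.\<close>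

lemma good_shuffle:
  assumes h: "finite (range h)" "\<And>c d. h c = h d \<Longrightarrow>
      eqv n (over (cls c)) (A # As) (over (cls d)) (A # As) \<and> kind_of f (cls c) = kind_of f (cls d)"
    and J: "convex_in I J" "J \<noteq> {}" "no_min (rep ` J)" "no_max (rep ` J)"
    and hd: "colour_dense H h (rep ` J)"
  shows "good J"
  unfolding good_def
proof (intro allI impI)
  fix J' assume J': "convex_in I' J'" "J' \<noteq> {}" and kind: "kind_of f J = kind_of f' J'"
  have JI: "J \<subseteq> I" using J(1) by (simp add: convex_in_def)
  have nmin: "no_min J"
    unfolding no_min_def
  proof
    fix x assume x: "x \<in> J"
    then obtain y where "y \<in> J" "rep y < rep x" using J(3) unfolding no_min_def by blast
    then show "\<exists>y\<in>J. y < x" using rep_less_rev[of y x] JI x by blast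
  qed
  have nmax: "no_max J"
    unfolding no_max_def
  proof
    fix x assume x: "x \<in> J"
    then obtain y where "y \<in> J" "rep x < rep y" using J(4) unfolding no_max_def by blast
    then show "\<exists>y\<in>J. x < y" using rep_less_rev[of x y] JI x by blast
  qed
  have noend: "no_endpoints J" "no_endpoints (rep ` J)" using nmin nmax J(3,4) by (simp_all add: no_endpoints_iff)
  have noend': "no_endpoints J'"
    using kind_of_eqD(1,2)[OF kind] min_colour_emptyI[OF nmin, of f] max_colour_emptyI[OF nmax, of f]
      min_colour_no_min[of f' J'] max_colour_no_max[of f' J'] by (simp add: no_endpoints_iff)
  have ne: "rep ` J \<noteq> {}" using J(2) by blast
  have RJ: "rep ` J \<subseteq> R" "rep ` J \<subseteq> I" using JI R_sub by blast+
  \<comment> \<open>As there is neither a first nor a last class, each class that meets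
    \<open>J\<close> lies between points of \<open>J\<close> and hence inside
    \<open>J\<close>.\<close>
  have cls_J: "J \<inter> rep -` {c} = cls c" if c: "c \<in> rep ` J" for c
  proof (intro equalityI subsetI)
    fix x assume "x \<in> J \<inter> rep -` {c}"
    then show "x \<in> cls c" using rep_fibre[of c] c JI by blast
  next
    fix x assume x: "x \<in> cls c"
    have xI: "x \<in> I" and rx: "rep x = c" using rep_fibre[of c] c JI x by blast+
    obtain y z where yz: "y \<in> J" "rep y < c" "z \<in> J" "c < rep z"
      using J(3,4) c unfolding no_min_def no_max_def by blast
    then have "y < x" "x < z" using rep_less_rev[of y x] rep_less_rev[of x z] xI rx JI by auto
    then have "x \<in> J" using J(1) yz xI unfolding convex_in_def by blast
    then show "x \<in> J \<inter> rep -` {c}" using rx by simp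
  qed
  have h_all: "\<exists>c\<in>rep ` J. h c = k" if "k \<in> H" for k
    using colour_dense_all_colours[OF hd ne noend(2) that] .
  \<comment> \<open>A model class for each colour; its kind is prescribed on the right, and its
    answer is used there.\<close>
  define wit where "wit k = (SOME c. c \<in> rep ` J \<and> h c = k)" for k
  have wit: "wit k \<in> rep ` J \<and> h (wit k) = k" if k: "k \<in> H" for k
    unfolding wit_def using h_all[OF k] by (intro someI_ex[of "\<lambda>c. c \<in> rep ` J \<and> h c = k"]) blast
  have hH: "h c \<in> H" if "c \<in> rep ` J" for c using hd that unfolding colour_dense_def by blast
  define \<kappa> where "\<kappa> k = kind_of f (cls (wit k))" for k
  have \<kappa>_h: "\<kappa> (h c) = kind_of f (cls c)" if "c \<in> rep ` J" for c
    using h(2)[of "wit (h c)" c] wit[OF hH[OF that]] by (simp add: \<kappa>_def)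
  have "finite H"
  proof -
    have "H \<subseteq> range h" using h_all by blast
    then show ?thesis using h(1) by (rule finite_subset)
  qed
  moreover have "H \<noteq> {}" using hH ne by blast
  moreover have "valid_kind T (\<kappa> k)" for k
    unfolding \<kappa>_def using cd cls_sub[of "wit k"] by (intro valid_kind_of) (auto simp: colour_dense_def)
  \<comment> \<open>If the kind \<open>({t}, {t}, True)\<close> is missing for some
    \<open>t\<close>, take a point of \<open>J\<close> with colour \<open>t\<close>: its class
    cannot be a single point, so some kind has several points.\<close>
  moreover have "(\<exists>k\<in>H. \<not> snd (snd (\<kappa> k))) \<or> (\<forall>t\<in>T. \<exists>k\<in>H. \<kappa> k = ({t}, {t}, True))"
  proof (rule disjCI)
    assume no: "\<not> (\<forall>t\<in>T. \<exists>k\<in>H. \<kappa> k = ({t}, {t}, True))"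
    then obtain t where t: "t \<in> T" "\<And>k. k \<in> H \<Longrightarrow> \<kappa> k \<noteq> ({t}, {t}, True)" by blast
    obtain x where x: "x \<in> J" "f x = t"
      using colour_dense_all_colours[OF convex_in_props(1)[OF J(1)] J(2) noend(1) t(1)] by blast
    have c: "rep x \<in> rep ` J" using x(1) by blast
    have "\<not> snd (snd (\<kappa> (h (rep x))))"
    proof
      assume "snd (snd (\<kappa> (h (rep x))))"
      then have "\<exists>z. cls (rep x) = {z}" unfolding \<kappa>_h[OF c] kind_of_def by simp
      then obtain z where z: "cls (rep x) = {z}" ..
      have "x \<in> cls (rep x)" using cls_J[OF c] x(1) by blast
      then have "cls (rep x) = {x}" using z by simp
      then have "\<kappa> (h (rep x)) = ({t}, {t}, True)" unfolding \<kappa>_h[OF c] using x(2) by (simp add: kind_of_singleton)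
      then show False using t(2)[OF hH[OF c]] by simp
    qed
    then show "\<exists>k\<in>H. \<not> snd (snd (\<kappa> k))" using hH[OF c] by blast
  qed
  ultimately have "\<exists>\<rho> h'. mono_on J' \<rho> \<and> \<rho> ` J' \<subseteq> J' \<and> no_endpoints (\<rho> ` J') \<and> colour_dense H h' (\<rho> ` J') \<and>
    (\<forall>c\<in>\<rho> ` J'. kind_of f' (J' \<inter> \<rho> -` {c}) = \<kappa> (h' c))"
    by (intro ex_decomposition[OF convex_in_props'(1,3)[OF J'(1)] J'(2) noend'])
  then obtain \<rho> h' where \<rho>: "mono_on J' \<rho>" "\<rho> ` J' \<subseteq> J'" "no_endpoints (\<rho> ` J')" "colour_dense H h' (\<rho> ` J')"
    "\<And>c. c \<in> \<rho> ` J' \<Longrightarrow> kind_of f' (J' \<inter> \<rho> -` {c}) = \<kappa> (h' c)" by blast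
  have h'H: "h' c \<in> H" if "c \<in> \<rho> ` J'" for c using \<rho>(4) that unfolding colour_dense_def by blast
  have "\<forall>c. \<exists>B. c \<in> \<rho> ` J' \<longrightarrow>
      eqv n (over (cls (wit (h' c)))) (A # As) (Y \<inter> \<pi>' -` (J' \<inter> \<rho> -` {c})) (B # Bs)"
  proof
    fix c
    show "\<exists>B. c \<in> \<rho> ` J' \<longrightarrow>
      eqv n (over (cls (wit (h' c)))) (A # As) (Y \<inter> \<pi>' -` (J' \<inter> \<rho> -` {c})) (B # Bs)"
    proof (cases "c \<in> \<rho> ` J'")
      case True
      have w: "wit (h' c) \<in> rep ` J" using wit[OF h'H[OF True]] by blast
      have "wit (h' c) \<in> cls (wit (h' c))" using self_in_cls w RJ(2) by blast
      then have "good (cls (wit (h' c)))" using niceD[OF nice_cls convex_cls] by blast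
      moreover have "J' \<inter> \<rho> -` {c} \<noteq> {}" using True by auto
      moreover have "kind_of f (cls (wit (h' c))) = kind_of f' (J' \<inter> \<rho> -` {c})"
        using \<rho>(5)[OF True] by (simp add: \<kappa>_def)
      ultimately show ?thesis
        using goodD[of "cls (wit (h' c))" "J' \<inter> \<rho> -` {c}"] convex_in_Int_vimage[OF J'(1) \<rho>(1)]
        unfolding over_def by blast
    qed blast
  qed
  from choice[OF this] obtain b where b: "\<And>c. c \<in> \<rho> ` J' \<Longrightarrow>
      eqv n (over (cls (wit (h' c)))) (A # As) (Y \<inter> \<pi>' -` (J' \<inter> \<rho> -` {c})) (b c # Bs)" by blast
  define B where "B = {y. y \<in> b (\<rho> (\<pi>' y))}"
  have fib: "eqv n (over J \<inter> (\<lambda>x. rep (\<pi> x)) -` {c}) (A # As)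
      (Y \<inter> \<pi>' -` J' \<inter> (\<lambda>y. \<rho> (\<pi>' y)) -` {c'}) (B # Bs)"
    if c: "c \<in> rep ` J" "c' \<in> \<rho> ` J'" "h c = h' c'" for c c'
  proof -
    have "over J \<inter> (\<lambda>x. rep (\<pi> x)) -` {c} = over (J \<inter> rep -` {c})" by (auto simp: over_def)
    then have e1: "over J \<inter> (\<lambda>x. rep (\<pi> x)) -` {c} = over (cls c)" using cls_J[OF c(1)] by simp
    have e2: "Y \<inter> \<pi>' -` J' \<inter> (\<lambda>y. \<rho> (\<pi>' y)) -` {c'} = Y \<inter> \<pi>' -` (J' \<inter> \<rho> -` {c'})" by auto
    \<comment> \<open>The comparison goes through the model class: \<open>cls c\<close> has its type
      because the colours agree, and the piece over \<open>c'\<close> was matched with it.\<close>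
    have "h (wit (h' c')) = h c" using wit[OF h'H[OF c(2)]] c(3) by simp
    then have "eqv n (over (cls c)) (A # As) (over (cls (wit (h' c')))) (A # As)"
      using h(2)[of c "wit (h' c')"] by simp
    from eqv_trans[OF this b[OF c(2)]]
    show ?thesis unfolding e1 e2 by (rule eqv_cong_hd) (auto simp: B_def)
  qed
  have m1: "mono_on (over J) (\<lambda>x. rep (\<pi> x))"
    by (intro mono_onI rep_mono mono_onD[OF \<pi>(1)]) (use JI in \<open>auto simp: over_def\<close>)
  have m2: "mono_on (Y \<inter> \<pi>' -` J') (\<lambda>y. \<rho> (\<pi>' y))"
    using mono_onD[OF \<pi>'(1)] mono_onD[OF \<rho>(1)] by (intro mono_onI) simp
  have i1: "(\<lambda>x. rep (\<pi> x)) ` over J \<subseteq> rep ` J" by (auto simp: over_def)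
  have i2: "(\<lambda>y. \<rho> (\<pi>' y)) ` (Y \<inter> \<pi>' -` J') \<subseteq> \<rho> ` J'" by auto
  have k1: "small_on_thin (rep ` J)" using small_on_thin_subset[OF I(3) RJ(2)] .
  have k2: "small_on_thin (\<rho> ` J')" using small_on_thin_subset[OF convex_in_props'(3)[OF J'(1)] \<rho>(2)] .
  have l: "length (A # As) = length (B # Bs)" using len by simp
  have ne': "\<rho> ` J' \<noteq> {}" using J'(2) by blast
  have "eqv n (over J) (A # As) (Y \<inter> \<pi>' -` J') (B # Bs)"
    using claim[unfolded shuffle_claim_def, rule_format, OF \<open>finite H\<close> l hd ne noend(2) k1 m1 i1 \<rho>(4) ne' \<rho>(3) k2 m2 i2] fib
    by blast
  then show "\<exists>B. eqv n (X \<inter> \<pi> -` J) (A # As) (Y \<inter> \<pi>' -` J') (B # Bs)" unfolding over_def by blast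
qed

lemma convex_rep_image:
  assumes "convex_in I J"
  shows "convex_in R (rep ` J)"
  unfolding convex_in_def
proof (intro conjI ballI impI)
  have JI: "J \<subseteq> I" using assms by (simp add: convex_in_def)
  then show "rep ` J \<subseteq> R" by blast
  fix a b c assume abc: "a \<in> rep ` J" "b \<in> rep ` J" "c \<in> R" "a < c \<and> c < b"
  obtain x y z where x: "x \<in> J" "a = rep x" and y: "y \<in> J" "b = rep y" and z: "z \<in> I" "c = rep z"
    using abc by blast
  have "x < z" "z < y" using rep_less_rev[of x z] rep_less_rev[of z y] x y z abc(4) JI by auto
  then have "z \<in> J" using assms x y z unfolding convex_in_def by blast
  then show "c \<in> rep ` J" using z by blast
qed

text \<open>With more than one class there is an interval of classes in which all colours that occur
  are dense. It is shown to be nice, so its points would be equivalent although they lie in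
  different classes.\<close>

lemma nice_I: "nice I"
proof (rule ccontr)
  assume not_nice: "\<not> nice I"
  obtain p where p: "p \<in> I" using I(1) by blast
  obtain q where q: "q \<in> I" "q \<notin> cls p" using nice_subset[OF nice_cls, of I p] not_nice by blast
  have "rep p \<noteq> rep q" using rep_eq_iff[OF p q(1)] q(2) by blast
  moreover have "rep p \<in> R" "rep q \<in> R" using p q(1) by blast+
  ultimately obtain a0 b0 where ab0: "a0 \<in> R" "b0 \<in> R" "a0 < b0"
    by (meson linorder_less_linear)
  obtain h :: "real \<Rightarrow> nat" where h: "finite (range h)" "\<And>c d. h c = h d \<Longrightarrow>
      eqv n (over (cls c)) (A # As) (over (cls d)) (A # As) \<and> kind_of f (cls c) = kind_of f (cls d)"
    using ex_class_colouring by blast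
  define cols where "cols = (\<lambda>(a, b). h ` (R \<inter> {a<..<b}))"
  define P where "P ab \<longleftrightarrow> fst ab \<in> R \<and> snd ab \<in> R \<and> fst ab < snd ab" for ab
  have "P (a0, b0)" using ab0 by (simp add: P_def)
  \<comment> \<open>An interval of classes that shows as few colours as possible; every subinterval
    then shows the same ones, which is density.\<close>
  then obtain ab where ab: "P ab" "\<And>cd. P cd \<Longrightarrow> card (cols ab) \<le> card (cols cd)"
    using ex_has_least_nat[of P "(a0, b0)" "\<lambda>ab. card (cols ab)"] by blast
  define a where "a = fst ab"
  define b where "b = snd ab"
  have abR: "a \<in> R" "b \<in> R" "a < b" using ab(1) by (simp_all add: P_def a_def b_def)
  define R0 where "R0 = R \<inter> {a<..<b}"
  define H where "H = h ` R0"
  have "H \<subseteq> range h" by (auto simp: H_def)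
  then have "finite H" using h(1) by (rule finite_subset)
  have full: "h ` (R \<inter> {c<..<d}) = H" if cd: "c \<in> R" "d \<in> R" "c < d" "a \<le> c" "d \<le> b" for c d
  proof (rule card_seteq[OF \<open>finite H\<close>])
    show "h ` (R \<inter> {c<..<d}) \<subseteq> H" unfolding H_def R0_def using cd(4,5) by (intro image_mono) auto
    show "card H \<le> card (h ` (R \<inter> {c<..<d}))"
      using ab(2)[of "(c, d)"] cd(1-3) by (simp add: P_def cols_def H_def R0_def a_def b_def case_prod_beta)
  qed
  have R0_dense: "colour_dense H h R0"
    unfolding colour_dense_def
  proof (intro conjI ballI impI)
    show "h ` R0 \<subseteq> H" by (simp add: H_def)
    fix c d k assume cd: "c \<in> R0" "d \<in> R0" "c < d" "k \<in> H"
    then have "k \<in> h ` (R \<inter> {c<..<d})" using full[of c d] unfolding R0_def by auto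
    then show "\<exists>e\<in>R0. c < e \<and> e < d \<and> h e = k" using cd unfolding R0_def by auto
  qed
  have R0R: "R0 \<subseteq> R" by (auto simp: R0_def)
  have conv0: "convex_in R0 (rep ` J)" if J: "convex_in I J" "rep ` J \<subseteq> R0" for J
    using convex_rep_image[OF J(1)] J(2) R0R unfolding convex_in_def by (meson subsetD)
  have both_open: "good J" if J: "convex_in I J" "J \<noteq> {}" "rep ` J \<subseteq> R0" "no_min (rep ` J)" "no_max (rep ` J)" for J
    using good_shuffle[OF h J(1,2,4,5) colour_dense_convex_in[OF R0_dense conv0[OF J(1,3)]]] by blast
  have split: "good J" if J: "convex_in I J" and J12: "J = J1 \<union> J2" "J1 \<noteq> {}" "J2 \<noteq> {}"
      "\<And>x y. x \<in> J1 \<Longrightarrow> y \<in> J2 \<Longrightarrow> rep x < rep y" "good J1" "good J2" for J J1 J2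
  proof -
    have "x < y" if "x \<in> J1" "y \<in> J2" for x y
      using rep_less_rev[of x y] J12(4)[OF that] that J J12(1) unfolding convex_in_def by blast
    then show ?thesis using good_join[of J1 J2] J J12 by blast
  qed
  have final_conv: "convex_in I {x \<in> J. c < rep x}" "convex_in I {x \<in> J. rep x < c}" if J: "convex_in I J" for J c
  proof -
    have JI: "x \<in> I" if "x \<in> J" for x using J that by (auto simp: convex_in_def)
    show "convex_in I {x \<in> J. c < rep x}"
      unfolding convex_in_def
    proof (intro conjI ballI impI)
      show "{x \<in> J. c < rep x} \<subseteq> I" using JI by blast
      fix x y z assume *: "x \<in> {x \<in> J. c < rep x}" "y \<in> {x \<in> J. c < rep x}" "z \<in> I" "x < z \<and> z < y"
      have "z \<in> J" using J * unfolding convex_in_def by blast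
      moreover have "rep x \<le> rep z" using rep_mono[of x z] * JI by auto
      ultimately show "z \<in> {x \<in> J. c < rep x}" using * by auto
    qed
    show "convex_in I {x \<in> J. rep x < c}"
      unfolding convex_in_def
    proof (intro conjI ballI impI)
      show "{x \<in> J. rep x < c} \<subseteq> I" using JI by blast
      fix x y z assume *: "x \<in> {x \<in> J. rep x < c}" "y \<in> {x \<in> J. rep x < c}" "z \<in> I" "x < z \<and> z < y"
      have "z \<in> J" using J * unfolding convex_in_def by blast
      moreover have "rep z \<le> rep y" using rep_mono[of z y] * JI by auto
      ultimately show "z \<in> {x \<in> J. rep x < c}" using * by auto
    qed
  qed
  \<comment> \<open>A convex set may contain just a part of its first or last class. Such a part is
    good because classes are nice, and it is split off, so that \<open>good_shuffle\<close> is
    applied only to sets without a first or last class.\<close>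
  have class_conv: "good {x \<in> J. rep x = c}" if J: "convex_in I J" and ne: "{x \<in> J. rep x = c} \<noteq> {}" for J c
  proof -
    have JI: "J \<subseteq> I" using J by (simp add: convex_in_def)
    then have cR: "c \<in> R" using ne by blast
    have "mono_on J rep" using rep_mono JI by (intro mono_onI) blast
    then have "convex_in I (J \<inter> rep -` {c})" by (rule convex_in_Int_vimage[OF J])
    moreover have eq: "J \<inter> rep -` {c} = {x \<in> J. rep x = c}" by auto
    moreover have "{x \<in> J. rep x = c} \<subseteq> cls c" using rep_fibre[OF cR] JI by blast
    ultimately show ?thesis using niceD[OF nice_cls] ne by metis
  qed
  have dense: "\<exists>e\<in>R. c < e \<and> e < d" if "c \<in> R" "d \<in> R" "c < d" for c d
    using R_dense that unfolding order_dense_def by blast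
  have right_open: "good J" if J: "convex_in I J" "J \<noteq> {}" "rep ` J \<subseteq> R0" "no_max (rep ` J)" for J
  proof (cases "no_min (rep ` J)")
    case True
    then show ?thesis using both_open J by blast
  next
    case False
    then obtain c where c: "c \<in> rep ` J" "\<And>d. d \<in> rep ` J \<Longrightarrow> c \<le> d" by (auto simp: no_min_def not_less)
    define J1 where "J1 = {x \<in> J. rep x = c}"
    define J2 where "J2 = {x \<in> J. c < rep x}"
    have J2_img: "rep ` J2 = rep ` J \<inter> {c<..}" by (auto simp: J2_def)
    obtain d where d: "d \<in> rep ` J" "c < d" using J(4) c(1) by (auto simp: no_max_def)
    have "J = J1 \<union> J2" unfolding J1_def J2_def using c(2) by force
    moreover have "J1 \<noteq> {}" using c(1) unfolding J1_def by blast
    moreover have "J2 \<noteq> {}" using d unfolding J2_def by blast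
    moreover have "good J1" unfolding J1_def using class_conv[OF J(1)] calculation(2) J1_def by blast
    moreover have "good J2"
    proof (rule both_open)
      show "convex_in I J2" unfolding J2_def by (rule final_conv[OF J(1)])
      show "J2 \<noteq> {}" by fact
      show "rep ` J2 \<subseteq> R0" using J(3) J2_img by blast
      show "no_min (rep ` J2)"
        unfolding no_min_def
      proof
        fix e assume e: "e \<in> rep ` J2"
        then have e': "e \<in> rep ` J" "c < e" using J2_img by auto
        then obtain g where g: "g \<in> R" "c < g" "g < e" using dense[of c e] c(1) J(3) R0R by blast
        then have "g \<in> rep ` J" using convex_rep_image[OF J(1)] c(1) e' unfolding convex_in_def by blast
        then show "\<exists>g\<in>rep ` J2. g < e" using g J2_img by auto
      qed
      show "no_max (rep ` J2)"
        unfolding no_max_def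
      proof
        fix e assume e: "e \<in> rep ` J2"
        then have e': "e \<in> rep ` J" "c < e" using J2_img by auto
        have "\<forall>e\<in>rep ` J. \<exists>g\<in>rep ` J. e < g" using J(4) by (simp only: no_max_def)
        then have "\<exists>g\<in>rep ` J. e < g" using e'(1) by (rule bspec)
        then obtain g where g: "g \<in> rep ` J" "e < g" by (rule bexE)
        then have "g \<in> rep ` J2" unfolding J2_img using e'(2) by simp
        then show "\<exists>g\<in>rep ` J2. e < g" using g(2) by (rule bexI[rotated])
      qed
    qed
    moreover have "rep x < rep y" if "x \<in> J1" "y \<in> J2" for x y using that by (simp add: J1_def J2_def)
    ultimately show ?thesis by (intro split[OF J(1), of J1 J2])
  qed
  have "good J" if J: "convex_in I J" "J \<noteq> {}" "rep ` J \<subseteq> R0" for J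
  proof (cases "no_max (rep ` J)")
    case True
    then show ?thesis using right_open J by blast
  next
    case False
    then obtain c where c: "c \<in> rep ` J" "\<And>d. d \<in> rep ` J \<Longrightarrow> d \<le> c" by (auto simp: no_max_def not_less)
    define J1 where "J1 = {x \<in> J. rep x < c}"
    define J2 where "J2 = {x \<in> J. rep x = c}"
    have J1_img: "rep ` J1 = rep ` J \<inter> {..<c}" by (auto simp: J1_def)
    have J_eq: "J = J1 \<union> J2" unfolding J1_def J2_def using c(2) by force
    have J2_ne: "J2 \<noteq> {}" using c(1) unfolding J2_def by blast
    have good2: "good J2" unfolding J2_def using class_conv[OF J(1)] J2_ne J2_def by blast
    show ?thesis
    proof (cases "J1 = {}")
      case True
      then show ?thesis using J_eq good2 by simp
    next
      case False
      have "good J1"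
      proof (rule right_open)
        show "convex_in I J1" unfolding J1_def by (rule final_conv[OF J(1)])
        show "rep ` J1 \<subseteq> R0" using J(3) J1_img by blast
        show "no_max (rep ` J1)"
          unfolding no_max_def
        proof
          fix e assume e: "e \<in> rep ` J1"
          then have e': "e \<in> rep ` J" "e < c" using J1_img by auto
          then obtain g where g: "g \<in> R" "e < g" "g < c" using dense[of e c] c(1) J(3) R0R by blast
          then have "g \<in> rep ` J" using convex_rep_image[OF J(1)] c(1) e' unfolding convex_in_def by blast
          then show "\<exists>g\<in>rep ` J1. e < g" using g J1_img by auto
        qed
      qed fact
      moreover have "rep x < rep y" if "x \<in> J1" "y \<in> J2" for x y using that by (simp add: J1_def J2_def)
      ultimately show ?thesis by (intro split[OF J(1) J_eq False J2_ne _ _ good2])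
    qed
  qed
  then have nice: "nice {x \<in> I. rep x \<in> R0}" unfolding nice_def by blast
  \<comment> \<open>\<open>R0\<close> excludes \<open>a\<close> and \<open>b\<close>, so two
    representatives strictly between them are needed for a segment over which niceness is
    known.\<close>
  obtain c where c: "c \<in> R" "a < c" "c < b" using dense[OF abR] by blast
  obtain d where d: "d \<in> R" "c < d" "d < b" using dense[OF c(1) abR(2) c(3)] by blast
  have cdI: "c \<in> I" "d \<in> I" using c d R_sub by blast+
  have "seg c d \<subseteq> {x \<in> I. rep x \<in> R0}"
  proof
    fix x assume "x \<in> seg c d"
    then have x: "x \<in> I" "c \<le> x" "x \<le> d" using d(2) by (auto simp: seg_def)
    have "c \<le> rep x" "rep x \<le> d"
      using rep_mono[OF cdI(1) x(1,2)] rep_mono[OF x(1) cdI(2) x(3)] rep_idem[OF c(1)] rep_idem[OF d(1)] by auto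
    then show "x \<in> {x \<in> I. rep x \<in> R0}" using x(1) c(2) d(3) by (auto simp: R0_def)
  qed
  then have "rel c d" unfolding rel_def using nice nice_subset by blast
  then have "d \<in> cls c" using cdI by (simp add: cls_def)
  then have "rep d = rep c" by (rule rep_eq)
  then show False using rep_idem[OF c(1)] rep_idem[OF d(1)] d(2) by simp
qed

lemma ex_response: "\<exists>B. eqv n X (A # As) Y (B # Bs)"
proof -
  have "convex_in I I" "convex_in I' I'" by (auto simp: convex_in_def)
  have "good I" using niceD[OF nice_I \<open>convex_in I I\<close> I(1)] by simp
  moreover have "kind_of f I = kind_of f' I'"
  proof (rule kind_of_eqI)
    have ends: "no_min I" "no_max I" "no_min I'" "no_max I'" using I(2) I'(2) by (simp_all add: no_endpoints_iff)
    show "min_colour f I = min_colour f' I'" "max_colour f I = max_colour f' I'"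
      using ends by (simp_all add: min_colour_emptyI max_colour_emptyI)
    show "(\<exists>x. I = {x}) = (\<exists>x. I' = {x})"
      using no_min_not_singleton[OF ends(1)] no_min_not_singleton[OF ends(3)] by blast
  qed
  ultimately have "\<exists>B. eqv n (X \<inter> \<pi> -` I) (A # As) (Y \<inter> \<pi>' -` I') (B # Bs)"
    using goodD[OF _ \<open>convex_in I' I'\<close> I'(1)] by blast
  moreover have "X \<inter> \<pi> -` I = X" "Y \<inter> \<pi>' -` I' = Y" using \<pi>(2) \<pi>'(2) by auto
  ultimately show ?thesis by simp
qed

end

section \<open>The induction on the depth and the theorem\<close>

lemma shuffle_claim: "shuffle_claim n"
proof (induction n)
  case 0
  show ?case by (rule shuffle_claim_0)
next
  case (Suc n)
  show ?case
    unfolding shuffle_claim_def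
  proof (intro allI impI)
    fix X :: "real set" and As \<pi> and I :: "real set" and f and Y :: "real set" and Bs \<pi>' and I' :: "real set" and f' T
    assume *: "finite T" "length As = length Bs"
      "colour_dense T f I" "I \<noteq> {}" "no_endpoints I" "small_on_thin I" "mono_on X \<pi>" "\<pi> ` X \<subseteq> I"
      "colour_dense T f' I'" "I' \<noteq> {}" "no_endpoints I'" "small_on_thin I'" "mono_on Y \<pi>'" "\<pi>' ` Y \<subseteq> I'"
      and fib: "\<forall>i\<in>I. \<forall>j\<in>I'. f i = f' j \<longrightarrow> eqv (Suc n) (X \<inter> \<pi> -` {i}) As (Y \<inter> \<pi>' -` {j}) Bs"
    have fib1: "eqv (Suc n) (X \<inter> \<pi> -` {i}) As (Y \<inter> \<pi>' -` {j}) Bs"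
      if ij: "i \<in> I" "j \<in> I'" "f i = f' j" for i j
      by (rule fib[THEN bspec, THEN bspec, THEN mp, OF ij])
    have fib2: "eqv (Suc n) (Y \<inter> \<pi>' -` {j}) Bs (X \<inter> \<pi> -` {i}) As"
      if ij: "j \<in> I'" "i \<in> I" "f' j = f i" for i j
      by (rule eqv_sym[OF fib1[OF ij(2,1) ij(3)[symmetric]]])
    show "eqv (Suc n) X As Y Bs"
      unfolding eqv.simps
    proof (intro conjI allI)
      fix A
      interpret shuffle_step n X As \<pi> I f Y Bs \<pi>' I' f' T A
        by (rule shuffle_step.intro; fact Suc * fib1)
      show "\<exists>B. eqv n X (A # As) Y (B # Bs)" by (rule ex_response)
    next
      fix B
      \<comment> \<open>All hypotheses are symmetric in the two sums, so a move on the right is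
        answered by the same argument with the sides exchanged.\<close>
      interpret shuffle_step n Y Bs \<pi>' I' f' X As \<pi> I f T B
        by (rule shuffle_step.intro; fact Suc * *(2)[symmetric] fib2)
      show "\<exists>A. eqv n X (A # As) Y (B # Bs)" using ex_response eqv_sym by blast
    qed
  qed
qed

lemma eqv_small_orders:
  assumes "M \<noteq> {}" "order_dense M" "no_endpoints M" "small_on_thin M"
    and "N \<noteq> {}" "order_dense N" "no_endpoints N" "small_on_thin N"
  shows "eqv n M [] N []"
proof -
  have cd: "colour_dense {0} (\<lambda>_. 0) M" "colour_dense {0} (\<lambda>_. 0) N"
    using assms(2,6) by (auto simp: colour_dense_def order_dense_def)
  have fib: "eqv n (M \<inter> (\<lambda>x. x) -` {i}) [] (N \<inter> (\<lambda>x. x) -` {j}) []" if "i \<in> M" "j \<in> N" for i j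
  proof -
    have "eqv n {i} [] ((\<lambda>_. j) ` {i}) []" by (rule eqv_iso) (auto simp: strict_mono_on_def)
    moreover have "M \<inter> (\<lambda>x. x) -` {i} = {i}" "N \<inter> (\<lambda>x. x) -` {j} = {j}" using that by auto
    ultimately show ?thesis by simp
  qed
  have id: "mono_on S (\<lambda>x. x)" "(\<lambda>x. x) ` S \<subseteq> S" for S :: "real set" by (auto simp: mono_on_def)
  show ?thesis
    using shuffle_claim[of n, unfolded shuffle_claim_def, rule_format, OF _ refl cd(1) assms(1,3,4) id cd(2) assms(5,7,8) id] fib
    by blast
qed

lemma order_dense_Rats: "order_dense (\<rat> :: real set)" "no_endpoints (\<rat> :: real set)"
proof -
  show "order_dense (\<rat> :: real set)" 
    unfolding order_dense_def by (intro ballI impI Rats_dense_in_real)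
  show "no_endpoints (\<rat> :: real set)"
    unfolding no_endpoints_def
  proof
    fix x :: real assume "x \<in> \<rat>"
    then have "x - 1 \<in> \<rat>" "x + 1 \<in> \<rat>" by auto
    then show "(\<exists>y\<in>\<rat>. y < x) \<and> (\<exists>y\<in>\<rat>. x < y)"
      by (intro conjI bexI[of _ "x - 1"] bexI[of _ "x + 1"]) auto
  qed
qed

theorem theorem7p4:
  fixes M :: "real set"
  assumes "M \<noteq> {}"
    and "order_dense M"
    and "no_endpoints M"
    and "\<And>P. perfect_set P \<Longrightarrow> P \<inter> M \<prec> (UNIV :: nat set set)"
  shows "monadic_theory M (<) = monadic_theory (UNIV :: rat set) (<)"
proof (rule monadic_theory_eqI[OF assms(1)])
  show "(UNIV :: rat set) \<noteq> {}" by simp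
  fix n
  have small: "small_on_thin M" "small_on_thin (\<rat> :: real set)"
    using small_on_thin_if_perfect[OF assms(4)] small_on_thin_countable[OF countable_rat] by blast+
  have "(\<rat> :: real set) \<noteq> {}" using Rats_0 by blast
  then have "eqv n M [] (\<rat> :: real set) []"
    using eqv_small_orders[OF assms(1-3) small(1) _ order_dense_Rats small(2)] by blast
  \<comment> \<open>Shuffles are indexed by sets of reals, so the rationals first enter as a subset
    of the reals and are then replaced by an isomorphic copy.\<close>
  moreover have "eqv n (UNIV :: rat set) [] (of_rat ` (UNIV :: rat set)) ([] :: real set list)"
    by (rule eqv_iso) (auto simp: strict_mono_on_def of_rat_less)
  then have "eqv n (\<rat> :: real set) [] (UNIV :: rat set) []"
    unfolding Rats_def by (rule eqv_sym)
  ultimately show "eqv n M [] (UNIV :: rat set) []" by (rule eqv_trans)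
qed

end
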